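(* Let $\mathcal T$ be a weighted naturally oriented tree with root $x_0$, and let $v,v_1,\dots,v_n,w_1,\dots,w_k$, $\mathcal T_1$, $\mathcal T_2$ be as in the context. Let $M=\{m_{vv_2},\dots,m_{vv_n}\}$. Assume $\mathbf w(v)=1$. Then for all $r,d$, $$\beta_{r,d}(R/I(\mathcal T))=\beta_{r,d}(R/I(\mathcal T_1))+\sum_{S\subseteq M}\beta_{r-(|S|+1),\,d-d'}(R/I(\mathcal T_2)),$$ where, for each $S\subseteq M$, $$d'=1+\mathbf w(v_1)+\sum_{m_{vv_i}\in S,\ i\ne n}\mathbf w(v_i)+\begin{cases}1&\text{if } m_{vv_n}\in S,\\0&\text{otherwise.}\end{cases}$$
   Context: A weighted oriented graph is a triple $\mathcal D=(V,E,\mathbf w)$ with $V$ a finite vertex set, $E$ a set of directed edges whose underlying undirected graph is simple, and $\mathbf w:V\to\mathbb N^+$. Its edge ideal is $I(\mathcal D)=(xy^{\mathbf w(y)}\mid(x,y)\in E)$, where $(x,y)$ is the edge oriented from $x$ to $y$; $m_{xy}$ denotes the generator corresponding to the edge between $x$ and $y$ (regardless of its orientation). A weighted naturally oriented tree is a weighted oriented graph whose underlying graph is a tree with a root $x_0$, such that each edge is oriented towards its endpoint further from $x_0$. The rank of a vertex is its distance to $x_0$; $x$ is the predecessor of $z$ if $(x,z)\in E$. Set-up. Let $p$ be the maximal rank of a vertex of $\mathcal T$, let $v_1$ be a vertex of rank $p$, and let $v$ be its predecessor. Let $v_1,\dots,v_n$ be all the neighbors of $v$ (at most one of them is not a leaf).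 Assume exactly one neighbor of $v$ is not a leaf and call it $v_n$. Let $w_1,\dots,w_k$ be the neighbors of $v_n$ other than $v$, and assume that $v_n$ has a predecessor, labelled $w_k$. For $W\subseteq V(\mathcal T)$, $\mathcal T\setminus W$ is the weighted oriented graph obtained from $\mathcal T$ by deleting the vertices in $W$ and all edges incident to them. Put $\mathcal T_1=\mathcal T\setminus\{v_1\}$ and $\mathcal T_2=\mathcal T\setminus\{v,v_1,\dots,v_n\}$. $R$ is the polynomial ring over a field $\Bbbk$ on the vertices of $\mathcal T$ with the standard grading; $\beta_{r,d}(R/J)=\dim_\Bbbk\operatorname{Tor}^R_r(R/J,\Bbbk)_d$ are graded Betti numbers, equal to $0$ for negative $r$ or $d$. *)

theory Defs
  imports
    "HOL-Library.Poly_Mapping"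
    "HOL-Library.Function_Algebras"
    "Graph_Theory.Digraph_Component"
begin

section \<open>Polynomial rings and ideals\<close>

text \<open>A monomial is its exponent vector, and the product of polynomials is the convolution
  product of \<^theory>\<open>HOL-Library.Poly_Mapping\<close>.\<close>

type_synonym ('v, 'k) mpoly = "('v \<Rightarrow>\<^sub>0 nat) \<Rightarrow>\<^sub>0 'k"

text \<open>\<open>polys V\<close> is the polynomial ring over \<open>'k\<close> in the variables \<open>V\<close>.\<close>

definition polys :: "'v set \<Rightarrow> ('v, 'k::field) mpoly set" where
  "polys V = {f. \<forall>m \<in> Poly_Mapping.keys f. Poly_Mapping.keys m \<subseteq> V}"

definition monom_deg :: "('v \<Rightarrow>\<^sub>0 nat) \<Rightarrow> nat" where
  "monom_deg m = (\<Sum>x \<in> Poly_Mapping.keys m. Poly_Mapping.lookup m x)"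

text \<open>The zero polynomial is homogeneous of every degree, and the only one of negative degree.\<close>

definition homogeneous :: "int \<Rightarrow> ('v, 'k::field) mpoly \<Rightarrow> bool" where
  "homogeneous d f \<longleftrightarrow> (\<forall>m \<in> Poly_Mapping.keys f. int (monom_deg m) = d)"

definition ideal_gen :: "'v set \<Rightarrow> ('v, 'k::field) mpoly set \<Rightarrow> ('v, 'k) mpoly set" where
  "ideal_gen V B = {\<Sum>g\<in>A. c g * g | A c. finite A \<and> A \<subseteq> B \<and> (\<forall>g\<in>A. c g \<in> polys V)}"


section \<open>Graded free resolutions and graded Betti numbers\<close>

text \<open>
  The data of a complex \<open>\<dots> \<rightarrow> F\<^sub>1 \<rightarrow> F\<^sub>0 \<rightarrow> R/J\<close> with
  \<open>F\<^sub>i\<close> the direct sum of the \<open>R(-shift i j)\<close> for \<open>j < frank i\<close>.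
  The map \<open>F\<^sub>i\<^sub>+\<^sub>1 \<rightarrow> F\<^sub>i\<close> has the matrix \<open>dmat i\<close>
  (row \<open>l < frank i\<close>, column \<open>j < frank (Suc i)\<close>), and \<open>aug j\<close> is a representative in \<open>R\<close> of the
  image in \<open>R/J\<close> of the \<open>j\<close>-th basis element of \<open>F\<^sub>0\<close>.
\<close>

record (overloaded) ('v, 'k::zero) free_complex =
  frank :: "nat \<Rightarrow> nat"
  shift :: "nat \<Rightarrow> nat \<Rightarrow> int"
  dmat :: "nat \<Rightarrow> nat \<Rightarrow> nat \<Rightarrow> ('v, 'k) mpoly"
  aug :: "nat \<Rightarrow> ('v, 'k) mpoly"

definition free_mod :: "'v set \<Rightarrow> nat \<Rightarrow> (nat \<Rightarrow> ('v, 'k::field) mpoly) set" where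
  "free_mod V n = {x. (\<forall>j<n. x j \<in> polys V) \<and> (\<forall>j\<ge>n. x j = 0)}"

definition dmap :: "('v, 'k::field) free_complex \<Rightarrow> nat \<Rightarrow>
    (nat \<Rightarrow> ('v, 'k) mpoly) \<Rightarrow> nat \<Rightarrow> ('v, 'k) mpoly" where
  "dmap F i x = (\<lambda>l. if l < frank F i then \<Sum>j<frank F (Suc i). dmat F i l j * x j else 0)"

definition augmap :: "('v, 'k::field) free_complex \<Rightarrow>
    (nat \<Rightarrow> ('v, 'k) mpoly) \<Rightarrow> ('v, 'k) mpoly" where
  "augmap F x = (\<Sum>j<frank F 0. aug F j * x j)"

text \<open>\<open>F\<close> is a graded resolution of \<open>R/J\<close> by free modules of finite rank, where
  \<open>R = polys V\<close>; all maps are homogeneous of degree \<open>0\<close>. It may be infinite and need not be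
  minimal.\<close>

definition graded_free_resolution ::
    "'v set \<Rightarrow> ('v, 'k::field) mpoly set \<Rightarrow> ('v, 'k) free_complex \<Rightarrow> bool" where
  "graded_free_resolution V J F \<longleftrightarrow>
     (\<forall>i. \<forall>l<frank F i. \<forall>j<frank F (Suc i).
        dmat F i l j \<in> polys V \<and> homogeneous (shift F (Suc i) j - shift F i l) (dmat F i l j)) \<and>
     (\<forall>j<frank F 0. aug F j \<in> polys V \<and> homogeneous (shift F 0 j) (aug F j)) \<and>
     (\<forall>f \<in> polys V. \<exists>x \<in> free_mod V (frank F 0). f - augmap F x \<in> J) \<and>
     (\<forall>x \<in> free_mod V (frank F 0).
        augmap F x \<in> J \<longleftrightarrow> (\<exists>y \<in> free_mod V (frank F 1). dmap F 0 y = x)) \<and>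
     (\<forall>i. \<forall>x \<in> free_mod V (frank F (Suc i)).
        dmap F i x = 0 \<longleftrightarrow> (\<exists>y \<in> free_mod V (frank F (Suc (Suc i))). dmap F (Suc i) y = x))"

text \<open>
  Tensoring with the residue field \<open>k = R/(x | x \<in> V)\<close> turns \<open>F\<^sub>i\<close> into the vector space
  with basis \<open>{..<frank i}\<close> and reduces the matrices modulo the variables, that is, replaces each
  entry by its constant coefficient.
\<close>

definition tensor_comp :: "('v, 'k::field) free_complex \<Rightarrow> nat \<Rightarrow> int \<Rightarrow> (nat \<Rightarrow> 'k) set" where
  "tensor_comp F i d = {c. \<forall>j. c j \<noteq> 0 \<longrightarrow> j < frank F i \<and> shift F i j = d}"

definition tensor_dmap :: "('v, 'k::field) free_complex \<Rightarrow> nat \<Rightarrow> (nat \<Rightarrow> 'k) \<Rightarrow> nat \<Rightarrow> 'k" where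
  "tensor_dmap F i c =
     (\<lambda>l. if l < frank F i then \<Sum>j<frank F (Suc i). Poly_Mapping.lookup (dmat F i l j) 0 * c j else 0)"

definition tensor_cycles :: "('v, 'k::field) free_complex \<Rightarrow> nat \<Rightarrow> int \<Rightarrow> (nat \<Rightarrow> 'k) set" where
  "tensor_cycles F r d =
     {c \<in> tensor_comp F r d. case r of 0 \<Rightarrow> True | Suc i \<Rightarrow> tensor_dmap F i c = 0}"

definition tensor_boundaries :: "('v, 'k::field) free_complex \<Rightarrow> nat \<Rightarrow> int \<Rightarrow> (nat \<Rightarrow> 'k) set" where
  "tensor_boundaries F r d = tensor_dmap F r ` tensor_comp F (Suc r) d"

abbreviation kdim :: "(nat \<Rightarrow> 'k::field) set \<Rightarrow> nat" where
  "kdim \<equiv> vector_space.dim (\<lambda>(a::'k) c j. a * c j)"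

text \<open>The dimension of the degree \<open>d\<close> part of the \<open>r\<close>-th homology of \<open>F \<otimes> k\<close>. The boundaries
  are a subspace of the finite-dimensional space of cycles, so the subtraction does not
  truncate.\<close>

definition tor_dim :: "('v, 'k::field) free_complex \<Rightarrow> nat \<Rightarrow> int \<Rightarrow> nat" where
  "tor_dim F r d = kdim (tensor_cycles F r d) - kdim (tensor_boundaries F r d)"

text \<open>
  \<open>graded_betti V J r d\<close> is the dimension of the degree \<open>d\<close> part of \<open>Tor\<^sub>r(R/J, k)\<close> over
  \<open>R = polys V\<close>, computed as usual from some graded free resolution of \<open>R/J\<close>: the dimension
  does not depend on the resolution, and one exists for every homogeneous ideal \<open>J\<close> if \<open>V\<close> is
  finite.
\<close>

definition graded_betti :: "'v set \<Rightarrow> ('v, 'k::field) mpoly set \<Rightarrow> int \<Rightarrow> int \<Rightarrow> nat" where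
  "graded_betti V J r d =
     (if r < 0 \<or> d < 0 then 0
      else tor_dim (SOME F. graded_free_resolution V J F) (nat r) d)"


section \<open>Weighted oriented graphs and trees\<close>

locale weighted_oriented_graph = pair_digraph G for G :: "'v pair_pre_digraph" +
  fixes w :: "'v \<Rightarrow> nat"
  assumes oriented: "(x, y) \<in> parcs G \<Longrightarrow> (y, x) \<notin> parcs G"
    and weight_pos: "x \<in> pverts G \<Longrightarrow> 0 < w x"

text \<open>The underlying undirected graph is the symmetric digraph \<^const>\<open>mk_symmetric\<close>. In it
  each edge is a closed walk of length 2, which is a \<^const>\<open>pre_digraph.cycle\<close>; hence the bound
  on the length. (So the notion \<^const>\<open>tree\<close> of digraphs is not the one needed here.)\<close>

definition underlying_tree :: "'v pair_pre_digraph \<Rightarrow> bool" where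
  "underlying_tree G \<longleftrightarrow> Digraph_Component.connected G \<and>
     \<not> (\<exists>p. pre_digraph.cycle (mk_symmetric G) p \<and> 3 \<le> length p)"

definition neighbors :: "'v pair_pre_digraph \<Rightarrow> 'v \<Rightarrow> 'v set" where
  "neighbors G x = {y. (x, y) \<in> parcs (mk_symmetric G)}"

definition leaf :: "'v pair_pre_digraph \<Rightarrow> 'v \<Rightarrow> bool" where
  "leaf G x \<longleftrightarrow> card (neighbors G x) = 1"

definition graph_dist :: "'v pair_pre_digraph \<Rightarrow> 'v \<Rightarrow> 'v \<Rightarrow> nat" where
  "graph_dist G x y = (LEAST n. (x, y) \<in> parcs (mk_symmetric G) ^^ n)"

definition weighted_naturally_oriented_tree ::
    "'v pair_pre_digraph \<Rightarrow> ('v \<Rightarrow> nat) \<Rightarrow> 'v \<Rightarrow> bool" where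
  "weighted_naturally_oriented_tree G w x0 \<longleftrightarrow>
     weighted_oriented_graph G w \<and> underlying_tree G \<and> x0 \<in> pverts G \<and>
     (\<forall>(x, y) \<in> parcs G. graph_dist G x0 x < graph_dist G x0 y)"

definition del_verts :: "'v pair_pre_digraph \<Rightarrow> 'v set \<Rightarrow> 'v pair_pre_digraph" where
  "del_verts G W = \<lparr> pverts = pverts G - W,
     parcs = {(x, y) \<in> parcs G. x \<notin> W \<and> y \<notin> W} \<rparr>"

definition arc_monomial :: "('v \<Rightarrow> nat) \<Rightarrow> 'v \<Rightarrow> 'v \<Rightarrow> ('v, 'k::field) mpoly" where
  "arc_monomial w x y =
     Poly_Mapping.single (Poly_Mapping.single x 1 + Poly_Mapping.single y (w y)) 1"

text \<open>The generator belonging to the edge between \<open>x\<close> and \<open>y\<close>, whatever its orientation.\<close>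

definition edge_gen ::
    "'v pair_pre_digraph \<Rightarrow> ('v \<Rightarrow> nat) \<Rightarrow> 'v \<Rightarrow> 'v \<Rightarrow> ('v, 'k::field) mpoly" where
  "edge_gen G w x y = (if (x, y) \<in> parcs G then arc_monomial w x y else arc_monomial w y x)"

text \<open>The edge ideal of \<open>G\<close> as an ideal of \<open>polys V\<close>. For a subgraph of a graph with vertex set
  \<open>V\<close>, the ambient ring thus remains that of the large graph.\<close>

definition edge_ideal ::
    "'v set \<Rightarrow> 'v pair_pre_digraph \<Rightarrow> ('v \<Rightarrow> nat) \<Rightarrow> ('v, 'k::field) mpoly set" where
  "edge_ideal V G w = ideal_gen V {arc_monomial w x y | x y. (x, y) \<in> parcs G}"

end

theory Submission
  imports Defs
begin

text \<open>Write \<open>R\<close> for the polynomial ring, \<open>J\<close> for the edge ideal of \<open>T1\<close>, and put \<open>u = v\<close> and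
  \<open>q = v\<^sub>1 ^ w(v\<^sub>1)\<close>. The vertex \<open>v\<^sub>1\<close> is a leaf below \<open>v\<close>, so the edge ideal of \<open>T\<close> is
  \<open>J + (u q)\<close>. The variable \<open>v\<^sub>1\<close> does not occur in the generators of \<open>J\<close>, hence
  \<open>J : (u q) = J : u\<close>. As \<open>w(v) = 1\<close> and \<open>v\<^sub>n\<close> is the predecessor of \<open>v\<close>, cancelling \<open>v\<close> turns
  the generators at \<open>v\<close> into \<open>v\<^sub>i ^ w(v\<^sub>i)\<close> for \<open>2 \<le> i < n\<close> and into \<open>v\<^sub>n\<close>. All other generators at
  \<open>v\<^sub>n\<close> are multiples of \<open>v\<^sub>n\<close>, so \<open>J : u\<close> is generated by the edge ideal of \<open>T2\<close> and by these powers
  of variables, none of which is a vertex of \<open>T2\<close>.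

  Both uses of this description rest on one statement about adding a generator,
  \<open>graded_betti_add_principal\<close>. Let \<open>J : u = J : (u q)\<close>, where \<open>q\<close> has no constant term, and let
  \<open>F\<close> and \<open>G\<close> be resolutions of \<open>R/J\<close> and \<open>R/(J : u)\<close>. Multiplication by \<open>u\<close> lifts to a chain map
  \<open>\<phi>\<close> from \<open>G\<close> to \<open>F\<close>, and then \<open>q \<phi>\<close> lifts multiplication by \<open>u q\<close>. Its mapping cone resolves
  \<open>R/(J + (u q))\<close>, because \<open>R/(J : (u q)) \<rightarrow> R/J\<close> is injective with this cokernel. All entries of
  \<open>q \<phi>\<close> vanish modulo the variables, so after reduction the cone is the direct sum of \<open>F\<close> and the
  shifted \<open>G\<close>, and Betti numbers add up. With \<open>u = v\<close> this splits off \<open>R/J\<close>. With \<open>u = 1\<close> it adjoins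
  the powers of variables to the edge ideal of \<open>T2\<close> one after the other. Each of them doubles the
  number of summands, which yields the sum over all subsets (\<open>graded_betti_regular_monomials\<close>).

  Two facts make Betti numbers accessible at all, as they are computed from an arbitrary resolution.
  They do not depend on it (\<open>tor_dim_unique\<close>): for two resolutions of \<open>R/J\<close> the cone of a lift of
  multiplication by \<open>1\<close> resolves \<open>R/R = 0\<close>, a resolution of \<open>0\<close> is contractible, and so the cone stays
  exact after reduction. And resolutions exist for monomial ideals (\<open>mon_ideal_resolution\<close>):
  induction on the number of generators, with the same cone, works because the colon ideal by a
  monomial does not need more generators.

  The tree enters only through the uniqueness of predecessors
  (\<open>natural_tree_unique_predecessor\<close>), which determines the orientation of all edges at \<open>v\<close>.\<close>

section \<open>Homogeneous polynomials\<close>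

lemma monom_deg_superset:
  assumes "finite A" "Poly_Mapping.keys m \<subseteq> A"
  shows "monom_deg m = (\<Sum>x\<in>A. Poly_Mapping.lookup m x)"
  unfolding monom_deg_def using assms
  by (intro sum.mono_neutral_left) (auto simp: in_keys_iff)

lemma monom_deg_zero [simp]: "monom_deg 0 = 0"
  by (simp add: monom_deg_def)

lemma monom_deg_single [simp]: "monom_deg (Poly_Mapping.single x e) = e"
  by (cases "e = 0") (simp_all add: monom_deg_def)

lemma monom_deg_add: "monom_deg (a + b) = monom_deg a + monom_deg b"
proof -
  let ?A = "Poly_Mapping.keys a \<union> Poly_Mapping.keys b"
  have "Poly_Mapping.keys (a + b) \<subseteq> ?A"
    by (rule keys_add)
  then show ?thesis
    by (simp add: monom_deg_superset[of ?A] lookup_add sum.distrib)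
qed

lemma monom_add_eq_0_iff: "(a :: 'v \<Rightarrow>\<^sub>0 nat) + b = 0 \<longleftrightarrow> a = 0 \<and> b = 0"
  by (auto simp: poly_mapping_eq_iff lookup_add fun_eq_iff)

lemma keys_uminus_poly: "Poly_Mapping.keys (- (f :: ('v, 'k::field) mpoly)) = Poly_Mapping.keys f"
  by (auto simp: in_keys_iff)

lemma keys_minus_poly:
  "Poly_Mapping.keys (f - (g :: ('v, 'k::field) mpoly)) \<subseteq> Poly_Mapping.keys f \<union> Poly_Mapping.keys g"
  by (auto simp: in_keys_iff lookup_minus)

lemma polys_0 [simp]: "0 \<in> polys V"
  and polys_1 [simp]: "1 \<in> polys V"
  by (auto simp: polys_def)

lemma polys_add: "f \<in> polys V \<Longrightarrow> g \<in> polys V \<Longrightarrow> f + g \<in> polys V"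
  using keys_add[of f g] by (auto simp: polys_def)

lemma polys_uminus: "f \<in> polys V \<Longrightarrow> - f \<in> polys V"
  by (auto simp: polys_def keys_uminus_poly)

lemma polys_diff: "f \<in> polys V \<Longrightarrow> g \<in> polys V \<Longrightarrow> f - g \<in> polys V"
  using keys_minus_poly[of f g] by (auto simp: polys_def)

lemma polys_mult: "f \<in> polys V \<Longrightarrow> g \<in> polys V \<Longrightarrow> f * g \<in> polys V"
proof -
  assume f: "f \<in> polys V" and g: "g \<in> polys V"
  have "Poly_Mapping.keys m \<subseteq> V" if m: "m \<in> Poly_Mapping.keys (f * g)" for m
  proof -
    from m keys_mult[of f g] obtain a b where "a \<in> Poly_Mapping.keys f" "b \<in> Poly_Mapping.keys g" "m = a + b"
      by auto
    then show ?thesis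
      using f g keys_add[of a b] by (fastforce simp: polys_def)
  qed
  then show ?thesis
    by (simp add: polys_def)
qed

lemma polys_sum: "(\<And>i. i \<in> I \<Longrightarrow> f i \<in> polys V) \<Longrightarrow> sum f I \<in> polys V"
  by (induction I rule: infinite_finite_induct) (auto intro: polys_add)

lemma polys_const: "Poly_Mapping.single 0 c \<in> polys V"
  by (simp add: polys_def)

lemma polys_monom: "Poly_Mapping.keys m \<subseteq> V \<Longrightarrow> Poly_Mapping.single m c \<in> polys V"
  by (simp add: polys_def)

lemma homogeneous_0 [simp]: "homogeneous d 0"
  and homogeneous_1 [simp]: "homogeneous 0 1"
  by (simp_all add: homogeneous_def)

lemma homogeneous_single: "homogeneous (int (monom_deg m)) (Poly_Mapping.single m c)"
  by (simp add: homogeneous_def)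

lemma homogeneous_add: "homogeneous d f \<Longrightarrow> homogeneous d g \<Longrightarrow> homogeneous d (f + g)"
  using keys_add[of f g] by (auto simp: homogeneous_def)

lemma homogeneous_uminus: "homogeneous d f \<Longrightarrow> homogeneous d (- f)"
  by (simp add: homogeneous_def keys_uminus_poly)

lemma homogeneous_diff: "homogeneous d f \<Longrightarrow> homogeneous d g \<Longrightarrow> homogeneous d (f - g)"
  using keys_minus_poly[of f g] by (auto simp: homogeneous_def)

lemma homogeneous_mult: "homogeneous a f \<Longrightarrow> homogeneous b g \<Longrightarrow> homogeneous (a + b) (f * g)"
  using keys_mult[of f g] by (fastforce simp: homogeneous_def monom_deg_add)

lemma homogeneous_mult_eq: "homogeneous a f \<Longrightarrow> homogeneous b g \<Longrightarrow> a + b = c \<Longrightarrow> homogeneous c (f * g)"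
  using homogeneous_mult by blast

lemma homogeneous_sum: "(\<And>i. i \<in> I \<Longrightarrow> homogeneous d (f i)) \<Longrightarrow> homogeneous d (sum f I)"
  by (induction I rule: infinite_finite_induct) (auto intro: homogeneous_add)

definition hcomp :: "int \<Rightarrow> ('v, 'k::field) mpoly \<Rightarrow> ('v, 'k) mpoly" where
  "hcomp d f = Poly_Mapping.mapp (\<lambda>m c. if int (monom_deg m) = d then c else 0) f"

lemma lookup_hcomp:
  "Poly_Mapping.lookup (hcomp d f) m = (if int (monom_deg m) = d then Poly_Mapping.lookup f m else 0)"
  by (auto simp: hcomp_def lookup_mapp when_def in_keys_iff)

lemma hcomp_0 [simp]: "hcomp d 0 = 0"
  by (rule poly_mapping_eqI) (simp add: lookup_hcomp)

lemma hcomp_add: "hcomp d (f + g) = hcomp d f + hcomp d g"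
  by (rule poly_mapping_eqI) (simp add: lookup_hcomp lookup_add)

lemma hcomp_diff: "hcomp d (f - g) = hcomp d f - hcomp d g"
  by (rule poly_mapping_eqI) (simp add: lookup_hcomp lookup_minus)

lemma hcomp_sum: "hcomp d (sum f I) = (\<Sum>i\<in>I. hcomp d (f i))"
  by (induction I rule: infinite_finite_induct) (auto simp: hcomp_add)

lemma homogeneous_hcomp: "homogeneous d (hcomp d f)"
  by (auto simp: homogeneous_def in_keys_iff lookup_hcomp split: if_splits)

lemma keys_hcomp: "Poly_Mapping.keys (hcomp d f) \<subseteq> Poly_Mapping.keys f"
  by (auto simp: in_keys_iff lookup_hcomp split: if_splits)

lemma polys_hcomp: "f \<in> polys V \<Longrightarrow> hcomp d f \<in> polys V"
  using keys_hcomp[of d f] by (auto simp: polys_def)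

lemma hcomp_homogeneous: "homogeneous d f \<Longrightarrow> hcomp d f = f"
  by (rule poly_mapping_eqI) (auto simp: lookup_hcomp homogeneous_def in_keys_iff)

lemma hcomp_mult:
  assumes p: "homogeneous a p"
  shows "hcomp c (p * q) = p * hcomp (c - a) q"
proof -
  \<comment> \<open>The rest of \<open>q\<close> has no terms of degree \<open>c - a\<close>, so it contributes nothing in degree \<open>c\<close>.\<close>
  define q' where "q' = q - hcomp (c - a) q"
  have deg: "int (monom_deg m) \<noteq> c - a" if "m \<in> Poly_Mapping.keys q'" for m
    using that by (auto simp: q'_def in_keys_iff lookup_minus lookup_hcomp)
  have "int (monom_deg m) \<noteq> c" if m: "m \<in> Poly_Mapping.keys (p * q')" for m
  proof -
    obtain x y where "x \<in> Poly_Mapping.keys p" "y \<in> Poly_Mapping.keys q'" "m = x + y"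
      using m keys_mult[of p q'] by auto
    then show ?thesis
      using deg[of y] p by (auto simp: homogeneous_def monom_deg_add)
  qed
  then have "hcomp c (p * q') = 0"
    by (intro poly_mapping_eqI) (auto simp: lookup_hcomp in_keys_iff)
  moreover have "hcomp c (p * hcomp (c - a) q) = p * hcomp (c - a) q"
    by (rule hcomp_homogeneous) (rule homogeneous_mult_eq[OF p homogeneous_hcomp], simp)
  moreover have "p * q = p * hcomp (c - a) q + p * q'"
    by (simp add: q'_def algebra_simps)
  ultimately show ?thesis
    by (simp add: hcomp_add)
qed

abbreviation ccoeff :: "('v, 'k::field) mpoly \<Rightarrow> 'k" where
  "ccoeff f \<equiv> Poly_Mapping.lookup f 0"

text \<open>A product of monomials is constant only if both factors are, so taking the constant
  coefficient is the ring homomorphism from \<open>R\<close> to its residue field.\<close>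

lemma ccoeff_mult_eq_0:
  assumes "ccoeff f = 0" shows "ccoeff (f * g) = 0"
proof -
  have "0 \<notin> Poly_Mapping.keys (f * g)"
  proof
    assume "0 \<in> Poly_Mapping.keys (f * g)"
    then obtain a b where ab: "a \<in> Poly_Mapping.keys f" "0 = a + b"
      using keys_mult[of f g] by auto
    have "a = 0" using ab(2) monom_add_eq_0_iff[of a b] by auto
    then show False
      using ab(1) assms by (simp add: in_keys_iff)
  qed
  then show ?thesis
    by (simp add: in_keys_iff)
qed

text \<open>A product of monomials is constant only if both factors are, so taking the constant
  coefficient is the ring homomorphism from \<open>R\<close> to its residue field.\<close>

lemma ccoeff_mult: "ccoeff (f * g) = ccoeff f * ccoeff g"
proof -
  define a where "a = ccoeff f"
  define b where "b = ccoeff g"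
  define f' where "f' = f - Poly_Mapping.single 0 a"
  define g' where "g' = g - Poly_Mapping.single 0 b"
  have f': "ccoeff f' = 0" and g': "ccoeff g' = 0"
    by (simp_all add: f'_def g'_def a_def b_def lookup_minus)
  have "f * g = f' * g + (g' * Poly_Mapping.single 0 a + Poly_Mapping.single 0 a * Poly_Mapping.single 0 b)"
    by (simp add: f'_def g'_def algebra_simps)
  then show ?thesis
    by (simp add: lookup_add ccoeff_mult_eq_0 f' g' mult_single a_def b_def)
qed

lemma ccoeff_sum: "ccoeff (sum f I) = (\<Sum>i\<in>I. ccoeff (f i))"
  by (rule lookup_sum)

lemma ccoeff_homogeneous: "homogeneous d f \<Longrightarrow> ccoeff f \<noteq> 0 \<Longrightarrow> d = 0"
  by (force simp: homogeneous_def in_keys_iff)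

definition graded_ideal :: "'v set \<Rightarrow> ('v, 'k::field) mpoly set \<Rightarrow> bool" where
  "graded_ideal V J \<longleftrightarrow> J \<subseteq> polys V \<and> 0 \<in> J \<and> (\<forall>f\<in>J. \<forall>g\<in>J. f + g \<in> J) \<and>
     (\<forall>f\<in>J. \<forall>c\<in>polys V. c * f \<in> J) \<and> (\<forall>f\<in>J. \<forall>d. hcomp d f \<in> J)"

lemma graded_idealD:
  assumes "graded_ideal V J"
  shows "J \<subseteq> polys V" "0 \<in> J" "f \<in> J \<Longrightarrow> g \<in> J \<Longrightarrow> f + g \<in> J"
    "f \<in> J \<Longrightarrow> c \<in> polys V \<Longrightarrow> c * f \<in> J" "f \<in> J \<Longrightarrow> hcomp d f \<in> J"
  using assms by (auto simp: graded_ideal_def)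

lemma graded_ideal_uminus:
  assumes J: "graded_ideal V J" and f: "f \<in> J" shows "- f \<in> J"
proof -
  have "(- 1) * f \<in> J"
    by (rule graded_idealD(4)[OF J f]) (rule polys_uminus, simp)
  then show ?thesis by simp
qed

lemma graded_ideal_diff:
  assumes J: "graded_ideal V J" and "f \<in> J" "g \<in> J" shows "f - g \<in> J"
  using graded_idealD(3)[OF J \<open>f \<in> J\<close> graded_ideal_uminus[OF J \<open>g \<in> J\<close>]] by simp

section \<open>Homogeneous matrices\<close>

definition mat_app :: "nat \<Rightarrow> nat \<Rightarrow> (nat \<Rightarrow> nat \<Rightarrow> 'a::comm_ring_1) \<Rightarrow> (nat \<Rightarrow> 'a) \<Rightarrow> nat \<Rightarrow> 'a" where
  "mat_app a b A x = (\<lambda>l. if l < a then \<Sum>j<b. A l j * x j else 0)"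

definition mat_mul :: "nat \<Rightarrow> (nat \<Rightarrow> nat \<Rightarrow> 'a::comm_ring_1) \<Rightarrow> (nat \<Rightarrow> nat \<Rightarrow> 'a) \<Rightarrow> nat \<Rightarrow> nat \<Rightarrow> 'a" where
  "mat_mul b A B = (\<lambda>l j. \<Sum>i<b. A l i * B i j)"

lemma mat_app_add: "mat_app a b A (x + y) = mat_app a b A x + mat_app a b A y"
  by (rule ext) (simp add: mat_app_def sum.distrib algebra_simps)

lemma mat_app_diff: "mat_app a b A (x - y) = mat_app a b A x - mat_app a b A y"
  by (rule ext) (simp add: mat_app_def sum_subtractf algebra_simps)

lemma mat_app_uminus: "mat_app a b A (- x) = - mat_app a b A x"
  by (rule ext) (simp add: mat_app_def sum_negf)

lemma mat_app_0 [simp]: "mat_app a b A 0 = 0"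
  by (rule ext) (simp add: mat_app_def)

lemma mat_app_scale: "mat_app a b A (\<lambda>j. c * x j) = (\<lambda>l. c * mat_app a b A x l)"
  by (rule ext) (simp add: mat_app_def sum_distrib_left mult.left_commute)

lemma mat_app_cong:
  assumes "\<And>l j. l < a \<Longrightarrow> j < b \<Longrightarrow> A l j = B l j" "\<And>j. j < b \<Longrightarrow> x j = y j"
  shows "mat_app a b A x = mat_app a b B y"
  using assms by (auto simp: mat_app_def fun_eq_iff)

lemma mat_app_mul: "mat_app a b A (mat_app b c B x) = mat_app a c (mat_mul b A B) x"
proof (rule ext)
  fix l
  have "(\<Sum>i<b. A l i * (\<Sum>j<c. B i j * x j)) = (\<Sum>i<b. \<Sum>j<c. A l i * B i j * x j)"
    by (simp add: sum_distrib_left mult.assoc)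
  also have "\<dots> = (\<Sum>j<c. (\<Sum>i<b. A l i * B i j) * x j)"
    by (subst sum.swap) (simp add: sum_distrib_right)
  finally show "mat_app a b A (mat_app b c B x) l = mat_app a c (mat_mul b A B) x l"
    by (simp add: mat_app_def mat_mul_def)
qed

definition unit_vec :: "nat \<Rightarrow> nat \<Rightarrow> 'a::comm_ring_1" where
  "unit_vec j = (\<lambda>i. if i = j then 1 else 0)"

definition id_mat :: "nat \<Rightarrow> nat \<Rightarrow> 'a::comm_ring_1" where
  "id_mat l j = (if l = j then 1 else 0)"

lemma mat_app_unit_vec: "j < b \<Longrightarrow> mat_app a b A (unit_vec j) = (\<lambda>l. if l < a then A l j else 0)"
  by (rule ext) (simp add: mat_app_def unit_vec_def mult.commute if_distrib cong: if_cong)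

lemma mat_app_id: "(\<And>j. j \<ge> a \<Longrightarrow> x j = 0) \<Longrightarrow> mat_app a a id_mat x = x"
  by (rule ext) (simp add: mat_app_def id_mat_def if_distrib not_less if_distribR sum.delta' cong: if_cong)

lemma mat_app_columns:
  "mat_app a c (\<lambda>l j. mat_app a b A (Y j) l) x = mat_app a b A (mat_app b c (\<lambda>l j. Y j l) x)"
  unfolding mat_app_mul by (rule mat_app_cong) (auto simp: mat_app_def mat_mul_def)

text \<open>The matrices of degree-preserving maps between graded free modules whose basis
  elements have the degrees \<open>t j\<close> (source) and \<open>s l\<close> (target).\<close>

definition hom_mat :: "'v set \<Rightarrow> nat \<Rightarrow> (nat \<Rightarrow> int) \<Rightarrow> nat \<Rightarrow> (nat \<Rightarrow> int) \<Rightarrow> (nat \<Rightarrow> nat \<Rightarrow> ('v, 'k::field) mpoly) \<Rightarrow> bool" where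
  "hom_mat V a s b t A \<longleftrightarrow> (\<forall>l<a. \<forall>j<b. A l j \<in> polys V \<and> homogeneous (t j - s l) (A l j))"

lemma hom_matD:
  "hom_mat V a s b t A \<Longrightarrow> l < a \<Longrightarrow> j < b \<Longrightarrow> A l j \<in> polys V"
  "hom_mat V a s b t A \<Longrightarrow> l < a \<Longrightarrow> j < b \<Longrightarrow> homogeneous (t j - s l) (A l j)"
  by (auto simp: hom_mat_def)

lemma hom_mat_mul:
  assumes "hom_mat V a s b t A" "hom_mat V b t c u B"
  shows "hom_mat V a s c u (mat_mul b A B)"
  unfolding hom_mat_def mat_mul_def
  by (auto intro!: polys_sum polys_mult homogeneous_sum hom_matD[OF assms(1)] hom_matD[OF assms(2)]
      homogeneous_mult_eq[OF hom_matD(2)[OF assms(1)] hom_matD(2)[OF assms(2)]])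

lemma hom_mat_id: "hom_mat V a s a s id_mat"
  by (auto simp: hom_mat_def id_mat_def)

lemma hom_mat_diff:
  "hom_mat V a s b t A \<Longrightarrow> hom_mat V a s b t B \<Longrightarrow> hom_mat V a s b t (\<lambda>l j. A l j - B l j)"
  by (auto simp: hom_mat_def intro: polys_diff homogeneous_diff)

lemma hom_mat_smult:
  assumes "hom_mat V a s b t A" "p \<in> polys V" "homogeneous e p"
  shows "hom_mat V a s b (\<lambda>j. t j + e) (\<lambda>l j. p * A l j)"
  unfolding hom_mat_def
  by (auto intro!: polys_mult assms(2) hom_matD[OF assms(1)]
      homogeneous_mult_eq[OF assms(3) hom_matD(2)[OF assms(1)]])

lemma mat_app_mat_diff:
  "mat_app a b (\<lambda>l j. A l j - B l j) x = mat_app a b A x - mat_app a b B x"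
  by (rule ext) (simp add: mat_app_def sum_subtractf algebra_simps)

lemma free_mod_mat_app:
  assumes "hom_mat V a s b t A" "x \<in> free_mod V b"
  shows "mat_app a b A x \<in> free_mod V a"
  using assms by (auto simp: free_mod_def mat_app_def hom_mat_def intro!: polys_sum polys_mult)

lemma free_mod_add: "x \<in> free_mod V n \<Longrightarrow> y \<in> free_mod V n \<Longrightarrow> x + y \<in> free_mod V n"
  by (auto simp: free_mod_def intro: polys_add)

lemma free_mod_diff: "x \<in> free_mod V n \<Longrightarrow> y \<in> free_mod V n \<Longrightarrow> x - y \<in> free_mod V n"
  by (auto simp: free_mod_def intro: polys_diff)

lemma free_mod_uminus: "x \<in> free_mod V n \<Longrightarrow> - x \<in> free_mod V n"
  by (auto simp: free_mod_def intro: polys_uminus)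

lemma free_mod_unit_vec: "j < n \<Longrightarrow> unit_vec j \<in> free_mod V n"
  by (simp add: free_mod_def unit_vec_def)

text \<open>A homogeneous map commutes with taking homogeneous components, so the component in
  the degree of \<open>x\<close> of any preimage is again a preimage.\<close>

lemma homogeneous_preimage:
  assumes A: "hom_mat V a s b t A"
    and x: "\<And>l. l < a \<Longrightarrow> homogeneous (e - s l) (x l)"
    and y: "y \<in> free_mod V b" "mat_app a b A y = x"
  shows "\<exists>y'\<in>free_mod V b. (\<forall>j<b. homogeneous (e - t j) (y' j)) \<and> mat_app a b A y' = x"
proof (intro bexI conjI allI impI)
  let ?y = "\<lambda>j. hcomp (e - t j) (y j)"
  show "?y \<in> free_mod V b"
    using y(1) by (auto simp: free_mod_def intro: polys_hcomp)
  show "homogeneous (e - t j) (?y j)" for j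
    by (rule homogeneous_hcomp)
  show "mat_app a b A ?y = x"
  proof (rule ext)
    fix l
    show "mat_app a b A ?y l = x l"
    proof (cases "l < a")
      case True
      have "(\<Sum>j<b. A l j * ?y j) = (\<Sum>j<b. hcomp (e - s l) (A l j * y j))"
        by (rule sum.cong) (auto simp: hcomp_mult[OF hom_matD(2)[OF A True]])
      also have "\<dots> = hcomp (e - s l) (mat_app a b A y l)"
        using True by (simp add: hcomp_sum mat_app_def)
      finally show ?thesis
        using True x[OF True] unfolding y(2) by (simp add: mat_app_def hcomp_homogeneous)
    next
      case False
      then show ?thesis
        using y(2) by (auto simp: mat_app_def)
    qed
  qed
qed

text \<open>The source of \<open>Z\<close> is free, so \<open>Z\<close> factors through \<open>A\<close> as soon as each of its columns
  lies in the image of \<open>A\<close>. This projectivity yields the comparison maps in positive degrees and the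
  contracting homotopies below.\<close>

lemma lift_matrix:
  assumes A: "hom_mat V a s b t A" and Z: "hom_mat V a s c u Z"
    and im: "\<And>j. j < c \<Longrightarrow> \<exists>y\<in>free_mod V b. mat_app a b A y = mat_app a c Z (unit_vec j)"
  shows "\<exists>Y. hom_mat V b t c u Y \<and> (\<forall>x. mat_app a b A (mat_app b c Y x) = mat_app a c Z x)"
proof -
  have "\<exists>y. j < c \<longrightarrow> y \<in> free_mod V b \<and> (\<forall>i<b. homogeneous (u j - t i) (y i)) \<and>
      mat_app a b A y = mat_app a c Z (unit_vec j)" for j
  proof (cases "j < c")
    case True
    then obtain y where y: "y \<in> free_mod V b" "mat_app a b A y = mat_app a c Z (unit_vec j)"
      using im by blast
    have "homogeneous (u j - s l) (mat_app a c Z (unit_vec j) l)" if "l < a" for l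
      using that True hom_matD(2)[OF Z] by (simp add: mat_app_unit_vec)
    from homogeneous_preimage[OF A this y] show ?thesis by blast
  qed auto
  then obtain y where y: "\<And>j. j < c \<Longrightarrow> y j \<in> free_mod V b"
      "\<And>j i. j < c \<Longrightarrow> i < b \<Longrightarrow> homogeneous (u j - t i) (y j i)"
      "\<And>j. j < c \<Longrightarrow> mat_app a b A (y j) = mat_app a c Z (unit_vec j)"
    by metis
  have "hom_mat V b t c u (\<lambda>i j. y j i)"
    using y(1,2) by (auto simp: hom_mat_def free_mod_def)
  moreover have "mat_app a b A (mat_app b c (\<lambda>i j. y j i) x) = mat_app a c Z x" for x
    unfolding mat_app_columns[symmetric]
    by (rule mat_app_cong) (simp_all add: y(3) mat_app_unit_vec)
  ultimately show ?thesis by blast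
qed

section \<open>Comparison maps between resolutions\<close>

lemma dmap_mat_app: "dmap F i = mat_app (frank F i) (frank F (Suc i)) (dmat F i)"
  by (intro ext) (simp add: dmap_def mat_app_def)

lemma tensor_dmap_mat_app:
  "tensor_dmap F i = mat_app (frank F i) (frank F (Suc i)) (\<lambda>l j. ccoeff (dmat F i l j))"
  by (intro ext) (simp add: tensor_dmap_def mat_app_def)

lemma resolution_hom_mat:
  "graded_free_resolution V J F \<Longrightarrow>
    hom_mat V (frank F i) (shift F i) (frank F (Suc i)) (shift F (Suc i)) (dmat F i)"
  by (simp add: graded_free_resolution_def hom_mat_def)

lemma resolution_aug:
  assumes "graded_free_resolution V J F" "j < frank F 0"
  shows "aug F j \<in> polys V" "homogeneous (shift F 0 j) (aug F j)"
  using assms by (auto simp: graded_free_resolution_def)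

lemma resolution_surj:
  "graded_free_resolution V J F \<Longrightarrow> f \<in> polys V \<Longrightarrow> \<exists>x\<in>free_mod V (frank F 0). f - augmap F x \<in> J"
  by (simp add: graded_free_resolution_def)

lemma resolution_exact_0:
  "graded_free_resolution V J F \<Longrightarrow> x \<in> free_mod V (frank F 0) \<Longrightarrow>
    augmap F x \<in> J \<longleftrightarrow> (\<exists>y\<in>free_mod V (frank F 1). dmap F 0 y = x)"
  by (simp add: graded_free_resolution_def)

lemma resolution_exact:
  "graded_free_resolution V J F \<Longrightarrow> x \<in> free_mod V (frank F (Suc i)) \<Longrightarrow>
    dmap F i x = 0 \<longleftrightarrow> (\<exists>y\<in>free_mod V (frank F (Suc (Suc i))). dmap F (Suc i) y = x)"
  by (simp add: graded_free_resolution_def)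

lemma resolution_dmap_free_mod:
  "graded_free_resolution V J F \<Longrightarrow> x \<in> free_mod V (frank F (Suc i)) \<Longrightarrow> dmap F i x \<in> free_mod V (frank F i)"
  unfolding dmap_mat_app by (rule free_mod_mat_app[OF resolution_hom_mat])

lemma resolution_dmap_dmap:
  "graded_free_resolution V J F \<Longrightarrow> x \<in> free_mod V (frank F (Suc (Suc i))) \<Longrightarrow> dmap F i (dmap F (Suc i) x) = 0"
  using resolution_exact[of V J F "dmap F (Suc i) x" i] resolution_dmap_free_mod by blast

lemma resolution_augmap_dmap:
  "graded_free_resolution V J F \<Longrightarrow> x \<in> free_mod V (frank F 1) \<Longrightarrow> augmap F (dmap F 0 x) \<in> J"
  using resolution_exact_0[of V J F "dmap F 0 x"] resolution_dmap_free_mod[of V J F x 0] by auto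

lemma dmap_add: "dmap F i (x + y) = dmap F i x + dmap F i y"
  and dmap_diff: "dmap F i (x - y) = dmap F i x - dmap F i y"
  and dmap_uminus: "dmap F i (- x) = - dmap F i x"
  by (simp_all add: dmap_mat_app mat_app_add mat_app_diff mat_app_uminus)

lemma augmap_add: "augmap F (x + y) = augmap F x + augmap F y"
  by (simp add: augmap_def sum.distrib algebra_simps)

lemma augmap_diff: "augmap F (x - y) = augmap F x - augmap F y"
  by (simp add: augmap_def sum_subtractf algebra_simps)

lemma augmap_0: "augmap F 0 = 0"
  by (simp add: augmap_def)

lemma augmap_polys:
  "graded_free_resolution V J F \<Longrightarrow> x \<in> free_mod V (frank F 0) \<Longrightarrow> augmap F x \<in> polys V"
  unfolding augmap_def
  by (intro polys_sum polys_mult) (auto simp: free_mod_def resolution_aug)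

lemma augmap_mat_app:
  "augmap F (mat_app (frank F 0) c Y x) = (\<Sum>j<c. augmap F (\<lambda>l. Y l j) * x j)"
proof -
  have "augmap F (mat_app (frank F 0) c Y x) = (\<Sum>l<frank F 0. \<Sum>j<c. aug F l * Y l j * x j)"
    by (simp add: augmap_def mat_app_def sum_distrib_left mult.assoc)
  also have "\<dots> = (\<Sum>j<c. \<Sum>l<frank F 0. aug F l * Y l j * x j)"
    by (rule sum.swap)
  finally show ?thesis
    by (simp add: augmap_def sum_distrib_right)
qed

lemma augmap_hcomp:
  assumes "graded_free_resolution V J F"
  shows "augmap F (\<lambda>l. hcomp (d - shift F 0 l) (x l)) = hcomp d (augmap F x)"
  unfolding augmap_def hcomp_sum
  by (rule sum.cong) (auto simp: hcomp_mult[OF resolution_aug(2)[OF assms]])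

lemma graded_ideal_sum:
  "graded_ideal V J \<Longrightarrow> (\<And>i. i \<in> I \<Longrightarrow> f i \<in> J) \<Longrightarrow> sum f I \<in> J"
  by (induction I rule: infinite_finite_induct) (auto intro: graded_idealD)

text \<open>Degree zero of the lift of multiplication by \<open>p\<close>: the columns come from the surjectivity
  of the augmentation of \<open>F\<close> modulo \<open>J\<close>.\<close>

lemma augmentation_lift:
  assumes F: "graded_free_resolution V J F" and G: "graded_free_resolution V J' G"
    and J: "graded_ideal V J" and p: "p \<in> polys V" "homogeneous e p"
  shows "\<exists>Y. hom_mat V (frank F 0) (shift F 0) (frank G 0) (\<lambda>j. shift G 0 j + e) Y \<and>
    (\<forall>x\<in>free_mod V (frank G 0). augmap F (mat_app (frank F 0) (frank G 0) Y x) - p * augmap G x \<in> J)"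
proof -
  have "\<exists>y. j < frank G 0 \<longrightarrow> y \<in> free_mod V (frank F 0) \<and>
      (\<forall>l<frank F 0. homogeneous (shift G 0 j + e - shift F 0 l) (y l)) \<and> augmap F y - p * aug G j \<in> J" for j
  proof (cases "j < frank G 0")
    case True
    let ?f = "p * aug G j" and ?d = "shift G 0 j + e"
    have f: "?f \<in> polys V" "homogeneous ?d ?f"
      using resolution_aug[OF G True] p by (auto intro: polys_mult homogeneous_mult_eq)
    obtain y where y: "y \<in> free_mod V (frank F 0)" "?f - augmap F y \<in> J"
      using resolution_surj[OF F f(1)] by blast
    let ?y = "\<lambda>l. hcomp (?d - shift F 0 l) (y l)"
    have "?y \<in> free_mod V (frank F 0)"
      using y(1) by (auto simp: free_mod_def intro: polys_hcomp)
    moreover have "\<forall>l<frank F 0. homogeneous (?d - shift F 0 l) (?y l)"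
      by (simp add: homogeneous_hcomp)
    moreover have "augmap F ?y - ?f \<in> J"
    proof -
      have "augmap F ?y - ?f = - hcomp ?d (?f - augmap F y)"
        by (simp add: augmap_hcomp[OF F] hcomp_diff hcomp_homogeneous[OF f(2)])
      then show ?thesis
        using y(2) J by (simp only: graded_ideal_uminus graded_idealD)
    qed
    ultimately show ?thesis by blast
  qed auto
  then obtain y where y: "\<And>j. j < frank G 0 \<Longrightarrow> y j \<in> free_mod V (frank F 0)"
      "\<And>j l. j < frank G 0 \<Longrightarrow> l < frank F 0 \<Longrightarrow> homogeneous (shift G 0 j + e - shift F 0 l) (y j l)"
      "\<And>j. j < frank G 0 \<Longrightarrow> augmap F (y j) - p * aug G j \<in> J"
    by metis
  have "hom_mat V (frank F 0) (shift F 0) (frank G 0) (\<lambda>j. shift G 0 j + e) (\<lambda>l j. y j l)"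
    using y(1,2) by (auto simp: hom_mat_def free_mod_def)
  moreover have "augmap F (mat_app (frank F 0) (frank G 0) (\<lambda>l j. y j l) x) - p * augmap G x \<in> J"
    if x: "x \<in> free_mod V (frank G 0)" for x
  proof -
    have "augmap F (mat_app (frank F 0) (frank G 0) (\<lambda>l j. y j l) x) - p * augmap G x
        = (\<Sum>j<frank G 0. x j * (augmap F (y j) - p * aug G j))"
      unfolding augmap_mat_app
      by (simp add: augmap_def[of G] sum_distrib_left sum_subtractf algebra_simps)
    also have "\<dots> \<in> J"
      using x by (intro graded_ideal_sum[OF J] graded_idealD(4)[OF J] y(3)) (auto simp: free_mod_def)
    finally show ?thesis .
  qed
  ultimately show ?thesis by blast
qed

text \<open>\<open>\<phi>\<close> is a homogeneous chain map from \<open>G\<close> to \<open>F\<close>, of degree \<open>e\<close>, that induces multiplication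
  by \<open>p\<close> on the resolved modules.\<close>

definition chain_lift ::
    "'v set \<Rightarrow> ('v, 'k::field) mpoly set \<Rightarrow> ('v, 'k) free_complex \<Rightarrow> ('v, 'k) free_complex \<Rightarrow>
      ('v, 'k) mpoly \<Rightarrow> int \<Rightarrow> (nat \<Rightarrow> nat \<Rightarrow> nat \<Rightarrow> ('v, 'k) mpoly) \<Rightarrow> bool" where
  "chain_lift V J F G p e \<phi> \<longleftrightarrow>
     (\<forall>i. hom_mat V (frank F i) (shift F i) (frank G i) (\<lambda>j. shift G i j + e) (\<phi> i)) \<and>
     (\<forall>x\<in>free_mod V (frank G 0).
        augmap F (mat_app (frank F 0) (frank G 0) (\<phi> 0) x) - p * augmap G x \<in> J) \<and>
     (\<forall>i. \<forall>x\<in>free_mod V (frank G (Suc i)).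
        dmap F i (mat_app (frank F (Suc i)) (frank G (Suc i)) (\<phi> (Suc i)) x) =
        mat_app (frank F i) (frank G i) (\<phi> i) (dmap G i x))"

lemma chain_liftD:
  assumes "chain_lift V J F G p e \<phi>"
  shows "hom_mat V (frank F i) (shift F i) (frank G i) (\<lambda>j. shift G i j + e) (\<phi> i)"
    "x \<in> free_mod V (frank G 0) \<Longrightarrow> augmap F (mat_app (frank F 0) (frank G 0) (\<phi> 0) x) - p * augmap G x \<in> J"
    "y \<in> free_mod V (frank G (Suc i)) \<Longrightarrow> dmap F i (mat_app (frank F (Suc i)) (frank G (Suc i)) (\<phi> (Suc i)) y) =
      mat_app (frank F i) (frank G i) (\<phi> i) (dmap G i y)"
  using assms by (auto simp: chain_lift_def)

text \<open>The hypothesis \<open>pJ'\<close> says that multiplication by \<open>p\<close> is well defined from \<open>R/J'\<close> to \<open>R/J\<close>.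
  It starts the usual degreewise construction, in which the exactness of \<open>F\<close> provides each next map.\<close>

lemma chain_lift_exists:
  fixes F :: "('v, 'k::field) free_complex"
  assumes F: "graded_free_resolution V J F" and G: "graded_free_resolution V J' G"
    and J: "graded_ideal V J" and p: "p \<in> polys V" "homogeneous e p"
    and pJ': "\<And>f. f \<in> J' \<Longrightarrow> p * f \<in> J"
  shows "\<exists>\<phi>. chain_lift V J F G p e \<phi>"
proof -
  let ?app = "\<lambda>i Y. mat_app (frank F i) (frank G i) Y"
  \<comment> \<open>The last conjunct of the invariant says that the columns needed in the next step have preimages.\<close>
  define P where "P i Y \<longleftrightarrow> hom_mat V (frank F i) (shift F i) (frank G i) (\<lambda>j. shift G i j + e) Y \<and>
      (i = 0 \<longrightarrow> (\<forall>x\<in>free_mod V (frank G 0). augmap F (?app 0 Y x) - p * augmap G x \<in> J)) \<and>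
      (\<forall>y\<in>free_mod V (frank G (Suc i)). \<exists>z\<in>free_mod V (frank F (Suc i)). dmap F i z = ?app i Y (dmap G i y))"
    for i and Y :: "nat \<Rightarrow> nat \<Rightarrow> ('v, 'k) mpoly"
  define Q where "Q i Y Y' \<longleftrightarrow> (\<forall>x\<in>free_mod V (frank G (Suc i)).
      dmap F i (?app (Suc i) Y' x) = ?app i Y (dmap G i x))" for i Y Y'
  have "\<exists>\<phi>. \<forall>i. P i (\<phi> i) \<and> Q i (\<phi> i) (\<phi> (Suc i))"
  proof (rule dependent_nat_choice)
    obtain Y where Y: "hom_mat V (frank F 0) (shift F 0) (frank G 0) (\<lambda>j. shift G 0 j + e) Y"
      "\<And>x. x \<in> free_mod V (frank G 0) \<Longrightarrow> augmap F (?app 0 Y x) - p * augmap G x \<in> J"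
      using augmentation_lift[OF F G J p] by blast
    have "\<exists>z\<in>free_mod V (frank F (Suc 0)). dmap F 0 z = ?app 0 Y (dmap G 0 y)"
      if y: "y \<in> free_mod V (frank G (Suc 0))" for y
    proof -
      have dy: "dmap G 0 y \<in> free_mod V (frank G 0)"
        by (rule resolution_dmap_free_mod[OF G y])
      have "augmap G (dmap G 0 y) \<in> J'"
        using resolution_augmap_dmap[OF G] y by simp
      then have "(augmap F (?app 0 Y (dmap G 0 y)) - p * augmap G (dmap G 0 y)) + p * augmap G (dmap G 0 y) \<in> J"
        using Y(2)[OF dy] pJ' graded_idealD(3)[OF J] by blast
      then show ?thesis
        using resolution_exact_0[OF F free_mod_mat_app[OF Y(1) dy]] by simp
    qed
    then show "\<exists>Y. P 0 Y"
      using Y by (auto simp: P_def)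
  next
    fix Y i assume P: "P i Y"
    have dG: "hom_mat V (frank G i) (\<lambda>j. shift G i j + e) (frank G (Suc i)) (\<lambda>j. shift G (Suc i) j + e) (dmat G i)"
      using resolution_hom_mat[OF G, of i] by (auto simp: hom_mat_def)
    have Z: "hom_mat V (frank F i) (shift F i) (frank G (Suc i)) (\<lambda>j. shift G (Suc i) j + e)
        (mat_mul (frank G i) Y (dmat G i))"
      using P unfolding P_def by (blast intro: hom_mat_mul dG)
    have "\<exists>Y'. hom_mat V (frank F (Suc i)) (shift F (Suc i)) (frank G (Suc i)) (\<lambda>j. shift G (Suc i) j + e) Y' \<and>
        (\<forall>x. mat_app (frank F i) (frank F (Suc i)) (dmat F i) (?app (Suc i) Y' x)
          = mat_app (frank F i) (frank G (Suc i)) (mat_mul (frank G i) Y (dmat G i)) x)"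
    proof (rule lift_matrix[OF resolution_hom_mat[OF F] Z])
      fix j assume "j < frank G (Suc i)"
      then have "unit_vec j \<in> free_mod V (frank G (Suc i))"
        by (rule free_mod_unit_vec)
      then show "\<exists>y\<in>free_mod V (frank F (Suc i)). mat_app (frank F i) (frank F (Suc i)) (dmat F i) y =
          mat_app (frank F i) (frank G (Suc i)) (mat_mul (frank G i) Y (dmat G i)) (unit_vec j)"
        using P by (auto simp: P_def dmap_mat_app mat_app_mul)
    qed
    then obtain Y' where Y': "hom_mat V (frank F (Suc i)) (shift F (Suc i)) (frank G (Suc i))
        (\<lambda>j. shift G (Suc i) j + e) Y'"
      and comm: "\<And>x. dmap F i (?app (Suc i) Y' x) = ?app i Y (dmap G i x)"
      by (auto simp: dmap_mat_app mat_app_mul)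
    have "\<exists>z\<in>free_mod V (frank F (Suc (Suc i))). dmap F (Suc i) z = ?app (Suc i) Y' (dmap G (Suc i) y)"
      if y: "y \<in> free_mod V (frank G (Suc (Suc i)))" for y
    proof -
      have dy: "dmap G (Suc i) y \<in> free_mod V (frank G (Suc i))"
        by (rule resolution_dmap_free_mod[OF G y])
      have "dmap F i (?app (Suc i) Y' (dmap G (Suc i) y)) = 0"
        by (simp add: comm resolution_dmap_dmap[OF G y])
      then show ?thesis
        using resolution_exact[OF F free_mod_mat_app[OF Y' dy]] by simp
    qed
    then have "P (Suc i) Y'"
      using Y' by (simp add: P_def)
    moreover have "Q i Y Y'"
      by (simp add: Q_def comm)
    ultimately show "\<exists>Y'. P (Suc i) Y' \<and> Q i Y Y'" by blast
  qed
  then show ?thesis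
    by (auto simp: chain_lift_def P_def Q_def)
qed

section \<open>The mapping cone\<close>

definition vec_join :: "nat \<Rightarrow> (nat \<Rightarrow> 'a) \<Rightarrow> (nat \<Rightarrow> 'a) \<Rightarrow> nat \<Rightarrow> 'a" where
  "vec_join a f g = (\<lambda>j. if j < a then f j else g (j - a))"

text \<open>The block matrix with the rows \<open>A B\<close> and \<open>0 D\<close>, where \<open>A\<close> has \<open>a\<close> rows and \<open>b\<close> columns.\<close>

definition block_mat :: "nat \<Rightarrow> nat \<Rightarrow> (nat \<Rightarrow> nat \<Rightarrow> 'a::zero) \<Rightarrow> (nat \<Rightarrow> nat \<Rightarrow> 'a) \<Rightarrow> (nat \<Rightarrow> nat \<Rightarrow> 'a) \<Rightarrow> nat \<Rightarrow> nat \<Rightarrow> 'a" where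
  "block_mat a b A B D = (\<lambda>l j. if l < a then (if j < b then A l j else B l (j - b))
     else (if j < b then 0 else D (l - a) (j - b)))"

lemma sum_lessThan_add: "(\<Sum>j<a + (b::nat). h j) = (\<Sum>j<a. h j) + (\<Sum>j<b. (h (j + a) :: 'a::comm_monoid_add))"
  by (induction b) (auto simp: ac_simps)

lemma mat_app_block_mat:
  "mat_app (a + c) (b + d) (block_mat a b A B D) (vec_join b f g) =
    vec_join a (mat_app a b A f + mat_app a d B g) (mat_app c d D g)"
  by (rule ext) (auto simp: mat_app_def block_mat_def vec_join_def sum_lessThan_add)

lemma vec_join_0: "vec_join a 0 0 = 0"
  by (rule ext) (simp add: vec_join_def)

lemma vec_join_0_right: "(\<And>j. j \<ge> a \<Longrightarrow> f j = 0) \<Longrightarrow> vec_join a f 0 = f"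
  by (rule ext) (simp add: vec_join_def)

lemma vec_join_eq_iff:
  assumes "\<And>j. j \<ge> a \<Longrightarrow> f j = 0" "\<And>j. j \<ge> a \<Longrightarrow> f' j = (0 :: 'a::zero)"
  shows "vec_join a f g = vec_join a f' g' \<longleftrightarrow> f = f' \<and> g = g'"
proof (intro iffI conjI ext)
  assume eq: "vec_join a f g = vec_join a f' g'"
  show "f j = f' j" for j
    using fun_cong[OF eq, of j] assms[of j] by (auto simp: vec_join_def split: if_splits)
  show "g j = g' j" for j
    using fun_cong[OF eq, of "j + a"] by (simp add: vec_join_def)
qed simp

lemma vec_join_eq_0_iff:
  "(\<And>j. j \<ge> a \<Longrightarrow> f j = 0) \<Longrightarrow> vec_join a f g = 0 \<longleftrightarrow> f = 0 \<and> g = 0"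
  using vec_join_eq_iff[of a f 0 g 0] by (simp add: vec_join_0)

lemma free_mod_vec_join: 
  "f \<in> free_mod V a \<Longrightarrow> g \<in> free_mod V b \<Longrightarrow> vec_join a f g \<in> free_mod V (a + b)"
  by (auto simp: free_mod_def vec_join_def)

lemma free_mod_split:
  assumes "x \<in> free_mod V (a + b)"
  obtains f g where "x = vec_join a f g" "f \<in> free_mod V a" "g \<in> free_mod V b"
proof
  show "x = vec_join a (\<lambda>j. if j < a then x j else 0) (\<lambda>j. x (j + a))"
    by (rule ext) (simp add: vec_join_def)
  show "(\<lambda>j. if j < a then x j else 0) \<in> free_mod V a" "(\<lambda>j. x (j + a)) \<in> free_mod V b"
    using assms by (auto simp: free_mod_def)
qed

text \<open>The entry of degree \<open>i - 1\<close>, with \<open>z\<close> in degree \<open>- 1\<close>. The cone contains \<open>G\<close> shifted by one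
  homological degree, and this avoids a case distinction in its definition.\<close>

abbreviation prev :: "'a \<Rightarrow> (nat \<Rightarrow> 'a) \<Rightarrow> nat \<Rightarrow> 'a" where
  "prev z f i \<equiv> (case i of 0 \<Rightarrow> z | Suc k \<Rightarrow> f k)"

text \<open>The mapping cone of \<open>\<phi>\<close>, with the basis of \<open>G\<close> placed behind that of \<open>F\<close>. In degree \<open>0\<close> it is
  \<open>F\<^sub>0\<close>, so its augmentation is that of \<open>F\<close>.\<close>

definition cone ::
    "('v, 'k::field) free_complex \<Rightarrow> ('v, 'k) free_complex \<Rightarrow>
      (nat \<Rightarrow> nat \<Rightarrow> nat \<Rightarrow> ('v, 'k) mpoly) \<Rightarrow> int \<Rightarrow> ('v, 'k) free_complex" where
  "cone F G \<phi> e = \<lparr>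
     frank = (\<lambda>i. frank F i + prev 0 (frank G) i),
     shift = (\<lambda>i j. if j < frank F i then shift F i j else prev (\<lambda>_. 0) (shift G) i (j - frank F i) + e),
     dmat = (\<lambda>i. block_mat (frank F i) (frank F (Suc i)) (dmat F i) (\<phi> i)
        (\<lambda>l j. - prev (\<lambda>_ _. 0) (dmat G) i l j)),
     aug = aug F \<rparr>"

lemma cone_simps [simp]:
  "frank (cone F G \<phi> e) i = frank F i + prev 0 (frank G) i"
  "shift (cone F G \<phi> e) i j = (if j < frank F i then shift F i j else prev (\<lambda>_. 0) (shift G) i (j - frank F i) + e)"
  "dmat (cone F G \<phi> e) i = block_mat (frank F i) (frank F (Suc i)) (dmat F i) (\<phi> i)
        (\<lambda>l j. - prev (\<lambda>_ _. 0) (dmat G) i l j)"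
  "aug (cone F G \<phi> e) = aug F"
  by (simp_all add: cone_def)

lemma mat_app_mat_uminus: "mat_app a b (\<lambda>l j. - A l j) x = - mat_app a b A x"
  by (rule ext) (simp add: mat_app_def sum_negf)

lemma mat_app_zero_rows: "mat_app 0 b A x = 0"
  by (rule ext) (simp add: mat_app_def)

lemma dmap_cone:
  "dmap (cone F G \<phi> e) i (vec_join (frank F (Suc i)) f g) =
    vec_join (frank F i) (dmap F i f + mat_app (frank F i) (frank G i) (\<phi> i) g) (- prev 0 (dmap G) i g)"
  unfolding dmap_mat_app cone_simps nat.case(2) mat_app_block_mat mat_app_mat_uminus
  by (cases i) (simp_all add: mat_app_zero_rows)

lemma tensor_dmap_cone:
  "tensor_dmap (cone F G \<phi> e) i (vec_join (frank F (Suc i)) f g) =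
    vec_join (frank F i) (tensor_dmap F i f + mat_app (frank F i) (frank G i) (\<lambda>l j. ccoeff (\<phi> i l j)) g)
      (- prev 0 (tensor_dmap G) i g)"
proof -
  have "(\<lambda>l j. ccoeff (dmat (cone F G \<phi> e) i l j)) =
      block_mat (frank F i) (frank F (Suc i)) (\<lambda>l j. ccoeff (dmat F i l j)) (\<lambda>l j. ccoeff (\<phi> i l j))
        (\<lambda>l j. - ccoeff (prev (\<lambda>_ _. 0) (dmat G) i l j))"
    by (intro ext) (simp add: block_mat_def)
  then show ?thesis
    unfolding tensor_dmap_mat_app cone_simps(1) nat.case(2)
    by (simp only: mat_app_block_mat mat_app_mat_uminus)
      (cases i, simp_all add: mat_app_zero_rows tensor_dmap_mat_app)
qed

lemma augmap_cone: "augmap (cone F G \<phi> e) x = augmap F x"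
  by (simp add: augmap_def)

lemma free_modD: "x \<in> free_mod V n \<Longrightarrow> n \<le> j \<Longrightarrow> x j = 0"
  by (simp add: free_mod_def)

text \<open>The condition on \<open>J'\<close> makes multiplication by \<open>p\<close> an injection of \<open>R/J'\<close> into \<open>R/J\<close>. The
  cokernel is \<open>R/(J + (p))\<close>, and the long exact sequence of the cone, here spelled out on elements,
  leaves no other homology.\<close>

lemma cone_resolution:
  assumes F: "graded_free_resolution V J F" and G: "graded_free_resolution V J' G"
    and J: "graded_ideal V J" and p: "p \<in> polys V"
    and J': "J' = {f \<in> polys V. p * f \<in> J}"
    and \<phi>: "chain_lift V J F G p e \<phi>"
  shows "graded_free_resolution V {f + p * g | f g. f \<in> J \<and> g \<in> polys V} (cone F G \<phi> e)"
    (is "graded_free_resolution V ?I ?C")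
proof -
  let ?\<phi> = "\<lambda>i. mat_app (frank F i) (frank G i) (\<phi> i)"
  have \<phi>_free: "?\<phi> i g \<in> free_mod V (frank F i)" if "g \<in> free_mod V (frank G i)" for i g
    using free_mod_mat_app[OF chain_liftD(1)[OF \<phi>] that] .
  have hom: "hom_mat V (frank ?C i) (shift ?C i) (frank ?C (Suc i)) (shift ?C (Suc i)) (dmat ?C i)" for i
    using resolution_hom_mat[OF F, of i] resolution_hom_mat[OF G, of "i - 1"] chain_liftD(1)[OF \<phi>, of i]
    by (cases i) (auto simp: hom_mat_def block_mat_def algebra_simps intro!: polys_uminus homogeneous_uminus)
  have J_I: "f \<in> ?I" if "f \<in> J" for f
    using that polys_0 by (metis (mono_tags, lifting) add_0_right mem_Collect_eq mult_zero_right)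
  have exact_0: "augmap ?C x \<in> ?I \<longleftrightarrow> (\<exists>y\<in>free_mod V (frank ?C 1). dmap ?C 0 y = x)"
    if x: "x \<in> free_mod V (frank ?C 0)" for x
  proof
    have x': "x \<in> free_mod V (frank F 0)" using x by simp
    assume "augmap ?C x \<in> ?I"
    then obtain a b where ab: "augmap F x = a + p * b" "a \<in> J" "b \<in> polys V"
      by (auto simp: augmap_cone)
    obtain g where g: "g \<in> free_mod V (frank G 0)" "b - augmap G g \<in> J'"
      using resolution_surj[OF G ab(3)] by blast
    \<comment> \<open>Correcting \<open>x\<close> by the image of a lift of \<open>b\<close> brings its augmentation into \<open>J\<close>.\<close>
    have "augmap F (x - ?\<phi> 0 g) = a + p * (b - augmap G g) - (augmap F (?\<phi> 0 g) - p * augmap G g)"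
      by (simp add: augmap_diff ab(1) algebra_simps)
    also have "\<dots> \<in> J"
      using g(2) J'
      by (intro graded_ideal_diff[OF J _ chain_liftD(2)[OF \<phi> g(1)]] graded_idealD(3)[OF J ab(2)]) simp
    finally obtain f where f: "f \<in> free_mod V (frank F 1)" "dmap F 0 f = x - ?\<phi> 0 g"
      using resolution_exact_0[OF F free_mod_diff[OF x' \<phi>_free[OF g(1)]]] by blast
    have "dmap ?C 0 (vec_join (frank F (Suc 0)) f g) = x"
      unfolding dmap_cone using f(2) x' by (simp add: vec_join_0_right free_modD)
    then show "\<exists>y\<in>free_mod V (frank ?C 1). dmap ?C 0 y = x"
      using free_mod_vec_join[of f V "frank F 1" g "frank G 0"] f(1) g(1) by auto
  next
    assume "\<exists>y\<in>free_mod V (frank ?C 1). dmap ?C 0 y = x"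
    then obtain y where y: "y \<in> free_mod V (frank F 1 + frank G 0)" "dmap ?C 0 y = x"
      by auto
    obtain f g where fg: "y = vec_join (frank F 1) f g" "f \<in> free_mod V (frank F 1)" "g \<in> free_mod V (frank G 0)"
      using free_mod_split[OF y(1)] .
    have sum_free: "dmap F 0 f + ?\<phi> 0 g \<in> free_mod V (frank F 0)"
      using resolution_dmap_free_mod[OF F, of f 0] \<phi>_free[OF fg(3)] fg(2) by (simp add: free_mod_add)
    have "x = vec_join (frank F 0) (dmap F 0 f + ?\<phi> 0 g) 0"
      unfolding y(2)[symmetric] fg(1) using dmap_cone[of F G \<phi> e 0 f g]
      by (simp only: One_nat_def nat.case zero_fun_apply minus_zero)
    also have "\<dots> = dmap F 0 f + ?\<phi> 0 g"
      by (rule vec_join_0_right) (rule free_modD[OF sum_free])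
    finally have "x = dmap F 0 f + ?\<phi> 0 g" .
    then have "augmap ?C x = (augmap F (dmap F 0 f) + (augmap F (?\<phi> 0 g) - p * augmap G g)) + p * augmap G g"
      by (simp add: augmap_cone augmap_add)
    moreover have "augmap F (dmap F 0 f) + (augmap F (?\<phi> 0 g) - p * augmap G g) \<in> J"
      by (intro graded_idealD(3)[OF J] resolution_augmap_dmap[OF F fg(2)] chain_liftD(2)[OF \<phi> fg(3)])
    ultimately show "augmap ?C x \<in> ?I"
      using augmap_polys[OF G fg(3)] by blast
  qed
  have exact: "dmap ?C i x = 0 \<longleftrightarrow> (\<exists>y\<in>free_mod V (frank ?C (Suc (Suc i))). dmap ?C (Suc i) y = x)"
    if x: "x \<in> free_mod V (frank ?C (Suc i))" for x i
  proof -
    obtain f g where fg: "x = vec_join (frank F (Suc i)) f g" "f \<in> free_mod V (frank F (Suc i))" "g \<in> free_mod V (frank G i)"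
      using x by (auto elim: free_mod_split)
    have sum_free: "dmap F i f + ?\<phi> i g \<in> free_mod V (frank F i)"
      using resolution_dmap_free_mod[OF F fg(2)] \<phi>_free[OF fg(3)] by (rule free_mod_add)
    have d0: "dmap ?C i x = 0 \<longleftrightarrow> dmap F i f + ?\<phi> i g = 0 \<and> prev 0 (dmap G) i g = 0"
      unfolding fg(1) dmap_cone
      by (subst vec_join_eq_0_iff[OF free_modD[OF sum_free]]) simp_all
    show ?thesis
    proof
      assume "dmap ?C i x = 0"
      then have fg0: "dmap F i f + ?\<phi> i g = 0" and g0: "prev 0 (dmap G) i g = 0"
        using d0 by auto
      \<comment> \<open>The second component of a cycle is a boundary of \<open>G\<close>. For \<open>i = 0\<close> this is where the
        colon ideal is used: \<open>p\<close> times the augmentation of \<open>g\<close> lies in \<open>J\<close>.\<close>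
      have "\<exists>g'\<in>free_mod V (frank G (Suc i)). dmap G i g' = g"
      proof (cases i)
        case 0
        have f1: "augmap F (dmap F 0 f) \<in> J"
          using resolution_augmap_dmap[OF F] fg(2) 0 by simp
        have g1: "g \<in> free_mod V (frank G 0)" using fg(3) 0 by simp
        have "p * augmap G g = 0 - (augmap F (dmap F 0 f) + (augmap F (?\<phi> 0 g) - p * augmap G g))"
          using arg_cong[OF fg0, of "augmap F"] 0 by (simp add: augmap_add augmap_0 algebra_simps add_eq_0_iff)
        also have "\<dots> \<in> J"
          by (intro graded_ideal_diff[OF J] graded_idealD[OF J] f1 chain_liftD(2)[OF \<phi> g1])
        finally have "augmap G g \<in> J'"
          using J' augmap_polys[OF G g1] by simp
        then show ?thesis
          using resolution_exact_0[OF G g1] 0 by simp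
      next
        case (Suc k)
        then show ?thesis
          using resolution_exact[OF G, of g k] fg(3) g0 by simp
      qed
      then obtain g' where g': "g' \<in> free_mod V (frank G (Suc i))" "dmap G i g' = g" by blast
      have ff: "f + ?\<phi> (Suc i) g' \<in> free_mod V (frank F (Suc i))"
        by (intro free_mod_add fg(2) \<phi>_free g'(1))
      have "dmap F i (f + ?\<phi> (Suc i) g') = 0"
        using chain_liftD(3)[OF \<phi> g'(1)] g'(2) fg0 by (simp add: dmap_add)
      then obtain f' where f': "f' \<in> free_mod V (frank F (Suc (Suc i)))" "dmap F (Suc i) f' = f + ?\<phi> (Suc i) g'"
        using resolution_exact[OF F ff] by blast
      have "dmap ?C (Suc i) (vec_join (frank F (Suc (Suc i))) f' (- g')) = x"
        unfolding dmap_cone by (simp add: fg(1) f'(2) mat_app_uminus dmap_uminus g'(2))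
      moreover have "vec_join (frank F (Suc (Suc i))) f' (- g') \<in> free_mod V (frank ?C (Suc (Suc i)))"
        using free_mod_vec_join[OF f'(1) free_mod_uminus[OF g'(1)]] by simp
      ultimately show "\<exists>y\<in>free_mod V (frank ?C (Suc (Suc i))). dmap ?C (Suc i) y = x" by blast
    next
      assume "\<exists>y\<in>free_mod V (frank ?C (Suc (Suc i))). dmap ?C (Suc i) y = x"
      then obtain f' g' where f'g': "dmap ?C (Suc i) (vec_join (frank F (Suc (Suc i))) f' g') = x"
        "f' \<in> free_mod V (frank F (Suc (Suc i)))" "g' \<in> free_mod V (frank G (Suc i))"
        by (auto elim: free_mod_split)
      have sum_free': "dmap F (Suc i) f' + ?\<phi> (Suc i) g' \<in> free_mod V (frank F (Suc i))"
        using resolution_dmap_free_mod[OF F f'g'(2)] \<phi>_free[OF f'g'(3)] by (rule free_mod_add)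
      have "f = dmap F (Suc i) f' + ?\<phi> (Suc i) g' \<and> g = - dmap G i g'"
        using f'g'(1) vec_join_eq_iff[of "frank F (Suc i)" "dmap F (Suc i) f' + ?\<phi> (Suc i) g'" f, OF free_modD[OF sum_free'] free_modD[OF fg(2)]]
        unfolding fg(1) dmap_cone by simp
      then have f: "f = dmap F (Suc i) f' + ?\<phi> (Suc i) g'" and g: "g = - dmap G i g'"
        by auto
      have "dmap F i f + ?\<phi> i g = 0"
        unfolding f g by (simp add: dmap_add resolution_dmap_dmap[OF F f'g'(2)] chain_liftD(3)[OF \<phi> f'g'(3)] mat_app_uminus)
      moreover have "prev 0 (dmap G) i g = 0"
        using f'g'(3) by (cases i) (simp_all add: g dmap_uminus resolution_dmap_dmap[OF G])
      ultimately show "dmap ?C i x = 0"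
        using d0 by simp
    qed
  qed
  have surj: "\<exists>x\<in>free_mod V (frank ?C 0). f - augmap ?C x \<in> ?I" if f: "f \<in> polys V" for f
  proof -
    obtain x where "x \<in> free_mod V (frank F 0)" "f - augmap F x \<in> J"
      using resolution_surj[OF F f] by blast
    then show ?thesis
      using J_I unfolding augmap_cone by (intro bexI[of _ x]) simp_all
  qed
  show ?thesis
    unfolding graded_free_resolution_def
  proof (intro conjI)
    show "\<forall>i. \<forall>l<frank ?C i. \<forall>j<frank ?C (Suc i). dmat ?C i l j \<in> polys V \<and>
        homogeneous (shift ?C (Suc i) j - shift ?C i l) (dmat ?C i l j)"
      using hom unfolding hom_mat_def by blast
    show "\<forall>j<frank ?C 0. aug ?C j \<in> polys V \<and> homogeneous (shift ?C 0 j) (aug ?C j)"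
      using resolution_aug[OF F] by simp
  qed (intro allI ballI surj exact_0 exact; assumption)+
qed

section \<open>Dimensions of subquotients\<close>

context vector_space
begin

lemma independent_disjoint_union:
  assumes A: "independent A" and B: "independent B" and AB: "span A \<inter> span B \<subseteq> {0}"
  shows "independent (A \<union> B)" "A \<inter> B = {}"
proof -
  show disj: "A \<inter> B = {}"
    using A B AB span_superset[of A] span_superset[of B] dependent_zero by blast
  show "independent (A \<union> B)"
  proof
    assume "dependent (A \<union> B)"
    then obtain t u v where t: "finite t" "t \<subseteq> A \<union> B" "(\<Sum>v\<in>t. scale (u v) v) = 0" "v \<in> t" "u v \<noteq> 0"
      unfolding dependent_explicit by blast
    define x where "x = (\<Sum>v\<in>t \<inter> A. scale (u v) v)"
    define y where "y = (\<Sum>v\<in>t \<inter> B. scale (u v) v)"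
    have "t = (t \<inter> A) \<union> (t \<inter> B)"
      using t(2) by blast
    then have "(\<Sum>v\<in>t. scale (u v) v) = x + y"
      unfolding x_def y_def using t(1) disj by (subst sum.union_disjoint[symmetric]) auto
    then have xy: "x = - y"
      using t(3) by (simp add: eq_neg_iff_add_eq_0)
    have "x \<in> span A" "y \<in> span B"
      unfolding x_def y_def by (intro span_sum span_scale span_base; simp)+
    then have "x = 0" "y = 0"
      using xy AB span_neg[of y B] by auto
    then have "u w = 0" if "w \<in> t" for w
    proof (cases "w \<in> A")
      case True
      have "finite (t \<inter> A)" using t(1) by simp
      then show ?thesis
        using independentD[OF A, of "t \<inter> A" u w] \<open>x = 0\<close> True that by (auto simp: x_def)
    next
      case False
      have "finite (t \<inter> B)" using t(1) by simp
      then show ?thesis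
        using independentD[OF B, of "t \<inter> B" u w] \<open>y = 0\<close> False that t(2) by (auto simp: y_def)
    qed
    then show False
      using t(4,5) by blast
  qed
qed

text \<open>Representations with respect to a basis are unique, so a vector in both spans has
  no coefficients.\<close>

lemma independent_span_Int:
  assumes C: "independent C" and A: "A \<subseteq> C" and B: "B \<subseteq> C" and AB: "A \<inter> B = {}"
  shows "span A \<inter> span B \<subseteq> {0}"
proof
  fix x assume "x \<in> span A \<inter> span B"
  then have x: "x \<in> span A" "x \<in> span B" by auto
  have rep: "representation C x = representation A x" "representation C x = representation B x"
    using representation_extend[OF C x(1) A] representation_extend[OF C x(2) B] .
  have "representation C x v = 0" for v
    using representation_ne_zero[of A x v] representation_ne_zero[of B x v] AB unfolding rep[symmetric] by auto
  moreover have "x \<in> span C"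
    using x(1) span_mono[OF A] by auto
  ultimately have "x = 0"
    using sum_nonzero_representation_eq[OF C, of x] by simp
  then show "x \<in> {0}" by simp
qed

lemma dim_subset_finite_span:
  assumes "S \<subseteq> T" "T \<subseteq> span W" "finite W"
  shows "dim S \<le> dim T"
proof -
  obtain A where A: "A \<subseteq> S" "independent A" "S \<subseteq> span A"
    using maximal_independent_subset .
  obtain B where B: "A \<subseteq> B" "B \<subseteq> T" "independent B" "T \<subseteq> span B"
    using maximal_independent_subset_extend[of A T] A assms(1) by blast
  have "finite B"
    using independent_span_bound[OF assms(3) B(3)] B(2) assms(2) by blast
  then show ?thesis
    using basis_card_eq_dim[OF A(1,3,2)] basis_card_eq_dim[OF B(2,4,3)] card_mono[OF _ B(1)] by simp
qed

text \<open>The last two hypotheses make \<open>f\<close> induce an injection from \<open>Z/B\<close> into \<open>Z'/B'\<close>.\<close>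

lemma dim_quotient_le:
  assumes f: "Vector_Spaces.linear scale scale f"
    and Z: "subspace Z" "Z \<subseteq> span W" and B: "subspace B" "B \<subseteq> Z"
    and Z': "subspace Z'" "Z' \<subseteq> span W'" and B': "subspace B'" "B' \<subseteq> Z'"
    and fin: "finite W" "finite W'"
    and fZ: "\<And>z. z \<in> Z \<Longrightarrow> f z \<in> Z'" and fB: "\<And>z. z \<in> Z \<Longrightarrow> f z \<in> B' \<Longrightarrow> z \<in> B"
  shows "dim Z - dim B \<le> dim Z' - dim B'"
proof -
  interpret f: Vector_Spaces.linear scale scale f by (rule f)
  obtain A where A: "A \<subseteq> B" "independent A" "B \<subseteq> span A"
    using maximal_independent_subset .
  obtain C where C: "A \<subseteq> C" "C \<subseteq> Z" "independent C" "Z \<subseteq> span C"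
    using maximal_independent_subset_extend[of A Z] A B(2) by blast
  obtain A' where A': "A' \<subseteq> B'" "independent A'" "B' \<subseteq> span A'"
    using maximal_independent_subset .
  \<comment> \<open>\<open>E\<close> is a basis of \<open>Z\<close> modulo \<open>B\<close>. Its image is independent modulo \<open>B'\<close>.\<close>
  define E where "E = C - A"
  have finC: "finite C"
    using independent_span_bound[OF fin(1) C(3)] C(2) Z(2) by blast
  have EZ: "span E \<subseteq> Z"
    using C(2) Z(1) by (intro span_minimal) (auto simp: E_def)
  have ker: "e = 0" if e: "e \<in> span E" "f e \<in> B'" for e
  proof -
    have "e \<in> span A"
      using fB[OF subsetD[OF EZ e(1)] e(2)] A(3) by blast
    then show ?thesis
      using independent_span_Int[OF C(3,1), of E] e(1) by (auto simp: E_def)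
  qed
  have inj: "inj_on f (span E)"
    unfolding f.inj_on_iff_eq_0[OF subspace_span] using ker subspace_0[OF B'(1)] by auto
  have indE: "independent E"
    using C(3) by (rule independent_mono) (auto simp: E_def)
  have indfE: "independent (f ` E)"
    by (rule f.independent_injective_image[OF indE inj])
  have "span (f ` E) \<inter> span A' \<subseteq> {0}"
  proof
    fix y assume y: "y \<in> span (f ` E) \<inter> span A'"
    then obtain e where e: "e \<in> span E" "y = f e"
      by (auto simp: f.span_image)
    have "y \<in> B'"
      using y span_minimal[OF A'(1) B'(1)] by auto
    then show "y \<in> {0}"
      using ker[OF e(1)] e(2) by simp
  qed
  note U = independent_disjoint_union[OF indfE A'(2) this]
  have sub: "f ` E \<union> A' \<subseteq> Z'"
    using A'(1) B'(2) fZ C(2) by (auto simp: E_def)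
  have finU: "finite (f ` E \<union> A')"
    using independent_span_bound[OF fin(2) U(1)] sub Z'(2) by blast
  have "card E + card A' = card (f ` E) + card A'"
    using inj_on_subset[OF inj span_superset] by (simp add: card_image)
  also have "\<dots> = card (f ` E \<union> A')"
    using finU U(2) by (subst card_Un_disjoint) auto
  also have "\<dots> = dim (f ` E \<union> A')"
    by (rule dim_eq_card_independent[symmetric, OF U(1)])
  also have "\<dots> \<le> dim Z'"
    by (rule dim_subset_finite_span[OF sub Z'(2) fin(2)])
  finally have "card E + dim B' \<le> dim Z'"
    by (simp add: basis_card_eq_dim[OF A'(1,3,2), symmetric])
  moreover have "dim Z = dim B + card E"
    using basis_card_eq_dim[OF A(1,3,2)] basis_card_eq_dim[OF C(2,4,3)] finC C(1)
      card_mono[OF finC C(1)] by (simp add: E_def card_Diff_subset finite_subset)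
  ultimately show ?thesis by simp
qed

lemma dim_direct_sum:
  assumes X: "subspace X" "X \<subseteq> span W" and Y: "subspace Y" "Y \<subseteq> span W'"
    and fin: "finite W" "finite W'"
    and f: "Vector_Spaces.linear scale scale f" and XY: "\<And>y. y \<in> Y \<Longrightarrow> f y \<in> X \<Longrightarrow> y = 0"
  shows "dim {x + f y | x y. x \<in> X \<and> y \<in> Y} = dim X + dim Y"
proof -
  interpret f: Vector_Spaces.linear scale scale f by (rule f)
  obtain A where A: "A \<subseteq> X" "independent A" "X \<subseteq> span A"
    using maximal_independent_subset .
  obtain B where B: "B \<subseteq> Y" "independent B" "Y \<subseteq> span B"
    using maximal_independent_subset .
  have span: "span A = X" "span B = Y"
    using A(1,3) B(1,3) span_minimal X(1) Y(1) by (metis subset_antisym)+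
  have inj: "inj_on f Y"
    unfolding f.inj_on_iff_eq_0[OF Y(1)] using XY subspace_0[OF X(1)] by auto
  have ind: "independent (f ` B)"
    by (rule f.independent_injective_image[OF B(2)]) (simp add: span inj)
  have "span A \<inter> span (f ` B) \<subseteq> {0}"
    unfolding f.span_image span using XY f.zero by blast
  note U = independent_disjoint_union[OF A(2) ind this]
  have finA: "finite A" "finite B"
    using independent_span_bound[OF fin(1) A(2)] A(1) X(2)
      independent_span_bound[OF fin(2) B(2)] B(1) Y(2) by auto
  have "{x + f y | x y. x \<in> X \<and> y \<in> Y} = span (A \<union> f ` B)"
    unfolding span_Un f.span_image span by blast
  then have "dim {x + f y | x y. x \<in> X \<and> y \<in> Y} = card (A \<union> f ` B)"
    by (simp only: dim_span_eq_card_independent[OF U(1)])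
  also have "\<dots> = card A + card B"
    using finA U(2) inj_on_subset[OF inj B(1)] by (simp add: card_Un_disjoint card_image)
  finally show ?thesis
    using basis_card_eq_dim[OF A(1,3,2)] basis_card_eq_dim[OF B(1,3,2)] by simp
qed

end

interpretation kvec: vector_space "\<lambda>(a::'k::field) (c :: nat \<Rightarrow> 'k) j. a * c j"
  by unfold_locales (auto simp: fun_eq_iff algebra_simps)

lemma kvec_subspaceI:
  assumes "(0 :: nat \<Rightarrow> 'k::field) \<in> S" "\<And>x y. x \<in> S \<Longrightarrow> y \<in> S \<Longrightarrow> x + y \<in> S"
    "\<And>c x. x \<in> S \<Longrightarrow> (\<lambda>j. c * x j) \<in> S"
  shows "kvec.subspace S"
  using assms by (auto simp: kvec.subspace_def)

lemma kvec_linearI: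
  assumes "\<And>x y. f (x + y) = f x + f y" "\<And>c x. f (\<lambda>j. c * x j) = (\<lambda>j. c * f x j)"
  shows "Vector_Spaces.linear (\<lambda>(a::'k::field) (c :: nat \<Rightarrow> 'k) j. a * c j) (\<lambda>(a::'k) (c :: nat \<Rightarrow> 'k) j. a * c j) f"
  by (intro Vector_Spaces.linear.intro kvec.vector_space_axioms module_hom.intro kvec.module_axioms
      module_hom_axioms.intro assms)

lemma sum_fun_apply: "(\<Sum>i\<in>I. f i) l = (\<Sum>i\<in>I. f i l)"
  by (induction I rule: infinite_finite_induct) auto

section \<open>Reduction modulo the variables\<close>

lemma tensor_comp_0 [simp]: "0 \<in> tensor_comp F i d"
  by (simp add: tensor_comp_def)

lemma tensor_comp_add: "x \<in> tensor_comp F i d \<Longrightarrow> y \<in> tensor_comp F i d \<Longrightarrow> x + y \<in> tensor_comp F i d"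
  unfolding tensor_comp_def by (auto, (metis add_0)+)

lemma tensor_comp_scale: "x \<in> tensor_comp F i d \<Longrightarrow> (\<lambda>j. c * x j) \<in> tensor_comp F i d"
  by (auto simp: tensor_comp_def)

lemma tensor_comp_uminus: "x \<in> tensor_comp F i d \<Longrightarrow> - x \<in> tensor_comp F i d"
  by (auto simp: tensor_comp_def)

lemma tensor_comp_beyond: "x \<in> tensor_comp F i d \<Longrightarrow> frank F i \<le> j \<Longrightarrow> x j = 0"
  by (force simp: tensor_comp_def)

lemma tensor_comp_span: "tensor_comp F i d \<subseteq> kvec.span (unit_vec ` {..<frank F i})"
proof
  fix c assume c: "c \<in> tensor_comp F i d"
  have "c = (\<Sum>j<frank F i. (\<lambda>l. c j * unit_vec j l))"
  proof (rule ext)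
    fix l
    have "(\<Sum>j<frank F i. (\<lambda>l. c j * unit_vec j l)) l = (\<Sum>j<frank F i. c j * unit_vec j l)"
      by (rule sum_fun_apply)
    also have "\<dots> = (if l < frank F i then c l else 0)"
      by (simp add: unit_vec_def if_distrib sum.delta' cong: if_cong)
    finally show "c l = (\<Sum>j<frank F i. (\<lambda>l. c j * unit_vec j l)) l"
      using c by (auto simp: tensor_comp_def)
  qed
  also have "\<dots> \<in> kvec.span (unit_vec ` {..<frank F i})"
    by (intro kvec.span_sum kvec.span_scale kvec.span_base) auto
  finally show "c \<in> kvec.span (unit_vec ` {..<frank F i})" .
qed

lemma tensor_dmap_add: "tensor_dmap F i (x + y) = tensor_dmap F i x + tensor_dmap F i y"
  and tensor_dmap_uminus: "tensor_dmap F i (- x) = - tensor_dmap F i x"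
  and tensor_dmap_0 [simp]: "tensor_dmap F i 0 = 0"
  and tensor_dmap_scale: "tensor_dmap F i (\<lambda>j. c * x j) = (\<lambda>l. c * tensor_dmap F i x l)"
  by (simp_all add: tensor_dmap_mat_app mat_app_add mat_app_uminus mat_app_scale)

text \<open>Together with \<open>reduce_vec\<close> below, this is how identities between maps of free modules are
  transported to the reduced complex: they are evaluated at constant vectors and then reduced.\<close>

definition const_vec :: "(nat \<Rightarrow> 'k::field) \<Rightarrow> nat \<Rightarrow> ('v, 'k) mpoly" where
  "const_vec c = (\<lambda>j. Poly_Mapping.single 0 (c j))"

definition reduce_vec :: "(nat \<Rightarrow> ('v, 'k::field) mpoly) \<Rightarrow> nat \<Rightarrow> 'k" where
  "reduce_vec x = (\<lambda>j. ccoeff (x j))"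

lemma reduce_const_vec [simp]: "reduce_vec (const_vec c) = c"
  by (simp add: const_vec_def reduce_vec_def)

lemma reduce_vec_mat_app:
  "reduce_vec (mat_app a b A x) = mat_app a b (\<lambda>l j. ccoeff (A l j)) (reduce_vec x)"
  by (rule ext) (simp add: reduce_vec_def mat_app_def ccoeff_sum ccoeff_mult)

lemma reduce_vec_dmap: "reduce_vec (dmap F i x) = tensor_dmap F i (reduce_vec x)"
  by (simp add: dmap_mat_app tensor_dmap_mat_app reduce_vec_mat_app)

lemma reduce_vec_diff: "reduce_vec (x - y) = reduce_vec x - reduce_vec y"
  by (rule ext) (simp add: reduce_vec_def lookup_minus)

lemma reduce_vec_0 [simp]: "reduce_vec 0 = 0"
  by (rule ext) (simp add: reduce_vec_def)

lemma const_vec_free_mod: "(\<And>j. n \<le> j \<Longrightarrow> c j = 0) \<Longrightarrow> const_vec c \<in> free_mod V n"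
  by (simp add: free_mod_def const_vec_def polys_const)

text \<open>An entry of a homogeneous matrix can have a nonzero constant coefficient only if it
  is of degree \<open>0\<close>, so the reduced matrix relates basis elements of matching degrees only.\<close>

lemma tensor_comp_mat_app:
  assumes A: "hom_mat V (frank F i) (shift F i) (frank G k) (\<lambda>j. shift G k j + e) A"
    and c: "c \<in> tensor_comp G k (d - e)"
  shows "mat_app (frank F i) (frank G k) (\<lambda>l j. ccoeff (A l j)) c \<in> tensor_comp F i d"
  unfolding tensor_comp_def
proof (intro CollectI allI impI conjI)
  fix l assume ne: "mat_app (frank F i) (frank G k) (\<lambda>l j. ccoeff (A l j)) c l \<noteq> 0"
  then show l: "l < frank F i"
    by (auto simp: mat_app_def split: if_splits)
  from ne l obtain j where j: "j < frank G k" "ccoeff (A l j) \<noteq> 0" "c j \<noteq> 0"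
    by (auto simp: mat_app_def elim: sum.not_neutral_contains_not_neutral)
  have "shift G k j + e - shift F i l = 0"
    using ccoeff_homogeneous[OF hom_matD(2)[OF A l j(1)] j(2)] by simp
  moreover have "shift G k j = d - e"
    using c j(3) by (simp add: tensor_comp_def)
  ultimately show "shift F i l = d" by simp
qed

lemma tensor_comp_dmap:
  assumes "graded_free_resolution V J F" "c \<in> tensor_comp F (Suc i) d"
  shows "tensor_dmap F i c \<in> tensor_comp F i d"
  unfolding tensor_dmap_mat_app
  using tensor_comp_mat_app[of V F i F "Suc i" 0 "dmat F i" c d] resolution_hom_mat[OF assms(1), of i] assms(2)
  by simp

lemma tensor_dmap_dmap:
  assumes F: "graded_free_resolution V J F" and c: "c \<in> tensor_comp F (Suc (Suc i)) d"
  shows "tensor_dmap F i (tensor_dmap F (Suc i) c) = 0"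
proof -
  have "const_vec c \<in> free_mod V (frank F (Suc (Suc i)))"
    by (intro const_vec_free_mod tensor_comp_beyond[OF c])
  from arg_cong[OF resolution_dmap_dmap[OF F this], of reduce_vec]
  show ?thesis by (simp add: reduce_vec_dmap)
qed

lemma tensor_boundaries_subset_cycles:
  assumes F: "graded_free_resolution V J F"
  shows "tensor_boundaries F r d \<subseteq> tensor_cycles F r d"
  using tensor_comp_dmap[OF F] tensor_dmap_dmap[OF F]
  by (auto simp: tensor_boundaries_def tensor_cycles_def split: nat.split)

lemma tensor_cycles_subset_comp: "tensor_cycles F r d \<subseteq> tensor_comp F r d"
  by (auto simp: tensor_cycles_def)

lemma subspace_tensor_cycles: "kvec.subspace (tensor_cycles F r d)"
proof (rule kvec_subspaceI)
  show "(\<lambda>j. c * x j) \<in> tensor_cycles F r d" if "x \<in> tensor_cycles F r d" for c x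
    using that tensor_comp_scale[of x F _ d c]
    by (cases r) (simp_all add: tensor_cycles_def tensor_dmap_scale fun_eq_iff)
qed (auto simp: tensor_cycles_def tensor_comp_add tensor_dmap_add split: nat.splits)

lemma subspace_tensor_boundaries: "kvec.subspace (tensor_boundaries F r d)"
  unfolding tensor_boundaries_def
proof (rule kvec_subspaceI)
  show "0 \<in> tensor_dmap F r ` tensor_comp F (Suc r) d"
    by (rule image_eqI[of _ _ 0]) simp_all
  show "x + y \<in> tensor_dmap F r ` tensor_comp F (Suc r) d"
    if "x \<in> tensor_dmap F r ` tensor_comp F (Suc r) d" "y \<in> tensor_dmap F r ` tensor_comp F (Suc r) d" for x y
    using that by (auto simp: tensor_dmap_add[symmetric] intro!: imageI tensor_comp_add)
  show "(\<lambda>j. c * x j) \<in> tensor_dmap F r ` tensor_comp F (Suc r) d"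
    if "x \<in> tensor_dmap F r ` tensor_comp F (Suc r) d" for c x
    using that by (auto simp: tensor_dmap_scale[symmetric] intro!: imageI tensor_comp_scale)
qed

section \<open>Betti numbers do not depend on the resolution\<close>

text \<open>A resolution of \<open>R/R = 0\<close> is an exact complex of free modules that ends in \<open>F\<^sub>0\<close>, and
  such a complex has a contracting homotopy. Its maps are lifts along \<open>\<partial>\<close> of the identity minus what
  the previous map of the homotopy already achieves.\<close>

lemma exact_contraction:
  fixes F :: "('v, 'k::field) free_complex"
  assumes F: "graded_free_resolution V (polys V) F"
  shows "\<exists>h. (\<forall>i. hom_mat V (frank F (Suc i)) (shift F (Suc i)) (frank F i) (shift F i) (h i)) \<and>
    (\<forall>x\<in>free_mod V (frank F 0). dmap F 0 (mat_app (frank F 1) (frank F 0) (h 0) x) = x) \<and>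
    (\<forall>i. \<forall>x\<in>free_mod V (frank F (Suc i)).
      dmap F (Suc i) (mat_app (frank F (Suc (Suc i))) (frank F (Suc i)) (h (Suc i)) x) =
      x - mat_app (frank F (Suc i)) (frank F i) (h i) (dmap F i x))"
proof -
  let ?app = "\<lambda>i h. mat_app (frank F (Suc i)) (frank F i) h"
  \<comment> \<open>The last conjunct of the invariant makes \<open>id - h \<partial>\<close> a map into the kernel of \<open>\<partial>\<close>.\<close>
  define P where "P i h \<longleftrightarrow> hom_mat V (frank F (Suc i)) (shift F (Suc i)) (frank F i) (shift F i) h \<and>
      (i = 0 \<longrightarrow> (\<forall>x\<in>free_mod V (frank F 0). dmap F 0 (?app 0 h x) = x)) \<and>
      (\<forall>x\<in>free_mod V (frank F (Suc i)). dmap F i (?app i h (dmap F i x)) = dmap F i x)"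
    for i and h :: "nat \<Rightarrow> nat \<Rightarrow> ('v, 'k) mpoly"
  define Q where "Q i h h' \<longleftrightarrow> (\<forall>x\<in>free_mod V (frank F (Suc i)).
      dmap F (Suc i) (?app (Suc i) h' x) = x - ?app i h (dmap F i x))" for i h h'
  have "\<exists>h. \<forall>i. P i (h i) \<and> Q i (h i) (h (Suc i))"
  proof (rule dependent_nat_choice)
    have "\<exists>h. hom_mat V (frank F 1) (shift F 1) (frank F 0) (shift F 0) h \<and>
        (\<forall>x. mat_app (frank F 0) (frank F 1) (dmat F 0) (mat_app (frank F 1) (frank F 0) h x)
          = mat_app (frank F 0) (frank F 0) id_mat x)"
    proof (rule lift_matrix[OF _ hom_mat_id])
      show "hom_mat V (frank F 0) (shift F 0) (frank F 1) (shift F 1) (dmat F 0)"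
        using resolution_hom_mat[OF F, of 0] by simp
      fix j assume "j < frank F 0"
      then have j: "unit_vec j \<in> free_mod V (frank F 0)"
        by (rule free_mod_unit_vec)
      then show "\<exists>y\<in>free_mod V (frank F 1). mat_app (frank F 0) (frank F 1) (dmat F 0) y =
          mat_app (frank F 0) (frank F 0) id_mat (unit_vec j)"
        using resolution_exact_0[OF F j] augmap_polys[OF F j]
        by (simp add: mat_app_id free_modD[OF j] dmap_mat_app)
    qed
    then obtain h where h: "hom_mat V (frank F 1) (shift F 1) (frank F 0) (shift F 0) h"
      "\<And>x. dmap F 0 (?app 0 h x) = mat_app (frank F 0) (frank F 0) id_mat x"
      by (auto simp: dmap_mat_app)
    have id: "dmap F 0 (?app 0 h x) = x" if "x \<in> free_mod V (frank F 0)" for x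
      unfolding h(2) by (rule mat_app_id) (rule free_modD[OF that])
    have "P 0 h"
      using h(1) id resolution_dmap_free_mod[OF F, of _ 0] by (simp add: P_def)
    then show "\<exists>h. P 0 h" by blast
  next
    fix h i assume P: "P i h"
    define Z where "Z = (\<lambda>l j. id_mat l j - mat_mul (frank F i) h (dmat F i) l j)"
    have homZ: "hom_mat V (frank F (Suc i)) (shift F (Suc i)) (frank F (Suc i)) (shift F (Suc i)) Z"
      unfolding Z_def using P
      by (auto simp: P_def intro!: hom_mat_diff hom_mat_id hom_mat_mul resolution_hom_mat[OF F])
    have appZ: "mat_app (frank F (Suc i)) (frank F (Suc i)) Z x = x - ?app i h (dmap F i x)"
      if x: "x \<in> free_mod V (frank F (Suc i))" for x
      unfolding Z_def mat_app_mat_diff dmap_mat_app mat_app_mul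
      by (simp add: mat_app_id free_modD[OF x])
    have happ: "?app i h x \<in> free_mod V (frank F (Suc i))" if "x \<in> free_mod V (frank F i)" for x
      using P that by (auto simp: P_def intro: free_mod_mat_app)
    have ker: "dmap F i (x - ?app i h (dmap F i x)) = 0" if x: "x \<in> free_mod V (frank F (Suc i))" for x
      using P x by (simp add: P_def dmap_diff)
    have "\<exists>h'. hom_mat V (frank F (Suc (Suc i))) (shift F (Suc (Suc i))) (frank F (Suc i)) (shift F (Suc i)) h' \<and>
        (\<forall>x. mat_app (frank F (Suc i)) (frank F (Suc (Suc i))) (dmat F (Suc i)) (?app (Suc i) h' x)
          = mat_app (frank F (Suc i)) (frank F (Suc i)) Z x)"
    proof (rule lift_matrix[OF resolution_hom_mat[OF F] homZ])
      fix j assume "j < frank F (Suc i)"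
      then have j: "unit_vec j \<in> free_mod V (frank F (Suc i))"
        by (rule free_mod_unit_vec)
      have "unit_vec j - ?app i h (dmap F i (unit_vec j)) \<in> free_mod V (frank F (Suc i))"
        by (intro free_mod_diff j happ resolution_dmap_free_mod[OF F])
      then show "\<exists>y\<in>free_mod V (frank F (Suc (Suc i))).
          mat_app (frank F (Suc i)) (frank F (Suc (Suc i))) (dmat F (Suc i)) y =
          mat_app (frank F (Suc i)) (frank F (Suc i)) Z (unit_vec j)"
        using resolution_exact[OF F] ker[OF j] by (simp add: appZ[OF j] dmap_mat_app[of F "Suc i", symmetric])
    qed
    then obtain h' where h': "hom_mat V (frank F (Suc (Suc i))) (shift F (Suc (Suc i))) (frank F (Suc i)) (shift F (Suc i)) h'"
      and dh': "\<And>x. dmap F (Suc i) (?app (Suc i) h' x) = mat_app (frank F (Suc i)) (frank F (Suc i)) Z x"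
      by (auto simp: dmap_mat_app)
    have Q: "Q i h h'"
      unfolding Q_def dh' using appZ by blast
    have "dmap F (Suc i) (?app (Suc i) h' (dmap F (Suc i) x)) = dmap F (Suc i) x"
      if x: "x \<in> free_mod V (frank F (Suc (Suc i)))" for x
      using resolution_dmap_free_mod[OF F x] by (simp add: dh' appZ resolution_dmap_dmap[OF F x])
    then have "P (Suc i) h'"
      using h' by (simp add: P_def)
    then show "\<exists>h'. P (Suc i) h' \<and> Q i h h'"
      using Q by blast
  qed
  then show ?thesis
    by (auto simp: P_def Q_def)
qed

text \<open>The contracting homotopy survives reduction modulo the variables.\<close>

lemma tensor_exact:
  assumes F: "graded_free_resolution V (polys V) F"
  shows "tensor_cycles F r d \<subseteq> tensor_boundaries F r d"
proof
  fix c assume cyc: "c \<in> tensor_cycles F r d"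
  then have c: "c \<in> tensor_comp F r d"
    using tensor_cycles_subset_comp by blast
  obtain h where h: "\<And>i. hom_mat V (frank F (Suc i)) (shift F (Suc i)) (frank F i) (shift F i) (h i)"
    and h0: "\<And>x. x \<in> free_mod V (frank F 0) \<Longrightarrow> dmap F 0 (mat_app (frank F 1) (frank F 0) (h 0) x) = x"
    and hSuc: "\<And>i x. x \<in> free_mod V (frank F (Suc i)) \<Longrightarrow>
      dmap F (Suc i) (mat_app (frank F (Suc (Suc i))) (frank F (Suc i)) (h (Suc i)) x) =
      x - mat_app (frank F (Suc i)) (frank F i) (h i) (dmap F i x)"
    using exact_contraction[OF F] by blast
  let ?h = "\<lambda>i. mat_app (frank F (Suc i)) (frank F i) (\<lambda>l j. ccoeff (h i l j))"
  have x: "const_vec c \<in> free_mod V (frank F r)"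
    by (intro const_vec_free_mod tensor_comp_beyond[OF c])
  have "tensor_dmap F r (?h r c) = c"
  proof (cases r)
    case 0
    have "const_vec c \<in> free_mod V (frank F 0)" using x 0 by simp
    from arg_cong[OF h0[OF this], of reduce_vec] show ?thesis
      by (simp add: 0 reduce_vec_dmap reduce_vec_mat_app)
  next
    case (Suc i)
    have x': "const_vec c \<in> free_mod V (frank F (Suc i))" using x Suc by simp
    have "tensor_dmap F i c = 0"
      using cyc Suc by (simp add: tensor_cycles_def)
    with arg_cong[OF hSuc[OF x'], of reduce_vec] show ?thesis
      by (simp add: Suc reduce_vec_dmap reduce_vec_mat_app reduce_vec_diff)
  qed
  moreover have "?h r c \<in> tensor_comp F (Suc r) d"
    using tensor_comp_mat_app[of V F "Suc r" F r 0 "h r" c d] h[of r] c by simp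
  ultimately show "c \<in> tensor_boundaries F r d"
    unfolding tensor_boundaries_def by (metis imageI)
qed

lemma tensor_comp_cone_join:
  assumes "f \<in> tensor_comp F (Suc i) d" "g \<in> tensor_comp G i (d - e)"
  shows "vec_join (frank F (Suc i)) f g \<in> tensor_comp (cone F G \<phi> e) (Suc i) d"
  using assms by (fastforce simp: tensor_comp_def vec_join_def split: if_splits)

lemma tensor_comp_cone_0: "tensor_comp (cone F G \<phi> e) 0 d = tensor_comp F 0 d"
  by (auto simp: tensor_comp_def)

lemma tensor_comp_cone_split:
  assumes "x \<in> tensor_comp (cone F G \<phi> e) (Suc i) d"
  obtains f g where "x = vec_join (frank F (Suc i)) f g" "f \<in> tensor_comp F (Suc i) d" "g \<in> tensor_comp G i (d - e)"
proof
  let ?a = "frank F (Suc i)"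
  show "x = vec_join ?a (\<lambda>j. if j < ?a then x j else 0) (\<lambda>j. x (j + ?a))"
    by (rule ext) (simp add: vec_join_def)
  show "(\<lambda>j. if j < ?a then x j else 0) \<in> tensor_comp F (Suc i) d"
    unfolding tensor_comp_def
  proof (intro CollectI allI impI)
    fix j assume "(if j < ?a then x j else 0) \<noteq> 0"
    then have "j < ?a" "x j \<noteq> 0"
      by (auto split: if_splits)
    moreover from this have "shift (cone F G \<phi> e) (Suc i) j = d"
      using assms by (auto simp: tensor_comp_def simp del: cone_simps(2))
    ultimately show "j < ?a \<and> shift F (Suc i) j = d" by simp
  qed
  show "(\<lambda>j. x (j + ?a)) \<in> tensor_comp G i (d - e)"
    unfolding tensor_comp_def
  proof (intro CollectI allI impI)
    fix j assume "x (j + ?a) \<noteq> 0"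
    then have "j + ?a < ?a + frank G i" "shift (cone F G \<phi> e) (Suc i) (j + ?a) = d"
      using assms by (auto simp: tensor_comp_def simp del: cone_simps(2))
    then show "j < frank G i \<and> shift G i j = d - e" by auto
  qed
qed

lemma tensor_boundary_cone:
  assumes "f \<in> tensor_comp F (Suc i) d" "g \<in> tensor_comp G i (d - e)"
  shows "vec_join (frank F i) (tensor_dmap F i f + mat_app (frank F i) (frank G i) (\<lambda>l j. ccoeff (\<phi> i l j)) g)
      (- prev 0 (tensor_dmap G) i g) \<in> tensor_boundaries (cone F G \<phi> e) i d"
  using imageI[OF tensor_comp_cone_join[OF assms, of \<phi>], of "tensor_dmap (cone F G \<phi> e) i"]
  unfolding tensor_dmap_cone tensor_boundaries_def .

lemma tensor_boundary_coneE:
  assumes "x \<in> tensor_boundaries (cone F G \<phi> e) i d"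
  obtains f g where "f \<in> tensor_comp F (Suc i) d" "g \<in> tensor_comp G i (d - e)"
    "x = vec_join (frank F i) (tensor_dmap F i f + mat_app (frank F i) (frank G i) (\<lambda>l j. ccoeff (\<phi> i l j)) g)
      (- prev 0 (tensor_dmap G) i g)"
proof -
  obtain y where y: "y \<in> tensor_comp (cone F G \<phi> e) (Suc i) d" "x = tensor_dmap (cone F G \<phi> e) i y"
    using assms by (auto simp: tensor_boundaries_def)
  obtain f g where "y = vec_join (frank F (Suc i)) f g" "f \<in> tensor_comp F (Suc i) d" "g \<in> tensor_comp G i (d - e)"
    using tensor_comp_cone_split[OF y(1)] .
  then show thesis
    using that y(2) by (simp only: tensor_dmap_cone)
qed

text \<open>A comparison map induces an injection on the homology of the reduced complexes. The
  opposite inequality follows by exchanging the two resolutions, so nothing has to be shown about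
  homotopies between comparison maps.\<close>

lemma tor_dim_le:
  assumes F: "graded_free_resolution V J F" and G: "graded_free_resolution V J G" and J: "graded_ideal V J"
  shows "tor_dim G r d \<le> tor_dim F r d"
proof -
  have "\<exists>\<phi>. chain_lift V J F G 1 0 \<phi>"
    by (rule chain_lift_exists[OF F G J]) simp_all
  then obtain \<phi> where \<phi>: "chain_lift V J F G 1 0 \<phi>" ..
  let ?C = "cone F G \<phi> 0"
  have "{f + 1 * g | f g. f \<in> J \<and> g \<in> polys V} = polys V"
  proof
    show "polys V \<subseteq> {f + 1 * g | f g. f \<in> J \<and> g \<in> polys V}"
      using graded_idealD(2)[OF J] by force
    show "{f + 1 * g | f g. f \<in> J \<and> g \<in> polys V} \<subseteq> polys V"
      using graded_idealD(1)[OF J] by (auto intro: polys_add)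
  qed
  moreover have "graded_free_resolution V {f + 1 * g | f g. f \<in> J \<and> g \<in> polys V} ?C"
    using graded_idealD(1)[OF J] by (intro cone_resolution[OF F G J _ _ \<phi>]) auto
  \<comment> \<open>The cone resolves \<open>R/R = 0\<close>.\<close>
  ultimately have C: "graded_free_resolution V (polys V) ?C" by simp
  let ?f = "mat_app (frank F r) (frank G r) (\<lambda>l j. ccoeff (\<phi> r l j))"
  have comm: "tensor_dmap F i (mat_app (frank F (Suc i)) (frank G (Suc i)) (\<lambda>l j. ccoeff (\<phi> (Suc i) l j)) c) =
      mat_app (frank F i) (frank G i) (\<lambda>l j. ccoeff (\<phi> i l j)) (tensor_dmap G i c)"
    if c: "c \<in> tensor_comp G (Suc i) d" for i c
  proof -
    have "const_vec c \<in> free_mod V (frank G (Suc i))"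
      by (intro const_vec_free_mod tensor_comp_beyond[OF c])
    from arg_cong[OF chain_liftD(3)[OF \<phi> this], of reduce_vec] show ?thesis
      by (simp add: reduce_vec_dmap reduce_vec_mat_app)
  qed
  have fcomp: "?f c \<in> tensor_comp F r d" if "c \<in> tensor_comp G r d" for c
    using tensor_comp_mat_app[OF chain_liftD(1)[OF \<phi>, of r], of c d] that by simp
  show ?thesis
    unfolding tor_dim_def
  proof (rule kvec.dim_quotient_le[of ?f])
    show "Vector_Spaces.linear (\<lambda>a c j. a * c j) (\<lambda>a c j. a * c j) ?f"
      by (rule kvec_linearI) (simp_all add: mat_app_add mat_app_scale)
    show "tensor_cycles G r d \<subseteq> kvec.span (unit_vec ` {..<frank G r})"
      "tensor_cycles F r d \<subseteq> kvec.span (unit_vec ` {..<frank F r})"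
      using tensor_cycles_subset_comp tensor_comp_span by blast+
    fix c assume c: "c \<in> tensor_cycles G r d"
    then have cc: "c \<in> tensor_comp G r d"
      using tensor_cycles_subset_comp by blast
    show "?f c \<in> tensor_cycles F r d"
      using c fcomp[OF cc] comm by (auto simp: tensor_cycles_def split: nat.splits)
    assume "?f c \<in> tensor_boundaries F r d"
    then obtain b where b: "b \<in> tensor_comp F (Suc r) d" "?f c = tensor_dmap F r b"
      by (auto simp: tensor_boundaries_def)
    have "prev 0 (tensor_dmap G) r c = 0"
      using c by (auto simp: tensor_cycles_def split: nat.splits)
    \<comment> \<open>If the image of \<open>c\<close> is the boundary of \<open>b\<close>, then \<open>(- b, c)\<close> is a cycle of the reduced cone.
      It is a boundary by exactness, and the second component exhibits \<open>c\<close> as a boundary.\<close>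
    then have "tensor_dmap ?C r (vec_join (frank F (Suc r)) (- b) c) = 0"
      unfolding tensor_dmap_cone by (simp add: b(2) tensor_dmap_uminus vec_join_0)
    then have "vec_join (frank F (Suc r)) (- b) c \<in> tensor_cycles ?C (Suc r) d"
      using tensor_comp_cone_join[OF tensor_comp_uminus[OF b(1)], of c G 0] cc
      by (simp add: tensor_cycles_def)
    then have "vec_join (frank F (Suc r)) (- b) c \<in> tensor_boundaries ?C (Suc r) d"
      using tensor_exact[OF C] by blast
    then obtain f g where fg: "f \<in> tensor_comp F (Suc (Suc r)) d" "g \<in> tensor_comp G (Suc r) d"
      "vec_join (frank F (Suc r)) (- b) c = vec_join (frank F (Suc r))
        (tensor_dmap F (Suc r) f + mat_app (frank F (Suc r)) (frank G (Suc r)) (\<lambda>l j. ccoeff (\<phi> (Suc r) l j)) g)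
        (- tensor_dmap G r g)"
      by (auto elim: tensor_boundary_coneE)
    have "c = - tensor_dmap G r g"
    proof (rule ext)
      fix j show "c j = (- tensor_dmap G r g) j"
        using fun_cong[OF fg(3), of "j + frank F (Suc r)"] by (simp add: vec_join_def)
    qed
    then show "c \<in> tensor_boundaries G r d"
      using tensor_comp_uminus[OF fg(2)] by (auto simp: tensor_boundaries_def tensor_dmap_uminus[symmetric])
  qed (auto simp: subspace_tensor_cycles subspace_tensor_boundaries
      tensor_boundaries_subset_cycles[OF F, THEN subsetD] tensor_boundaries_subset_cycles[OF G, THEN subsetD])
qed

theorem tor_dim_unique:
  assumes "graded_free_resolution V J F" "graded_free_resolution V J G" "graded_ideal V J"
  shows "tor_dim F r d = tor_dim G r d"
  using assms by (intro antisym tor_dim_le)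

section \<open>The cone over a map with entries in the maximal ideal\<close>

lemma kdim_join:
  assumes X: "kvec.subspace X" "X \<subseteq> tensor_comp F i d" and Y: "kvec.subspace Y" "Y \<subseteq> tensor_comp G k d'"
  shows "kdim {vec_join (frank F i) f g | f g. f \<in> X \<and> g \<in> Y} = kdim X + kdim Y"
proof -
  let ?a = "frank F i"
  have "{vec_join ?a f g | f g. f \<in> X \<and> g \<in> Y} = {f + vec_join ?a 0 g | f g. f \<in> X \<and> g \<in> Y}"
  proof -
    have "vec_join ?a f g = f + vec_join ?a 0 g" if "f \<in> X" for f g
      using subsetD[OF X(2) that] by (intro ext) (auto simp: vec_join_def tensor_comp_beyond)
    then show ?thesis by (metis (lifting))
  qed
  also have "kdim \<dots> = kdim X + kdim Y"
  proof (rule kvec.dim_direct_sum[OF X(1) _ Y(1)])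
    show "X \<subseteq> kvec.span (unit_vec ` {..<frank F i})" "Y \<subseteq> kvec.span (unit_vec ` {..<frank G k})"
      using X(2) Y(2) tensor_comp_span by blast+
    show "Vector_Spaces.linear (\<lambda>a c j. a * c j) (\<lambda>a c j. a * c j) (vec_join ?a 0)"
      by (rule kvec_linearI) (auto simp: vec_join_def fun_eq_iff)
    fix y assume "vec_join ?a 0 y \<in> X"
    then have "vec_join ?a 0 y \<in> tensor_comp F i d"
      using X(2) by blast
    then have "vec_join ?a 0 y (j + ?a) = 0" for j
      by (rule tensor_comp_beyond) simp
    then show "y = 0"
      by (intro ext) (simp add: vec_join_def)
  qed auto
  finally show ?thesis .
qed

text \<open>A cone over a map that vanishes modulo the variables reduces to the direct sum of
  \<open>F\<close> and of \<open>G\<close> shifted by one.\<close>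

lemma tor_dim_cone:
  fixes F :: "('v, 'k::field) free_complex"
  assumes F: "graded_free_resolution V J F" and G: "graded_free_resolution V J' G"
    and \<phi>: "\<And>i l j. l < frank F i \<Longrightarrow> j < frank G i \<Longrightarrow> ccoeff (\<phi> i l j) = 0"
  shows "tor_dim (cone F G \<phi> e) r d = tor_dim F r d + (case r of 0 \<Rightarrow> 0 | Suc k \<Rightarrow> tor_dim G k (d - e))"
proof -
  let ?C = "cone F G \<phi> e"
  have \<phi>0: "mat_app (frank F i) (frank G i) (\<lambda>l j. ccoeff (\<phi> i l j)) g = 0" for i g
    using \<phi> by (auto simp: mat_app_def fun_eq_iff)
  have dC: "tensor_dmap ?C i (vec_join (frank F (Suc i)) f g) =
      vec_join (frank F i) (tensor_dmap F i f) (- prev 0 (tensor_dmap G) i g)" for i f g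
    by (simp add: tensor_dmap_cone \<phi>0)
  have beyond: "tensor_dmap F i f j = 0" if "frank F i \<le> j" for i f j
    using that by (simp add: tensor_dmap_def)
  have bd: "tensor_boundaries ?C i d = {vec_join (frank F i) f g | f g. f \<in> tensor_boundaries F i d \<and>
      g \<in> (case i of 0 \<Rightarrow> {0} | Suc k \<Rightarrow> tensor_boundaries G k (d - e))}" for i
  proof (intro set_eqI iffI)
    fix x assume "x \<in> tensor_boundaries ?C i d"
    then obtain f g where fg: "f \<in> tensor_comp F (Suc i) d" "g \<in> tensor_comp G i (d - e)"
      "x = vec_join (frank F i) (tensor_dmap F i f) (- prev 0 (tensor_dmap G) i g)"
      by (auto elim!: tensor_boundary_coneE simp: \<phi>0)
    have "- prev 0 (tensor_dmap G) i g \<in> (case i of 0 \<Rightarrow> {0} | Suc k \<Rightarrow> tensor_boundaries G k (d - e))"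
      using tensor_comp_uminus[OF fg(2)]
      by (auto simp: tensor_boundaries_def tensor_dmap_uminus[symmetric] split: nat.split)
    moreover have "tensor_dmap F i f \<in> tensor_boundaries F i d"
      using fg(1) by (simp add: tensor_boundaries_def)
    ultimately show "x \<in> {vec_join (frank F i) f g | f g. f \<in> tensor_boundaries F i d \<and>
        g \<in> (case i of 0 \<Rightarrow> {0} | Suc k \<Rightarrow> tensor_boundaries G k (d - e))}"
      using fg(3) by blast
  next
    fix x assume "x \<in> {vec_join (frank F i) f g | f g. f \<in> tensor_boundaries F i d \<and>
        g \<in> (case i of 0 \<Rightarrow> {0} | Suc k \<Rightarrow> tensor_boundaries G k (d - e))}"
    then obtain f g where fg: "x = vec_join (frank F i) (tensor_dmap F i f) g" "f \<in> tensor_comp F (Suc i) d"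
      "g \<in> (case i of 0 \<Rightarrow> {0} | Suc k \<Rightarrow> tensor_boundaries G k (d - e))"
      by (auto simp: tensor_boundaries_def)
    have "\<exists>g'\<in>tensor_comp G i (d - e). g = - prev 0 (tensor_dmap G) i g'"
    proof (cases i)
      case 0
      then show ?thesis using fg(3) by (intro bexI[of _ 0]) auto
    next
      case (Suc k)
      then obtain g' where g': "g' \<in> tensor_comp G (Suc k) (d - e)" "g = tensor_dmap G k g'"
        using fg(3) by (auto simp: tensor_boundaries_def)
      show ?thesis
        using Suc g' by (intro bexI[of _ "- g'"]) (auto simp: tensor_dmap_uminus tensor_comp_uminus)
    qed
    then show "x \<in> tensor_boundaries ?C i d"
      using tensor_boundary_cone[OF fg(2), of _ G e \<phi>] fg(1) by (auto simp: \<phi>0)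
  qed
  show ?thesis
  proof (cases r)
    case 0
    have "tensor_boundaries ?C 0 d = tensor_boundaries F 0 d"
    proof -
      have "vec_join (frank F 0) f 0 = f" if "f \<in> tensor_boundaries F 0 d" for f
        using that beyond by (intro vec_join_0_right) (auto simp: tensor_boundaries_def)
      then have "(\<lambda>f. vec_join (frank F 0) f 0) ` tensor_boundaries F 0 d = id ` tensor_boundaries F 0 d"
        by (intro image_cong) simp_all
      moreover have "tensor_boundaries ?C 0 d = (\<lambda>f. vec_join (frank F 0) f 0) ` tensor_boundaries F 0 d"
        unfolding bd nat.case by blast
      ultimately show ?thesis by simp
    qed
    moreover have "tensor_cycles ?C 0 d = tensor_cycles F 0 d"
      by (simp add: tensor_cycles_def tensor_comp_cone_0)
    ultimately show ?thesis
      by (simp add: 0 tor_dim_def)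
  next
    case (Suc k)
    have cyc: "tensor_cycles ?C (Suc k) d =
        {vec_join (frank F (Suc k)) f g | f g. f \<in> tensor_cycles F (Suc k) d \<and> g \<in> tensor_cycles G k (d - e)}"
    proof (intro set_eqI iffI)
      have d0: "tensor_dmap ?C k (vec_join (frank F (Suc k)) f g) = 0 \<longleftrightarrow>
          tensor_dmap F k f = 0 \<and> prev 0 (tensor_dmap G) k g = 0" for f g
        unfolding dC by (subst vec_join_eq_0_iff) (simp_all add: beyond)
      {
        fix x assume x: "x \<in> tensor_cycles ?C (Suc k) d"
        then have "x \<in> tensor_comp ?C (Suc k) d"
          using tensor_cycles_subset_comp by blast
        then obtain f g where fg: "x = vec_join (frank F (Suc k)) f g"
          "f \<in> tensor_comp F (Suc k) d" "g \<in> tensor_comp G k (d - e)"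
          by (rule tensor_comp_cone_split)
        then have "tensor_dmap F k f = 0 \<and> prev 0 (tensor_dmap G) k g = 0"
          using x d0 by (simp add: tensor_cycles_def)
        then have "f \<in> tensor_cycles F (Suc k) d" "g \<in> tensor_cycles G k (d - e)"
          using fg(2,3) by (auto simp: tensor_cycles_def split: nat.splits)
        then show "x \<in> {vec_join (frank F (Suc k)) f g | f g. f \<in> tensor_cycles F (Suc k) d \<and> g \<in> tensor_cycles G k (d - e)}"
          using fg(1) by blast
      next
        fix x assume "x \<in> {vec_join (frank F (Suc k)) f g | f g. f \<in> tensor_cycles F (Suc k) d \<and> g \<in> tensor_cycles G k (d - e)}"
        then obtain f g where fg: "x = vec_join (frank F (Suc k)) f g"
          "f \<in> tensor_cycles F (Suc k) d" "g \<in> tensor_cycles G k (d - e)" by blast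
        then have "tensor_dmap ?C k x = 0"
          using d0 by (auto simp: tensor_cycles_def split: nat.splits)
        moreover have "x \<in> tensor_comp ?C (Suc k) d"
          unfolding fg(1) using fg(2,3) tensor_cycles_subset_comp by (blast intro: tensor_comp_cone_join)
        ultimately show "x \<in> tensor_cycles ?C (Suc k) d"
          by (simp add: tensor_cycles_def)
      }
    qed
    have FB: "tensor_boundaries F (Suc k) d \<subseteq> tensor_comp F (Suc k) d"
      and GB: "tensor_boundaries G k (d - e) \<subseteq> tensor_comp G k (d - e)"
      using tensor_boundaries_subset_cycles[OF F] tensor_boundaries_subset_cycles[OF G]
        tensor_cycles_subset_comp by blast+
    have "kdim (tensor_cycles ?C (Suc k) d) = kdim (tensor_cycles F (Suc k) d) + kdim (tensor_cycles G k (d - e))"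
      unfolding cyc by (rule kdim_join[OF subspace_tensor_cycles tensor_cycles_subset_comp subspace_tensor_cycles tensor_cycles_subset_comp])
    moreover have "kdim (tensor_boundaries ?C (Suc k) d) =
        kdim (tensor_boundaries F (Suc k) d) + kdim (tensor_boundaries G k (d - e))"
      unfolding bd nat.case by (rule kdim_join[OF subspace_tensor_boundaries FB subspace_tensor_boundaries GB])
    moreover have "kdim (tensor_boundaries F (Suc k) d) \<le> kdim (tensor_cycles F (Suc k) d)"
      by (rule kvec.dim_subset_finite_span[OF tensor_boundaries_subset_cycles[OF F]
            subset_trans[OF tensor_cycles_subset_comp tensor_comp_span]]) simp
    moreover have "kdim (tensor_boundaries G k (d - e)) \<le> kdim (tensor_cycles G k (d - e))"
      by (rule kvec.dim_subset_finite_span[OF tensor_boundaries_subset_cycles[OF G]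
            subset_trans[OF tensor_cycles_subset_comp tensor_comp_span]]) simp
    ultimately show ?thesis
      by (simp add: Suc tor_dim_def)
  qed
qed

section \<open>Adding one generator to an ideal\<close>

text \<open>With nonnegative shifts the reduced complex has nothing in negative degrees. This matches the
  convention that Betti numbers in negative degrees are \<open>0\<close>, which matters because the formulas
  below subtract degrees.\<close>

definition nonneg_resolution :: "'v set \<Rightarrow> ('v, 'k::field) mpoly set \<Rightarrow> ('v, 'k) free_complex \<Rightarrow> bool" where
  "nonneg_resolution V J F \<longleftrightarrow> graded_free_resolution V J F \<and> (\<forall>i. \<forall>j<frank F i. 0 \<le> shift F i j)"

lemma tor_dim_negative:
  assumes "nonneg_resolution V J F" "d < 0"
  shows "tor_dim F r d = 0"
proof -
  have "tensor_comp F r d \<subseteq> {0}"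
    using assms by (fastforce simp: nonneg_resolution_def tensor_comp_def fun_eq_iff)
  then have "tensor_cycles F r d \<subseteq> kvec.span {}"
    using tensor_cycles_subset_comp by fastforce
  then have "kdim (tensor_cycles F r d) \<le> card ({} :: (nat \<Rightarrow> 'b) set)"
    by (rule kvec.dim_le_card) simp
  then show ?thesis
    by (simp add: tor_dim_def)
qed

lemma graded_betti_eq_tor_dim:
  assumes F: "nonneg_resolution V J F" and J: "graded_ideal V J"
  shows "graded_betti V J r d = (if r < 0 then 0 else tor_dim F (nat r) d)"
proof -
  have F': "graded_free_resolution V J F"
    using F by (simp add: nonneg_resolution_def)
  have "graded_free_resolution V J (SOME F. graded_free_resolution V J F)"
    by (rule someI[of _ F]) (rule F')
  then show ?thesis
    using tor_dim_negative[OF F] tor_dim_unique[OF _ F' J] by (auto simp: graded_betti_def)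
qed

lemma graded_ideal_add_principal:
  assumes J: "graded_ideal V J" and p: "p \<in> polys V" "homogeneous e p"
  shows "graded_ideal V {f + p * g | f g. f \<in> J \<and> g \<in> polys V}" (is "graded_ideal V ?I")
  unfolding graded_ideal_def
proof (intro conjI ballI allI)
  have I: "f + p * g \<in> ?I" if "f \<in> J" "g \<in> polys V" for f g
    using that by blast
  show "?I \<subseteq> polys V"
    using graded_idealD(1)[OF J] p(1) by (auto intro!: polys_add polys_mult)
  show "0 \<in> ?I"
    using I[of 0 0] graded_idealD(2)[OF J] by simp
  fix x assume "x \<in> ?I"
  then obtain f g where x: "x = f + p * g" "f \<in> J" "g \<in> polys V" by blast
  show "x + y \<in> ?I" if "y \<in> ?I" for y
  proof -
    obtain f' g' where y: "y = f' + p * g'" "f' \<in> J" "g' \<in> polys V"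
      using \<open>y \<in> ?I\<close> by blast
    have "x + y = (f + f') + p * (g + g')"
      by (simp add: x y algebra_simps)
    then show ?thesis
      using I[of "f + f'" "g + g'"] x y graded_idealD(3)[OF J] polys_add by metis
  qed
  show "c * x \<in> ?I" if "c \<in> polys V" for c
  proof -
    have "c * x = c * f + p * (c * g)"
      by (simp add: x algebra_simps)
    then show ?thesis
      using I[of "c * f" "c * g"] x that graded_idealD(4)[OF J] polys_mult by metis
  qed
  show "hcomp d x \<in> ?I" for d
    unfolding x(1) hcomp_add hcomp_mult[OF p(2)]
    using x by (intro I graded_idealD(5)[OF J] polys_hcomp)
qed

lemma nonneg_resolution_cone:
  assumes "nonneg_resolution V J F" "nonneg_resolution V J' G" and J: "graded_ideal V J"
    and p: "p \<in> polys V" and J': "J' = {f \<in> polys V. p * f \<in> J}"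
    and \<phi>: "chain_lift V J F G p e \<phi>" and e: "0 \<le> e"
  shows "nonneg_resolution V {f + p * g | f g. f \<in> J \<and> g \<in> polys V} (cone F G \<phi> e)"
  unfolding nonneg_resolution_def
proof (intro conjI allI impI)
  show "graded_free_resolution V {f + p * g | f g. f \<in> J \<and> g \<in> polys V} (cone F G \<phi> e)"
    using assms(1,2) by (intro cone_resolution[OF _ _ J p J' \<phi>]) (simp_all add: nonneg_resolution_def)
  fix i j assume "j < frank (cone F G \<phi> e) i"
  then show "0 \<le> shift (cone F G \<phi> e) i j"
    using assms(1,2) e by (cases i) (auto simp: nonneg_resolution_def)
qed

lemma ex_nonneg_resolution_add_principal:
  assumes F: "\<exists>F. nonneg_resolution V J F" and G: "\<exists>G. nonneg_resolution V {f \<in> polys V. p * f \<in> J} G"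
    and J: "graded_ideal V J" and p: "p \<in> polys V" "homogeneous e p" "0 \<le> e"
  shows "\<exists>C. nonneg_resolution V {f + p * g | f g. f \<in> J \<and> g \<in> polys V} C"
proof -
  obtain F G where FG: "nonneg_resolution V J F" "nonneg_resolution V {f \<in> polys V. p * f \<in> J} G"
    using F G by blast
  then have "\<exists>\<phi>. chain_lift V J F G p e \<phi>"
    by (intro chain_lift_exists[OF _ _ J p(1,2)]) (auto simp: nonneg_resolution_def)
  then show ?thesis
    using nonneg_resolution_cone[OF FG J p(1) refl _ p(3)] by blast
qed

text \<open>A lift of multiplication by \<open>u q\<close> can thus be chosen with all entries divisible by \<open>q\<close>.\<close>

lemma chain_lift_mult:
  fixes F G :: "('v, 'k::field) free_complex"
  assumes \<phi>: "chain_lift V J F G u a \<phi>" and J: "graded_ideal V J"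
    and q: "q \<in> polys V" "homogeneous b q"
  shows "chain_lift V J F G (u * q) (a + b) (\<lambda>i l j. q * \<phi> i l j)"
proof -
  have app: "mat_app m n (\<lambda>l j. q * A l j) x = (\<lambda>l. q * mat_app m n A x l)"
    for m n A and x :: "nat \<Rightarrow> ('v, 'k) mpoly"
    by (rule ext) (simp add: mat_app_def sum_distrib_left mult.assoc)
  have aug: "augmap F (\<lambda>l. q * x l) = q * augmap F x" for x :: "nat \<Rightarrow> ('v, 'k) mpoly"
    by (simp add: augmap_def sum_distrib_left mult.left_commute)
  show ?thesis
    unfolding chain_lift_def
  proof (intro conjI allI ballI)
    show "hom_mat V (frank F i) (shift F i) (frank G i) (\<lambda>j. shift G i j + (a + b)) (\<lambda>l j. q * \<phi> i l j)" for i
      using hom_mat_smult[OF chain_liftD(1)[OF \<phi>, of i] q] by (simp add: add.assoc)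
    fix x :: "nat \<Rightarrow> ('v, 'k) mpoly" assume x: "x \<in> free_mod V (frank G 0)"
    have "q * (augmap F (mat_app (frank F 0) (frank G 0) (\<phi> 0) x) - u * augmap G x) \<in> J"
      by (rule graded_idealD(4)[OF J chain_liftD(2)[OF \<phi> x] q(1)])
    then show "augmap F (mat_app (frank F 0) (frank G 0) (\<lambda>l j. q * \<phi> 0 l j) x) - u * q * augmap G x \<in> J"
      by (simp add: app aug algebra_simps)
  next
    fix i and x :: "nat \<Rightarrow> ('v, 'k) mpoly" assume x: "x \<in> free_mod V (frank G (Suc i))"
    show "dmap F i (mat_app (frank F (Suc i)) (frank G (Suc i)) (\<lambda>l j. q * \<phi> (Suc i) l j) x) =
        mat_app (frank F i) (frank G i) (\<lambda>l j. q * \<phi> i l j) (dmap G i x)"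
      using chain_liftD(3)[OF \<phi> x] unfolding dmap_mat_app app mat_app_scale by simp
  qed
qed

text \<open>The long exact sequence of Betti numbers for adding the generator \<open>u q\<close> splits, since the
  map between the resolutions can be chosen divisible by \<open>q\<close> and therefore vanishes modulo the
  variables.\<close>

theorem graded_betti_add_principal:
  fixes J :: "('v, 'k::field) mpoly set"
  assumes F: "\<exists>F. nonneg_resolution V J F" and G: "\<exists>G. nonneg_resolution V J' G"
    and J: "graded_ideal V J" and J': "graded_ideal V J'"
    and u: "u \<in> polys V" "homogeneous a u" "0 \<le> a"
    and q: "q \<in> polys V" "homogeneous b q" "0 \<le> b" "ccoeff q = 0"
    and colon: "J' = {f \<in> polys V. u * f \<in> J}" "J' = {f \<in> polys V. u * q * f \<in> J}"
  shows "graded_betti V {f + u * q * g | f g. f \<in> J \<and> g \<in> polys V} r d =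
    graded_betti V J r d + graded_betti V J' (r - 1) (d - (a + b))"
proof -
  obtain F G where FG: "nonneg_resolution V J F" "nonneg_resolution V J' G"
    using F G by blast
  then have FG': "graded_free_resolution V J F" "graded_free_resolution V J' G"
    by (simp_all add: nonneg_resolution_def)
  obtain \<phi> where \<phi>: "chain_lift V J F G u a \<phi>"
    using chain_lift_exists[OF FG' J u(1,2)] colon(1) by blast
  let ?\<psi> = "\<lambda>i l j. q * \<phi> i l j"
  let ?C = "cone F G ?\<psi> (a + b)"
  have uq: "u * q \<in> polys V" "homogeneous (a + b) (u * q)" "0 \<le> a + b"
    using u q by (auto intro: polys_mult homogeneous_mult)
  have C: "nonneg_resolution V {f + u * q * g | f g. f \<in> J \<and> g \<in> polys V} ?C"
    by (rule nonneg_resolution_cone[OF FG J uq(1) colon(2) chain_lift_mult[OF \<phi> J q(1,2)] uq(3)])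
  have tor: "tor_dim ?C i d = tor_dim F i d + (case i of 0 \<Rightarrow> 0 | Suc k \<Rightarrow> tor_dim G k (d - (a + b)))" for i
    by (rule tor_dim_cone[OF FG']) (simp add: ccoeff_mult q(4))
  show ?thesis
    unfolding graded_betti_eq_tor_dim[OF C graded_ideal_add_principal[OF J uq(1,2)]]
      graded_betti_eq_tor_dim[OF FG(1) J] graded_betti_eq_tor_dim[OF FG(2) J'] tor
    by (cases "nat r") (auto simp: nat_diff_distrib')
qed

section \<open>Monomial ideals\<close>

definition mono_dvd :: "('v \<Rightarrow>\<^sub>0 nat) \<Rightarrow> ('v \<Rightarrow>\<^sub>0 nat) \<Rightarrow> bool" where
  "mono_dvd x t \<longleftrightarrow> (\<forall>i. Poly_Mapping.lookup x i \<le> Poly_Mapping.lookup t i)"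

lemma mono_dvd_add_diff: "mono_dvd x t \<Longrightarrow> x + (t - x) = t"
  by (rule poly_mapping_eqI) (simp add: mono_dvd_def lookup_add lookup_minus)

lemma mono_dvd_add: "mono_dvd x t \<Longrightarrow> mono_dvd x (s + t)"
  by (simp add: mono_dvd_def lookup_add trans_le_add2)

lemma mono_dvd_trans: "mono_dvd x y \<Longrightarrow> mono_dvd y z \<Longrightarrow> mono_dvd x z"
  using order_trans by (fastforce simp: mono_dvd_def)

lemma mono_dvd_refl [simp]: "mono_dvd x x"
  by (simp add: mono_dvd_def)

lemma mono_dvd_diff_iff: "mono_dvd (x - m) t \<longleftrightarrow> mono_dvd x (m + t)"
  by (simp add: mono_dvd_def lookup_minus lookup_add le_diff_conv add.commute)

lemma mono_keys_diff: "Poly_Mapping.keys ((x :: 'v \<Rightarrow>\<^sub>0 nat) - m) \<subseteq> Poly_Mapping.keys x"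
  by (auto simp: in_keys_iff lookup_minus)

lemma mono_keys_diff_image:
  assumes "\<And>x. x \<in> X \<Longrightarrow> Poly_Mapping.keys x \<subseteq> V" and y: "y \<in> (\<lambda>x. (x :: 'v \<Rightarrow>\<^sub>0 nat) - m) ` X"
  shows "Poly_Mapping.keys y \<subseteq> V"
proof -
  obtain x where "x \<in> X" "y = x - m"
    using y by blast
  then show ?thesis
    using assms(1)[of x] mono_keys_diff[of x m] by blast
qed

lemma sum_of_terms: "(\<Sum>t\<in>Poly_Mapping.keys f. Poly_Mapping.single t (Poly_Mapping.lookup f t)) = f"
  by (rule poly_mapping_eqI)
    (simp add: lookup_sum lookup_single when_def in_keys_iff if_distrib cong: if_cong)

lemma lookup_monom_mult: "Poly_Mapping.lookup (Poly_Mapping.single m 1 * f) (m + t) =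
    Poly_Mapping.lookup (f :: ('v, 'k::field) mpoly) t"
proof -
  have "Poly_Mapping.single m 1 * f =
      (\<Sum>s\<in>Poly_Mapping.keys f. Poly_Mapping.single (m + s) (Poly_Mapping.lookup f s))"
    by (subst sum_of_terms[of f, symmetric]) (simp add: sum_distrib_left mult_single)
  then show ?thesis
    by (simp add: lookup_sum lookup_single when_def in_keys_iff if_distrib cong: if_cong)
qed

lemma keys_monom_mult:
  "Poly_Mapping.keys (Poly_Mapping.single m 1 * (f :: ('v, 'k::field) mpoly)) = (+) m ` Poly_Mapping.keys f"
proof
  show "Poly_Mapping.keys (Poly_Mapping.single m 1 * f) \<subseteq> (+) m ` Poly_Mapping.keys f"
    using keys_mult[of "Poly_Mapping.single m 1" f] by auto
  show "(+) m ` Poly_Mapping.keys f \<subseteq> Poly_Mapping.keys (Poly_Mapping.single m 1 * f)"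
    by (auto simp: in_keys_iff lookup_monom_mult)
qed

text \<open>Membership is decided term by term. This makes colon ideals and the effect of another
  generator easy to compute; \<open>ideal_gen_monomials\<close> identifies it with the ideal generated by the
  monomials.\<close>

definition mon_ideal :: "'v set \<Rightarrow> ('v \<Rightarrow>\<^sub>0 nat) set \<Rightarrow> ('v, 'k::field) mpoly set" where
  "mon_ideal V X = {f \<in> polys V. \<forall>t\<in>Poly_Mapping.keys f. \<exists>x\<in>X. mono_dvd x t}"

lemma mon_ideal_mono: "(\<And>x. x \<in> X \<Longrightarrow> \<exists>y\<in>Y. mono_dvd y x) \<Longrightarrow> mon_ideal V X \<subseteq> mon_ideal V Y"
  unfolding mon_ideal_def using mono_dvd_trans by blast

lemma mon_ideal_cong:
  assumes "\<And>x. x \<in> X \<Longrightarrow> \<exists>y\<in>Y. mono_dvd y x" "\<And>y. y \<in> Y \<Longrightarrow> \<exists>x\<in>X. mono_dvd x y"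
  shows "mon_ideal V X = mon_ideal V Y"
  using assms by (intro antisym mon_ideal_mono)

lemma mon_ideal_add: "f \<in> mon_ideal V X \<Longrightarrow> g \<in> mon_ideal V X \<Longrightarrow> f + g \<in> mon_ideal V X"
  unfolding mon_ideal_def using keys_add[of f g] by (auto simp: polys_add)

lemma mon_ideal_mult:
  assumes f: "f \<in> mon_ideal V X" and c: "c \<in> polys V"
  shows "c * f \<in> mon_ideal V X"
  unfolding mon_ideal_def
proof (intro CollectI conjI ballI)
  show "c * f \<in> polys V"
    using f c by (simp add: mon_ideal_def polys_mult)
  fix t assume "t \<in> Poly_Mapping.keys (c * f)"
  then obtain a b where "b \<in> Poly_Mapping.keys f" "t = a + b"
    using keys_mult[of c f] by auto
  then show "\<exists>x\<in>X. mono_dvd x t"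
    using f mono_dvd_add unfolding mon_ideal_def by blast
qed

lemma graded_ideal_mon_ideal: "graded_ideal V (mon_ideal V X)"
  unfolding graded_ideal_def
proof (intro conjI ballI allI)
  show "mon_ideal V X \<subseteq> polys V" "0 \<in> mon_ideal V X"
    by (auto simp: mon_ideal_def)
  show "hcomp d f \<in> mon_ideal V X" if "f \<in> mon_ideal V X" for f d
    using that keys_hcomp[of d f] by (auto simp: mon_ideal_def polys_hcomp)
qed (auto intro: mon_ideal_add mon_ideal_mult)

lemma mon_ideal_gen: "x \<in> X \<Longrightarrow> Poly_Mapping.keys x \<subseteq> V \<Longrightarrow> Poly_Mapping.single x c \<in> mon_ideal V X"
  by (auto simp: mon_ideal_def polys_monom intro!: bexI[of _ x])

lemma keys_subset_of_poly: "f \<in> polys V \<Longrightarrow> t \<in> Poly_Mapping.keys f \<Longrightarrow> Poly_Mapping.keys t \<subseteq> V"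
  by (simp add: polys_def)

lemma ideal_gen_monomials:
  assumes X: "\<And>x. x \<in> X \<Longrightarrow> Poly_Mapping.keys x \<subseteq> V"
  shows "ideal_gen V ((\<lambda>x. Poly_Mapping.single x 1) ` X) = (mon_ideal V X :: ('v, 'k::field) mpoly set)"
proof (intro set_eqI iffI)
  fix f :: "('v, 'k) mpoly"
  assume "f \<in> ideal_gen V ((\<lambda>x. Poly_Mapping.single x 1) ` X)"
  then obtain A c where f: "f = (\<Sum>g\<in>A. c g * g)" "A \<subseteq> (\<lambda>x. Poly_Mapping.single x 1) ` X"
    "\<forall>g\<in>A. c g \<in> polys V"
    by (auto simp: ideal_gen_def)
  show "f \<in> mon_ideal V X"
    unfolding f(1) using f(2,3)
    by (intro graded_ideal_sum[OF graded_ideal_mon_ideal] mon_ideal_mult) (auto intro!: mon_ideal_gen dest: X)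
next
  fix f :: "('v, 'k) mpoly"
  assume f: "f \<in> mon_ideal V X"
  then obtain g where g: "\<And>t. t \<in> Poly_Mapping.keys f \<Longrightarrow> g t \<in> X \<and> mono_dvd (g t) t"
    unfolding mon_ideal_def by (simp, metis)
  define h :: "('v \<Rightarrow>\<^sub>0 nat) \<Rightarrow> ('v, 'k) mpoly" where "h t = Poly_Mapping.single (g t) 1" for t
  \<comment> \<open>Terms with the same chosen generator are collected into one coefficient.\<close>
  define c where "c b = (\<Sum>t\<in>{t \<in> Poly_Mapping.keys f. h t = b}.
      Poly_Mapping.single (t - g t) (Poly_Mapping.lookup f t))" for b
  have "f = (\<Sum>t\<in>Poly_Mapping.keys f. Poly_Mapping.single (t - g t) (Poly_Mapping.lookup f t) * h t)"
    using g by (subst sum_of_terms[of f, symmetric], intro sum.cong)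
      (simp_all add: h_def mult_single add.commute mono_dvd_add_diff)
  also have "\<dots> = (\<Sum>b\<in>h ` Poly_Mapping.keys f. \<Sum>t\<in>{t \<in> Poly_Mapping.keys f. h t = b}.
      Poly_Mapping.single (t - g t) (Poly_Mapping.lookup f t) * h t)"
    by (rule sum.image_gen) simp
  also have "\<dots> = (\<Sum>b\<in>h ` Poly_Mapping.keys f. c b * b)"
    by (rule sum.cong) (auto simp: c_def sum_distrib_right)
  finally have "f = (\<Sum>b\<in>h ` Poly_Mapping.keys f. c b * b)" .
  moreover have "c b \<in> polys V" for b
  proof -
    have "Poly_Mapping.keys (t - g t) \<subseteq> V" if "t \<in> Poly_Mapping.keys f" for t
      using mono_keys_diff[of t "g t"] keys_subset_of_poly[OF _ that, of V] f by (auto simp: mon_ideal_def)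
    then show ?thesis
      unfolding c_def by (intro polys_sum polys_monom) auto
  qed
  ultimately show "f \<in> ideal_gen V ((\<lambda>x. Poly_Mapping.single x 1) ` X)"
    unfolding ideal_gen_def using g by (intro CollectI exI[of _ "h ` Poly_Mapping.keys f"] exI[of _ c]) (auto simp: h_def)
qed

lemma mon_ideal_insert:
  assumes m: "Poly_Mapping.keys m \<subseteq> V"
  shows "(mon_ideal V (insert m X) :: ('v, 'k::field) mpoly set) =
    {f + Poly_Mapping.single m 1 * g | f g. f \<in> mon_ideal V X \<and> g \<in> polys V}"
    (is "_ = ?I")
proof (intro set_eqI iffI)
  fix f :: "('v, 'k) mpoly" assume f: "f \<in> mon_ideal V (insert m X)"
  \<comment> \<open>The terms outside \<open>K\<close> are all divisible by \<open>m\<close>.\<close>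
  define K where "K = {t \<in> Poly_Mapping.keys f. \<exists>x\<in>X. mono_dvd x t}"
  let ?t = "\<lambda>t. Poly_Mapping.single t (Poly_Mapping.lookup f t)"
  define g where "g = (\<Sum>t\<in>Poly_Mapping.keys f - K. Poly_Mapping.single (t - m) (Poly_Mapping.lookup f t))"
  have keysV: "Poly_Mapping.keys t \<subseteq> V" if "t \<in> Poly_Mapping.keys f" for t
    using f that by (auto simp: mon_ideal_def polys_def)
  have K: "K \<subseteq> Poly_Mapping.keys f"
    by (auto simp: K_def)
  have "f = (\<Sum>t\<in>Poly_Mapping.keys f. ?t t)"
    by (rule sum_of_terms[symmetric])
  also have "\<dots> = (\<Sum>t\<in>K. ?t t) + (\<Sum>t\<in>Poly_Mapping.keys f - K. ?t t)"
    unfolding sum.subset_diff[OF K finite_keys] by (rule add.commute)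
  also have "(\<Sum>t\<in>Poly_Mapping.keys f - K. ?t t) = Poly_Mapping.single m 1 * g"
    unfolding g_def sum_distrib_left
  proof (rule sum.cong[OF refl])
    fix t assume "t \<in> Poly_Mapping.keys f - K"
    then have "mono_dvd m t"
      using f by (auto simp: mon_ideal_def K_def)
    then show "?t t = Poly_Mapping.single m 1 * Poly_Mapping.single (t - m) (Poly_Mapping.lookup f t)"
      by (simp add: mult_single mono_dvd_add_diff)
  qed
  finally have "f = (\<Sum>t\<in>K. ?t t) + Poly_Mapping.single m 1 * g" .
  moreover have "(\<Sum>t\<in>K. ?t t) \<in> mon_ideal V X"
  proof (intro graded_ideal_sum[OF graded_ideal_mon_ideal])
    fix t assume "t \<in> K"
    then show "?t t \<in> mon_ideal V X"
      using keysV by (auto simp: mon_ideal_def K_def polys_monom)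
  qed
  moreover have "g \<in> polys V"
    unfolding g_def
  proof (intro polys_sum polys_monom)
    show "Poly_Mapping.keys (t - m) \<subseteq> V" if "t \<in> Poly_Mapping.keys f - K" for t
      using that keysV[of t] mono_keys_diff[of t m] by blast
  qed
  ultimately show "f \<in> ?I" by blast
next
  fix f :: "('v, 'k) mpoly" assume "f \<in> ?I"
  then obtain a g where f: "f = a + g * Poly_Mapping.single m 1" "a \<in> mon_ideal V X" "g \<in> polys V"
    by (auto simp: mult.commute)
  have "mon_ideal V X \<subseteq> (mon_ideal V (insert m X) :: ('v, 'k) mpoly set)"
    by (rule mon_ideal_mono) (auto intro: mono_dvd_refl)
  then show "f \<in> mon_ideal V (insert m X)"
    unfolding f(1) using f m by (intro mon_ideal_add mon_ideal_mult mon_ideal_gen) auto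
qed

text \<open>The difference of exponent vectors is truncated, so \<open>x - m\<close> is \<open>x\<close> divided by its
  greatest common divisor with \<open>m\<close>.\<close>

lemma mon_ideal_colon:
  assumes m: "Poly_Mapping.keys m \<subseteq> V"
  shows "{f \<in> polys V. Poly_Mapping.single m 1 * f \<in> mon_ideal V X} =
    (mon_ideal V ((\<lambda>x. x - m) ` X) :: ('v, 'k::field) mpoly set)"
proof -
  have "Poly_Mapping.single m 1 * f \<in> mon_ideal V X \<longleftrightarrow> f \<in> mon_ideal V ((\<lambda>x. x - m) ` X)"
    if f: "f \<in> polys V" for f :: "('v, 'k) mpoly"
    using f polys_mult[OF polys_monom[OF m, of 1] f]
    by (simp add: mon_ideal_def keys_monom_mult mono_dvd_diff_iff)
  then show ?thesis
    by (auto simp: mon_ideal_def)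
qed

lemma trivial_resolution:
  "nonneg_resolution V {0} \<lparr>frank = (\<lambda>i. if i = 0 then 1 else 0), shift = (\<lambda>_ _. 0), dmat = (\<lambda>_ _ _. 0), aug = (\<lambda>_. 1)\<rparr>"
    (is "nonneg_resolution V _ ?F")
proof -
  have aug: "augmap ?F x = x 0" for x
    by (simp add: augmap_def)
  have fm0: "x \<in> free_mod V 0 \<longleftrightarrow> x = 0" for x
    by (auto simp: free_mod_def fun_eq_iff)
  have fm1: "x \<in> free_mod V (Suc 0) \<Longrightarrow> x = 0 \<longleftrightarrow> x 0 = 0" for x
    by (auto simp: free_mod_def fun_eq_iff) (metis Suc_leI not_gr_zero)
  have surj: "\<exists>x\<in>free_mod V (Suc 0). f = x 0" if "f \<in> polys V" for f
    using that by (intro bexI[of _ "\<lambda>j. if j = 0 then f else 0"]) (auto simp: free_mod_def)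
  have d: "dmap ?F i x = 0" for i x
    by (rule ext) (simp add: dmap_def)
  have "graded_free_resolution V {0} ?F"
    unfolding graded_free_resolution_def
  proof (intro conjI allI ballI impI)
    show "\<exists>x\<in>free_mod V (frank ?F 0). f - augmap ?F x \<in> {0}" if "f \<in> polys V" for f
      using surj[OF that] by (simp add: aug)
    show "augmap ?F x \<in> {0} \<longleftrightarrow> (\<exists>y\<in>free_mod V (frank ?F 1). dmap ?F 0 y = x)"
      if "x \<in> free_mod V (frank ?F 0)" for x
      using fm1[of x] that unfolding d by (auto simp: aug fm0)
    show "dmap ?F i x = 0 \<longleftrightarrow> (\<exists>y\<in>free_mod V (frank ?F (Suc (Suc i))). dmap ?F (Suc i) y = x)"
      if "x \<in> free_mod V (frank ?F (Suc i))" for i x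
      using that unfolding d by (auto simp: fm0)
  qed simp_all
  then show ?thesis
    by (simp add: nonneg_resolution_def)
qed

text \<open>Splitting off a generator \<open>m\<close> leaves an ideal and a colon ideal that both have fewer
  generators, and the mapping cone combines their resolutions.\<close>

lemma mon_ideal_resolution:
  assumes "finite X" "\<And>x. x \<in> X \<Longrightarrow> Poly_Mapping.keys x \<subseteq> V"
  shows "\<exists>F. nonneg_resolution V (mon_ideal V X :: ('v, 'k::field) mpoly set) F"
  using assms
proof (induction "card X" arbitrary: X rule: less_induct)
  case less
  show ?case
  proof (cases "X = {}")
    case True
    then have "mon_ideal V X = ({0} :: ('v, 'k) mpoly set)"
      by (auto simp: mon_ideal_def)
    then show ?thesis
      using trivial_resolution by metis
  next
    case False
    then obtain m where m: "m \<in> X" by blast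
    define Y where "Y = X - {m}"
    have Y: "X = insert m Y" "finite Y" "card Y < card X" "\<And>x. x \<in> Y \<Longrightarrow> Poly_Mapping.keys x \<subseteq> V"
      using m less.prems card_Diff1_less[OF less.prems(1) m] by (auto simp: Y_def simp del: card_Diff_insert)
    have mV: "Poly_Mapping.keys m \<subseteq> V"
      using m less.prems(2) by blast
    have "\<exists>F. nonneg_resolution V (mon_ideal V Y :: ('v, 'k) mpoly set) F"
      using Y by (intro less.hyps)
    moreover have "\<exists>F. nonneg_resolution V (mon_ideal V ((\<lambda>x. x - m) ` Y) :: ('v, 'k) mpoly set) F"
    proof (rule less.hyps)
      show "card ((\<lambda>x. x - m) ` Y) < card X"
        using card_image_le[OF Y(2)] Y(3) by (rule le_less_trans)
      show "\<And>x. x \<in> (\<lambda>x. x - m) ` Y \<Longrightarrow> Poly_Mapping.keys x \<subseteq> V"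
        by (rule mono_keys_diff_image[OF Y(4)])
    qed (use Y(2) in simp)
    ultimately show ?thesis
      unfolding Y(1) mon_ideal_insert[OF mV] mon_ideal_colon[OF mV, symmetric]
      by (rule ex_nonneg_resolution_add_principal[OF _ _ graded_ideal_mon_ideal polys_monom[OF mV]
            homogeneous_single of_nat_0_le_iff])
  qed
qed

text \<open>The variables of \<open>q\<close> do not occur in the generators of \<open>X\<close>, so the colon ideals by
  \<open>u\<close> and by \<open>u q\<close> agree.\<close>

lemma graded_betti_mon_ideal_insert:
  assumes X: "finite X" "\<And>x. x \<in> X \<Longrightarrow> Poly_Mapping.keys x \<subseteq> V"
    and u: "Poly_Mapping.keys u \<subseteq> V" and q: "Poly_Mapping.keys q \<subseteq> V" "q \<noteq> 0"
    and disj: "\<And>x. x \<in> X \<Longrightarrow> Poly_Mapping.keys x \<inter> Poly_Mapping.keys q = {}"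
  shows "graded_betti V (mon_ideal V (insert (u + q) X) :: ('v, 'k::field) mpoly set) r d =
    graded_betti V (mon_ideal V X :: ('v, 'k) mpoly set) r d +
    graded_betti V (mon_ideal V ((\<lambda>x. x - u) ` X) :: ('v, 'k) mpoly set) (r - 1) (d - int (monom_deg (u + q)))"
proof -
  let ?u = "Poly_Mapping.single u 1 :: ('v, 'k) mpoly" and ?q = "Poly_Mapping.single q 1 :: ('v, 'k) mpoly"
  have uq: "?u * ?q = Poly_Mapping.single (u + q) 1"
    by (simp add: mult_single)
  have uqV: "Poly_Mapping.keys (u + q) \<subseteq> V"
    using keys_add[of u q] u q(1) by blast
  have X': "\<And>x. x \<in> (\<lambda>x. x - u) ` X \<Longrightarrow> Poly_Mapping.keys x \<subseteq> V"
    by (rule mono_keys_diff_image[OF X(2)])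
  have "x - (u + q) = x - u" if "x \<in> X" for x
  proof (rule poly_mapping_eqI)
    fix i
    have "Poly_Mapping.lookup x i = 0 \<or> Poly_Mapping.lookup q i = 0"
      using disj[OF that] by (auto simp: in_keys_iff)
    then show "Poly_Mapping.lookup (x - (u + q)) i = Poly_Mapping.lookup (x - u) i"
      by (auto simp: lookup_minus lookup_add)
  qed
  then have img: "(\<lambda>x. x - (u + q)) ` X = (\<lambda>x. x - u) ` X"
    by (rule image_cong[OF refl])
  have "graded_betti V {f + ?u * ?q * g | f g. f \<in> mon_ideal V X \<and> g \<in> polys V} r d =
    graded_betti V (mon_ideal V X :: ('v, 'k) mpoly set) r d +
    graded_betti V (mon_ideal V ((\<lambda>x. x - u) ` X) :: ('v, 'k) mpoly set) (r - 1)
      (d - (int (monom_deg u) + int (monom_deg q)))"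
  proof (rule graded_betti_add_principal[OF mon_ideal_resolution[OF X] mon_ideal_resolution[OF _ X']
        graded_ideal_mon_ideal graded_ideal_mon_ideal])
    show "?u \<in> polys V" "?q \<in> polys V"
      by (rule polys_monom, fact)+
    show "homogeneous (int (monom_deg u)) ?u" "homogeneous (int (monom_deg q)) ?q"
      by (rule homogeneous_single)+
    show "ccoeff ?q = 0"
      using q(2) by (simp add: lookup_single)
    show "mon_ideal V ((\<lambda>x. x - u) ` X) = {f \<in> polys V. ?u * f \<in> mon_ideal V X}"
      by (rule mon_ideal_colon[OF u, symmetric])
    have "{f \<in> polys V. Poly_Mapping.single (u + q) 1 * f \<in> mon_ideal V X} =
        (mon_ideal V ((\<lambda>x. x - u) ` X) :: ('v, 'k) mpoly set)"
      using mon_ideal_colon[OF uqV, of X] by (simp only: img)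
    then show "mon_ideal V ((\<lambda>x. x - u) ` X) = {f \<in> polys V. ?u * ?q * f \<in> mon_ideal V X}"
      by (simp only: uq)
  qed (use X(1) in simp_all)
  moreover have "int (monom_deg u) + int (monom_deg q) = int (monom_deg (u + q))"
    by (simp add: monom_deg_add)
  ultimately show ?thesis
    by (simp only: uq mon_ideal_insert[OF uqV])
qed

lemma sum_Pow_insert:
  assumes "finite I" "i \<notin> I"
  shows "(\<Sum>S\<in>Pow (insert i I). h S) = (\<Sum>S\<in>Pow I. h S) + (\<Sum>S\<in>Pow I. h (insert i S))"
proof -
  have "inj_on (insert i) (Pow I)"
  proof (rule inj_onI)
    fix A B assume AB: "A \<in> Pow I" "B \<in> Pow I" "insert i A = insert i B"
    then have "i \<notin> A" "i \<notin> B"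
      using assms(2) by blast+
    from insert_ident[OF this] show "A = B"
      using AB(3) by simp
  qed
  moreover have "Pow I \<inter> insert i ` Pow I = {}"
    using assms(2) by blast
  ultimately show ?thesis
    unfolding Pow_insert using assms(1)
    by (subst sum.union_disjoint) (simp_all add: sum.reindex comp_def)
qed

text \<open>The monomials \<open>q i\<close> form a regular sequence modulo the ideal of \<open>X\<close>, and the formula
  reflects tensoring with their Koszul complex. In the induction each \<open>q i\<close> is adjoined with \<open>u = 1\<close>,
  and the two resulting terms are the subsets without \<open>i\<close> and with \<open>i\<close>.\<close>

theorem graded_betti_regular_monomials:
  assumes X: "finite X" "\<And>x. x \<in> X \<Longrightarrow> Poly_Mapping.keys x \<subseteq> V"
    and I: "finite I" and q: "\<And>i. i \<in> I \<Longrightarrow> Poly_Mapping.keys (q i) \<subseteq> V" "\<And>i. i \<in> I \<Longrightarrow> q i \<noteq> 0"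
    and qX: "\<And>i x. i \<in> I \<Longrightarrow> x \<in> X \<Longrightarrow> Poly_Mapping.keys x \<inter> Poly_Mapping.keys (q i) = {}"
    and qq: "\<And>i j. i \<in> I \<Longrightarrow> j \<in> I \<Longrightarrow> i \<noteq> j \<Longrightarrow> Poly_Mapping.keys (q i) \<inter> Poly_Mapping.keys (q j) = {}"
  shows "graded_betti V (mon_ideal V (X \<union> q ` I) :: ('v, 'k::field) mpoly set) r d =
    (\<Sum>S\<in>Pow I. graded_betti V (mon_ideal V X :: ('v, 'k) mpoly set) (r - int (card S))
      (d - int (\<Sum>i\<in>S. monom_deg (q i))))"
  using I q qX qq
proof (induction I arbitrary: r d rule: finite_induct)
  case empty
  show ?case by simp
next
  case (insert i I)
  let ?B = "graded_betti V (mon_ideal V X :: ('v, 'k) mpoly set)"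
  let ?Y = "X \<union> q ` I"
  have IH: "graded_betti V (mon_ideal V ?Y :: ('v, 'k) mpoly set) r d =
      (\<Sum>S\<in>Pow I. ?B (r - int (card S)) (d - int (\<Sum>i\<in>S. monom_deg (q i))))" for r d
    by (rule insert.IH) (use insert.prems in auto)
  have Y: "finite ?Y" "\<And>x. x \<in> ?Y \<Longrightarrow> Poly_Mapping.keys x \<subseteq> V"
    "\<And>x. x \<in> ?Y \<Longrightarrow> Poly_Mapping.keys x \<inter> Poly_Mapping.keys (q i) = {}"
  proof -
    show "finite ?Y" using X(1) insert.hyps(1) by simp
    show "Poly_Mapping.keys x \<subseteq> V" if "x \<in> ?Y" for x
      using that X(2) insert.prems(1) by blast
    show "Poly_Mapping.keys x \<inter> Poly_Mapping.keys (q i) = {}" if x: "x \<in> ?Y" for x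
    proof (cases "x \<in> X")
      case True
      then show ?thesis using insert.prems(3) by blast
    next
      case False
      then obtain j where "x = q j" "j \<in> I" "j \<noteq> i" using x insert.hyps(2) by blast
      then show ?thesis using insert.prems(4)[of j i] by blast
    qed
  qed
  have "graded_betti V (mon_ideal V (insert (0 + q i) ?Y) :: ('v, 'k) mpoly set) r d =
      graded_betti V (mon_ideal V ?Y :: ('v, 'k) mpoly set) r d +
      graded_betti V (mon_ideal V ((\<lambda>x. x - 0) ` ?Y) :: ('v, 'k) mpoly set) (r - 1) (d - int (monom_deg (0 + q i)))"
    by (rule graded_betti_mon_ideal_insert[OF Y(1,2)]) (use insert.prems Y(3) in auto)
  then have "graded_betti V (mon_ideal V (X \<union> q ` insert i I) :: ('v, 'k) mpoly set) r d =
      graded_betti V (mon_ideal V ?Y :: ('v, 'k) mpoly set) r d +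
      graded_betti V (mon_ideal V ?Y :: ('v, 'k) mpoly set) (r - 1) (d - int (monom_deg (q i)))"
    by simp
  also have "\<dots> = (\<Sum>S\<in>Pow I. ?B (r - int (card S)) (d - int (\<Sum>i\<in>S. monom_deg (q i)))) +
      (\<Sum>S\<in>Pow I. ?B (r - int (card (insert i S))) (d - int (\<Sum>j\<in>insert i S. monom_deg (q j))))"
  proof -
    have "?B (r - 1 - int (card S)) (d - int (monom_deg (q i)) - int (\<Sum>i\<in>S. monom_deg (q i))) =
        ?B (r - int (card (insert i S))) (d - int (\<Sum>j\<in>insert i S. monom_deg (q j)))" if "S \<in> Pow I" for S
    proof -
      have "finite S" "i \<notin> S"
        using that insert.hyps finite_subset by auto
      then show ?thesis by (simp add: algebra_simps)
    qed
    then show ?thesis unfolding IH by simp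
  qed
  also have "\<dots> = (\<Sum>S\<in>Pow (insert i I). ?B (r - int (card S)) (d - int (\<Sum>i\<in>S. monom_deg (q i))))"
    by (rule sum_Pow_insert[symmetric]) (use insert.hyps in auto)
  finally show ?case .
qed

section \<open>Predecessors in a naturally oriented tree\<close>

lemma parcs_mk_symmetric_iff:
  "(x, y) \<in> parcs (mk_symmetric (with_proj G)) \<longleftrightarrow> (x, y) \<in> parcs G \<or> (y, x) \<in> parcs G"
  unfolding parcs_mk_symmetric with_proj_simps
  by (auto intro: bexI[of _ "(x, y)"] bexI[of _ "(y, x)"])

lemma pcas_snoc: "pcas u p b \<Longrightarrow> pcas u (p @ [(b, c)]) c"
  by (induction p arbitrary: u) auto

lemma pawalk_verts_snoc: "pcas u p b \<Longrightarrow> pawalk_verts u (p @ [(b, c)]) = pawalk_verts u p @ [c]"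
  by (induction p arbitrary: u) auto

lemma (in pair_wf_digraph) pawalk_verts_subset:
  "u \<in> pverts G \<Longrightarrow> set p \<subseteq> parcs G \<Longrightarrow> pcas u p b \<Longrightarrow> set (pawalk_verts u p) \<subseteq> pverts G"
  by (induction p arbitrary: u) (auto dest: in_arcsD2)

text \<open>Two predecessors \<open>a\<close> and \<open>b\<close> of \<open>c\<close> have smaller rank than \<open>c\<close>, so both are joined to
  the root by paths that avoid \<open>c\<close>. A path from \<open>a\<close> to \<open>b\<close> avoiding \<open>c\<close> closes up through \<open>c\<close> to a
  cycle.\<close>

lemma natural_tree_unique_predecessor:
  assumes T: "weighted_naturally_oriented_tree T w x0"
    and ac: "(a, c) \<in> parcs T" and bc: "(b, c) \<in> parcs T"
  shows "a = b"
proof (rule ccontr)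
  assume "a \<noteq> b"
  interpret T: weighted_oriented_graph T w
    using T by (simp add: weighted_naturally_oriented_tree_def)
  let ?S = "mk_symmetric (with_proj T)"
  let ?D = "graph_dist T x0"
  have conn: "Digraph_Component.connected (with_proj T)"
    and acyc: "\<not> (\<exists>p. pre_digraph.cycle (with_proj ?S) p \<and> 3 \<le> length p)"
    and x0: "x0 \<in> pverts T" and nat: "\<And>x y. (x, y) \<in> parcs T \<Longrightarrow> ?D x < ?D y"
    using T by (auto simp: weighted_naturally_oriented_tree_def underlying_tree_def)
  interpret S: pair_wf_digraph ?S
    by (rule T.wellformed_mk_symmetric)
  \<comment> \<open>\<open>H\<close> is the underlying graph without \<open>c\<close>. A shortest path from the root to a vertex of smaller
    rank than \<open>c\<close> stays inside \<open>H\<close>.\<close>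
  define H where "H = \<lparr>pverts = pverts T - {c}, parcs = {(x, y) \<in> parcs ?S. x \<noteq> c \<and> y \<noteq> c}\<rparr>"
  have Hs: "pverts H = pverts T - {c}" "\<And>x y. (x, y) \<in> parcs H \<longleftrightarrow> (x, y) \<in> parcs ?S \<and> x \<noteq> c \<and> y \<noteq> c"
    by (auto simp: H_def)
  interpret H: pair_wf_digraph H
  proof
    fix e assume "e \<in> parcs H"
    then show "fst e \<in> pverts H" "snd e \<in> pverts H"
      using Hs S.wellformed' by (cases e; force)+
  qed
  have symH: "symmetric (with_proj H)"
    by (auto simp: symmetric_def sym_def Hs parcs_mk_symmetric_iff)
  have near: "x0 \<rightarrow>\<^sup>*\<^bsub>with_proj H\<^esub> x" if "(x0, x) \<in> parcs ?S ^^ m" "m < ?D c" for m x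
    using that
  proof (induction m arbitrary: x)
    case 0
    have "?D x0 = 0"
      by (auto simp: graph_dist_def intro: Least_equality)
    then have "x0 \<noteq> c" using 0 by auto
    then show ?case
      using 0 x0 by (auto simp: Hs intro: H.reachable_refl)
  next
    case (Suc m)
    then obtain y where y: "(x0, y) \<in> parcs ?S ^^ m" "(y, x) \<in> parcs ?S" by auto
    have "?D y \<le> m"
      unfolding graph_dist_def by (rule Least_le) (rule y(1))
    moreover have "?D x \<le> Suc m"
      unfolding graph_dist_def by (rule Least_le) (rule Suc.prems(1))
    ultimately have "(y, x) \<in> parcs H"
      using y(2) Suc.prems(2) by (auto simp: Hs)
    moreover have "x0 \<rightarrow>\<^sup>*\<^bsub>with_proj H\<^esub> y"
      using Suc.IH[OF y(1)] Suc.prems(2) by simp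
    ultimately show ?case
      by (simp add: H.reachable_adj_trans)
  qed
  have reach: "x0 \<rightarrow>\<^sup>*\<^bsub>with_proj H\<^esub> x" if "(x, c) \<in> parcs T" for x
  proof (rule near)
    have "x0 \<rightarrow>\<^sup>*\<^bsub>with_proj ?S\<^esub> x"
      using conn x0 T.in_arcsD1[OF that] by (auto simp: connected_def strongly_connected_def)
    then have "(x0, x) \<in> (parcs ?S)\<^sup>*"
      using reachable_rtranclI by force
    then have "\<exists>m. (x0, x) \<in> parcs ?S ^^ m"
      by (rule rtrancl_imp_relpow)
    then show "(x0, x) \<in> parcs ?S ^^ ?D x"
      unfolding graph_dist_def by (rule LeastI_ex)
    show "?D x < ?D c"
      by (rule nat[OF that])
  qed
  have "a \<rightarrow>\<^sup>*\<^bsub>with_proj H\<^esub> b"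
    using symmetric_reachable[OF symH reach[OF ac]] reach[OF bc] by (rule H.reachable_trans)
  then obtain p where "pre_digraph.apath (with_proj H) a p b"
    using H.reachable_apath by blast
  then have p: "a \<in> pverts H" "set p \<subseteq> parcs H" "pcas a p b" "distinct (pawalk_verts a p)"
    by (auto simp: H.apath_def H.awalk_def)
  let ?p = "(c, a) # p @ [(b, c)]"
  have "S.awalk c ?p c"
    unfolding S.awalk_def
  proof (intro conjI)
    show "c \<in> pverts ?S"
      using T.in_arcsD2[OF ac] by simp
    show "set ?p \<subseteq> parcs ?S"
      using p(2) Hs ac bc by (auto simp: parcs_mk_symmetric_iff)
    show "pcas c ?p c"
      unfolding pcas.simps using pcas_snoc[OF p(3)] by simp
  qed
  moreover have "distinct (tl (pawalk_verts c ?p))"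
    using p(4) H.pawalk_verts_subset[OF p(1-3)] by (auto simp: pawalk_verts_snoc[OF p(3)] Hs)
  ultimately have "S.cycle ?p"
    unfolding S.cycle_def by blast
  moreover have "3 \<le> length ?p"
    using p(3) \<open>a \<noteq> b\<close> by (cases p) auto
  ultimately show False
    using acyc by blast
qed

section \<open>Edge ideals\<close>

definition arc_expo :: "('v \<Rightarrow> nat) \<Rightarrow> 'v \<Rightarrow> 'v \<Rightarrow> 'v \<Rightarrow>\<^sub>0 nat" where
  "arc_expo w x y = Poly_Mapping.single x 1 + Poly_Mapping.single y (w y)"

definition arc_expos :: "('v \<Rightarrow> nat) \<Rightarrow> 'v pair_pre_digraph \<Rightarrow> ('v \<Rightarrow>\<^sub>0 nat) set" where
  "arc_expos w G = (\<lambda>(x, y). arc_expo w x y) ` parcs G"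

lemma keys_arc_expo: "Poly_Mapping.keys (arc_expo w x y) \<subseteq> {x, y}"
  using keys_add[of "Poly_Mapping.single x 1" "Poly_Mapping.single y (w y)"]
  by (auto simp: arc_expo_def split: if_splits)

lemma lookup_arc_expo:
  "Poly_Mapping.lookup (arc_expo w x y) z = (if z = x then 1 else 0) + (if z = y then w y else 0)"
  by (auto simp: arc_expo_def lookup_add lookup_single when_def)

lemma keys_arc_expos:
  "(\<And>x y. (x, y) \<in> parcs G \<Longrightarrow> x \<in> V \<and> y \<in> V) \<Longrightarrow> t \<in> arc_expos w G \<Longrightarrow> Poly_Mapping.keys t \<subseteq> V"
  using keys_arc_expo[of w] by (fastforce simp: arc_expos_def)

lemma edge_ideal_eq_mon_ideal:
  assumes "\<And>x y. (x, y) \<in> parcs G \<Longrightarrow> x \<in> V \<and> y \<in> V"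
  shows "edge_ideal V G w = (mon_ideal V (arc_expos w G) :: ('v, 'k::field) mpoly set)"
proof -
  have "{arc_monomial w x y | x y. (x, y) \<in> parcs G} =
      (\<lambda>t. Poly_Mapping.single t 1 :: ('v, 'k) mpoly) ` arc_expos w G"
    by (auto simp: arc_expos_def arc_expo_def arc_monomial_def image_iff)
  then show ?thesis
    unfolding edge_ideal_def using keys_arc_expos[OF assms]
    by (simp add: ideal_gen_monomials)
qed

text \<open>The variables of the generator of an edge are its end points.\<close>

lemma edge_gen_inj:
  assumes "edge_gen G w v x = (edge_gen G w v y :: ('v, 'k::field) mpoly)"
    and "v \<noteq> x" "v \<noteq> y" "0 < w v" "0 < w x" "0 < w y"
  shows "x = y"
proof -
  have keys: "Poly_Mapping.keys (arc_expo w x y) = {x, y}" if "x \<noteq> y" "0 < w y" for x y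
    using that by (auto simp: in_keys_iff lookup_arc_expo split: if_splits)
  have *: "\<exists>t. edge_gen G w v z = (Poly_Mapping.single t 1 :: ('v, 'k) mpoly) \<and> Poly_Mapping.keys t = {v, z}"
    if "v \<noteq> z" "0 < w z" for z
  proof (cases "(v, z) \<in> parcs G")
    case True
    then show ?thesis
      using keys[of v z] that by (intro exI[of _ "arc_expo w v z"]) (simp add: edge_gen_def arc_monomial_def arc_expo_def)
  next
    case False
    then show ?thesis
      using keys[of z v] that \<open>0 < w v\<close>
      by (intro exI[of _ "arc_expo w z v"]) (auto simp: edge_gen_def arc_monomial_def arc_expo_def)
  qed
  obtain s t where "edge_gen G w v x = (Poly_Mapping.single s 1 :: ('v, 'k) mpoly)" "Poly_Mapping.keys s = {v, x}"
    "edge_gen G w v y = (Poly_Mapping.single t 1 :: ('v, 'k) mpoly)" "Poly_Mapping.keys t = {v, y}"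
    using *[OF assms(2,5)] *[OF assms(3,6)] by blast
  moreover from this have "Poly_Mapping.keys (Poly_Mapping.single s (1::'k)) = Poly_Mapping.keys (Poly_Mapping.single t (1::'k))"
    using assms(1) by simp
  ultimately have "{v, x} = {v, y}" by simp
  then show ?thesis
    using assms(2,3) by auto
qed

theorem theorem3p17:
  fixes T :: "'v pair_pre_digraph" and w :: "'v \<Rightarrow> nat" and x0 v :: 'v
    and vs ws :: "nat \<Rightarrow> 'v" and n k :: nat and r d :: int
    and V :: "'v set" and T1 T2 :: "'v pair_pre_digraph"
    and M :: "('v, 'k::field) mpoly set"
    and d' :: "('v, 'k) mpoly set \<Rightarrow> nat"
  assumes tree: "weighted_naturally_oriented_tree T w x0"
    and V_def: "V = pverts T"
    and v1_vertex: "vs 1 \<in> V"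
    and v1_max_rank: "\<forall>x\<in>V. graph_dist T x0 x \<le> graph_dist T x0 (vs 1)"
    and v_pred_v1: "(v, vs 1) \<in> parcs T"
    and v_neighbors: "bij_betw vs {1..n} (neighbors T v)"
    and vn_not_leaf: "\<not> leaf T (vs n)"
    and vi_leaf: "\<forall>i\<in>{1..<n}. leaf T (vs i)"
    and vn_neighbors: "bij_betw ws {1..k} (neighbors T (vs n) - {v})"
    and k_pos: "1 \<le> k"
    and wk_pred_vn: "(ws k, vs n) \<in> parcs T"
    and T1_def: "T1 = del_verts T {vs 1}"
    and T2_def: "T2 = del_verts T (insert v (vs ` {1..n}))"
    and M_def: "M = {edge_gen T w v (vs i) | i. i \<in> {2..n}}"
    and d'_def: "\<forall>S. d' S = 1 + w (vs 1)
        + (\<Sum>i | i \<in> {2..n} \<and> edge_gen T w v (vs i) \<in> S \<and> i \<noteq> n. w (vs i))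
        + (if edge_gen T w v (vs n) \<in> S then 1 else 0)"
    and w_v: "w v = 1"
  shows "graded_betti V (edge_ideal V T w :: ('v, 'k) mpoly set) r d =
    graded_betti V (edge_ideal V T1 w :: ('v, 'k) mpoly set) r d
    + (\<Sum>S\<in>Pow M. graded_betti V (edge_ideal V T2 w :: ('v, 'k) mpoly set)
         (r - (int (card S) + 1)) (d - int (d' S)))"
proof -
  interpret T: weighted_oriented_graph T w
    using tree by (simp add: weighted_naturally_oriented_tree_def)
  note pred_unique = natural_tree_unique_predecessor[OF tree]
  have neighbors_iff: "y \<in> neighbors T x \<longleftrightarrow> (x, y) \<in> parcs T \<or> (y, x) \<in> parcs T" for x y
    by (simp add: neighbors_def parcs_mk_symmetric_iff)
  have nbr: "neighbors T v = vs ` {1..n}" and inj: "inj_on vs {1..n}"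
    using v_neighbors by (auto simp: bij_betw_def)
  have "vs 1 \<in> vs ` {1..n}"
    using v_pred_v1 neighbors_iff nbr by blast
  then have n1: "1 \<le> n" by auto
  \<comment> \<open>\<open>v\<^sub>n\<close> already has the predecessor \<open>w\<^sub>k\<close>, so the edge between \<open>v\<close> and \<open>v\<^sub>n\<close> points to \<open>v\<close>.\<close>
  have "ws k \<noteq> v"
    using bij_betwE[OF vn_neighbors] k_pos by auto
  then have "(v, vs n) \<notin> parcs T"
    using pred_unique[OF _ wk_pred_vn] by metis
  moreover have "vs n \<in> neighbors T v"
    unfolding nbr using n1 by simp
  ultimately have vn_v: "(vs n, v) \<in> parcs T" and v_vn: "(v, vs n) \<notin> parcs T"
    by (auto simp: neighbors_iff)
  have "n \<noteq> 1"
    using v_pred_v1 v_vn by metis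
  then have n2: "2 \<le> n" using n1 by simp
  have v_vi: "(v, vs i) \<in> parcs T" if i: "1 \<le> i" "i < n" for i
  proof -
    have "vs i \<in> neighbors T v"
      unfolding nbr using i by simp
    moreover have "(vs i, v) \<notin> parcs T"
    proof
      assume "(vs i, v) \<in> parcs T"
      then have "vs i = vs n"
        by (rule pred_unique[OF _ vn_v])
      then show False
        using inj_onD[OF inj, of i n] i by simp
    qed
    ultimately show ?thesis
      by (auto simp: neighbors_iff)
  qed
  have leaf_nbr: "neighbors T (vs i) = {v}" if i: "1 \<le> i" "i < n" for i
  proof -
    have "card (neighbors T (vs i)) = 1"
      using vi_leaf i by (simp add: leaf_def)
    moreover have "v \<in> neighbors T (vs i)"
      using v_vi[OF i] by (simp add: neighbors_iff)
    ultimately show ?thesis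
      by (auto simp: card_1_singleton_iff)
  qed
  have from_leaf: "(vs i, y) \<notin> parcs T" if i: "1 \<le> i" "i < n" for i y
  proof
    assume "(vs i, y) \<in> parcs T"
    moreover from this have "y = v"
      using leaf_nbr[OF i] neighbors_iff by blast
    ultimately show False
      using T.oriented[OF v_vi[OF i]] by simp
  qed
  have to_leaf: "x = v" if i: "1 \<le> i" "i < n" and "(x, vs i) \<in> parcs T" for i x
    using pred_unique[OF that(3) v_vi[OF i]] .
  have from_v: "\<exists>i. 1 \<le> i \<and> i < n \<and> y = vs i" if vy: "(v, y) \<in> parcs T" for y
  proof -
    have "y \<in> neighbors T v"
      using vy neighbors_iff by blast
    then obtain i where "1 \<le> i" "i \<le> n" "y = vs i"
      unfolding nbr by auto
    then show ?thesis
      using vy v_vn by (cases "i = n") auto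
  qed
  have to_v: "x = vs n" if "(x, v) \<in> parcs T" for x
    using pred_unique[OF that vn_v] .
  have arcV: "x \<in> V \<and> y \<in> V" if "(x, y) \<in> parcs T" for x y
    using T.in_arcsD1[OF that] T.in_arcsD2[OF that] V_def by simp
  have wpos: "0 < w x" if "x \<in> V" for x
    using T.weight_pos that V_def by simp
  have vsV: "vs i \<in> V" if "1 \<le> i" "i \<le> n" for i
    using that arcV[OF vn_v] arcV[OF v_vi[of i]] by (cases "i = n") auto
  have vV: "v \<in> V" using arcV[OF vn_v] by simp
  have v_ne: "vs i \<noteq> v" if "1 \<le> i" "i \<le> n" for i
    using that T.pair_no_loops[OF vn_v] T.pair_no_loops[OF v_vi[of i]] by (cases "i = n") auto
  have vs_eq: "vs i = vs j \<longleftrightarrow> i = j" if "1 \<le> i" "i \<le> n" "1 \<le> j" "j \<le> n" for i j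
    using inj that by (auto simp: inj_on_eq_iff)

  have T1: "(x, y) \<in> parcs T1 \<longleftrightarrow> (x, y) \<in> parcs T \<and> x \<noteq> vs 1 \<and> y \<noteq> vs 1" for x y
    by (auto simp: T1_def del_verts_def)
  have T2: "(x, y) \<in> parcs T2 \<longleftrightarrow> (x, y) \<in> parcs T \<and> x \<notin> insert v (vs ` {1..n}) \<and> y \<notin> insert v (vs ` {1..n})" for x y
    by (auto simp: T2_def del_verts_def)
  let ?X1 = "arc_expos w T1" and ?X2 = "arc_expos w T2"
  let ?u = "Poly_Mapping.single v 1 :: 'v \<Rightarrow>\<^sub>0 nat"
  let ?q1 = "Poly_Mapping.single (vs 1) (w (vs 1)) :: 'v \<Rightarrow>\<^sub>0 nat"
  \<comment> \<open>\<open>q i\<close> is what remains of the generator of the edge between \<open>v\<close> and \<open>v\<^sub>i\<close> after cancelling \<open>v\<close>.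
    For \<open>i = n\<close> that generator is \<open>v\<^sub>n v\<close>, whatever the weight of \<open>v\<^sub>n\<close>.\<close>
  define q :: "nat \<Rightarrow> 'v \<Rightarrow>\<^sub>0 nat" where "q i = Poly_Mapping.single (vs i) (if i = n then 1 else w (vs i))" for i
  have arcs_T: "parcs T = insert (v, vs 1) (parcs T1)"
  proof (rule set_eqI)
    fix e :: "'v \<times> 'v"
    obtain x y where e: "e = (x, y)" by (cases e)
    have "x \<noteq> vs 1" if "(x, y) \<in> parcs T"
      using from_leaf[of 1 y] that n2 by auto
    moreover have "x = v" if "(x, y) \<in> parcs T" "y = vs 1"
      using to_leaf[of 1 x] that n2 by simp
    ultimately show "e \<in> parcs T \<longleftrightarrow> e \<in> insert (v, vs 1) (parcs T1)"
      unfolding e insert_iff T1 using v_pred_v1 by blast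
  qed
  have X: "arc_expos w T = insert (?u + ?q1) ?X1"
    by (simp add: arc_expos_def arcs_T arc_expo_def)
  have arcV1: "x \<in> V \<and> y \<in> V" if "(x, y) \<in> parcs T1" for x y
    using that T1[of x y] arcV[of x y] by simp
  have arcV2: "x \<in> V \<and> y \<in> V" if "(x, y) \<in> parcs T2" for x y
    using that T2[of x y] arcV[of x y] by simp
  have finX1: "finite ?X1"
    using T.pair_finite_arcs by (simp add: arc_expos_def arcs_T)
  have keysX1: "Poly_Mapping.keys t \<subseteq> V - {vs 1}" if "t \<in> ?X1" for t
    by (rule keys_arc_expos[OF _ that]) (use T1 arcV in auto)
  have finX2: "finite ?X2"
  proof -
    have "parcs T2 \<subseteq> parcs T" using T2 by auto
    then show ?thesis
      using T.pair_finite_arcs by (simp add: arc_expos_def finite_subset)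
  qed
  have keysX2: "Poly_Mapping.keys t \<subseteq> V - insert v (vs ` {1..n})" if "t \<in> ?X2" for t
    by (rule keys_arc_expos[OF _ that]) (use T2 arcV in auto)

  \<comment> \<open>The left-hand side is \<open>J : v\<close>; each generator on one side is a multiple of one on the other.\<close>
  have colon: "mon_ideal V ((\<lambda>x. x - ?u) ` ?X1) = (mon_ideal V (?X2 \<union> q ` {2..n}) :: ('v, 'k) mpoly set)"
  proof (rule mon_ideal_cong)
    fix t assume "t \<in> (\<lambda>x. x - ?u) ` ?X1"
    then obtain x y where xy: "(x, y) \<in> parcs T" "x \<noteq> vs 1" "y \<noteq> vs 1" and t: "t = arc_expo w x y - ?u"
      using T1 by (auto simp: arc_expos_def)
    have lt: "Poly_Mapping.lookup t z = (if z = x then 1 else 0) + (if z = y then w y else 0) - (if z = v then 1 else 0)" for z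
      by (simp add: t lookup_minus lookup_arc_expo lookup_single when_def)
    consider (v) i where "2 \<le> i" "i < n" "x = v" "y = vs i" | (xn) "x = vs n" | (yn) "y = vs n"
      | (inT2) "(x, y) \<in> parcs T2"
    proof (cases "x = v")
      case True
      then obtain i where "1 \<le> i" "i < n" "y = vs i"
        using from_v xy(1) by blast
      moreover have "i \<noteq> 1" using xy(3) calculation by metis
      ultimately show ?thesis using v[of i] True by simp
    next
      case False
      have x: "x = vs n" if x_nbr: "x \<in> vs ` {1..n}"
      proof -
        obtain i where "1 \<le> i" "i \<le> n" "x = vs i"
          using x_nbr by auto
        then show ?thesis
          using from_leaf[of i y] xy(1) by (cases "i = n") auto
      qed
      have y: "y = vs n" if y_nbr: "y \<in> vs ` {1..n}"
      proof -
        obtain i where "1 \<le> i" "i \<le> n" "y = vs i"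
          using y_nbr by auto
        then show ?thesis
          using to_leaf[of i x] xy(1) False by (cases "i = n") auto
      qed
      show ?thesis
      proof (cases "x = vs n \<or> y = vs n")
        case True
        then show ?thesis using xn yn by blast
      next
        case nn: False
        have "y \<noteq> v" using to_v[of x] xy(1) nn by blast
        then show ?thesis
          using inT2 x y nn False xy(1) unfolding T2[of x y] by blast
      qed
    qed
    then show "\<exists>y\<in>?X2 \<union> q ` {2..n}. mono_dvd y t"
    proof cases
      case v
      have "mono_dvd (q i) t"
        using v v_ne[of i] by (auto simp: mono_dvd_def q_def lt lookup_single when_def)
      then show ?thesis using v by (intro bexI[of _ "q i"]) auto
    next
      case xn
      have "mono_dvd (q n) t"
        using xn v_ne[of n] n2 by (auto simp: mono_dvd_def q_def lt lookup_single when_def)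
      then show ?thesis using n2 by (intro bexI[of _ "q n"]) auto
    next
      case yn
      have "mono_dvd (q n) t"
        using yn v_ne[of n] n2 wpos[of y] arcV[OF xy(1)]
        by (auto simp: mono_dvd_def q_def lt lookup_single when_def)
      then show ?thesis using n2 by (intro bexI[of _ "q n"]) auto
    next
      case inT2
      then have "arc_expo w x y \<in> ?X2" "x \<noteq> v" "y \<noteq> v"
        using T2 by (force simp: arc_expos_def)+
      moreover from this have "mono_dvd (arc_expo w x y) t"
        by (auto simp: mono_dvd_def lookup_arc_expo lt)
      ultimately show ?thesis by blast
    qed
  next
    fix t assume "t \<in> ?X2 \<union> q ` {2..n}"
    then consider (X2) x y where "(x, y) \<in> parcs T2" "t = arc_expo w x y"
      | (q) i where "2 \<le> i" "i < n" "t = q i" | (qn) "t = q n"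
    proof
      assume "t \<in> ?X2"
      then obtain x y where "(x, y) \<in> parcs T2" "t = arc_expo w x y"
        by (auto simp: arc_expos_def)
      then show ?thesis by (rule X2)
    next
      assume "t \<in> q ` {2..n}"
      then obtain i where "2 \<le> i" "i \<le> n" "t = q i" by auto
      then show ?thesis
        using q[of i] qn by (cases "i = n") auto
    qed
    then show "\<exists>s\<in>(\<lambda>x. x - ?u) ` ?X1. mono_dvd s t"
    proof cases
      case X2
      then have "arc_expo w x y \<in> ?X1"
        using T1 T2 n1 by (force simp: arc_expos_def)
      moreover have "mono_dvd (arc_expo w x y - ?u) t"
        by (simp add: X2 mono_dvd_def lookup_minus)
      ultimately show ?thesis by blast
    next
      case q
      have "(v, vs i) \<in> parcs T1"
        using T1 v_vi[of i] q vs_eq[of i 1] v_ne[of 1] n1 by auto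
      then have "arc_expo w v (vs i) \<in> ?X1"
        by (force simp: arc_expos_def)
      moreover have "mono_dvd (arc_expo w v (vs i) - ?u) t"
        using q by (auto simp: mono_dvd_def q_def lookup_minus lookup_arc_expo lookup_single when_def)
      ultimately show ?thesis by blast
    next
      case qn
      have "(vs n, v) \<in> parcs T1"
        using T1 vn_v vs_eq[of n 1] v_ne[of 1] n2 by auto
      then have "arc_expo w (vs n) v \<in> ?X1"
        by (force simp: arc_expos_def)
      moreover have "mono_dvd (arc_expo w (vs n) v - ?u) t"
        using w_v by (auto simp: qn mono_dvd_def q_def lookup_minus lookup_arc_expo lookup_single when_def)
      ultimately show ?thesis by blast
    qed
  qed

  let ?B = "graded_betti V (edge_ideal V T2 w :: ('v, 'k) mpoly set)"
  have I: "edge_ideal V T w = (mon_ideal V (insert (?u + ?q1) ?X1) :: ('v, 'k) mpoly set)"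
    unfolding X[symmetric] by (rule edge_ideal_eq_mon_ideal[OF arcV])
  have I1: "edge_ideal V T1 w = (mon_ideal V ?X1 :: ('v, 'k) mpoly set)"
    by (rule edge_ideal_eq_mon_ideal[OF arcV1])
  have I2: "edge_ideal V T2 w = (mon_ideal V ?X2 :: ('v, 'k) mpoly set)"
    by (rule edge_ideal_eq_mon_ideal[OF arcV2])
  have q1: "Poly_Mapping.keys ?q1 = {vs 1}"
    using wpos[OF v1_vertex] by simp
  have keys_q: "Poly_Mapping.keys (q i) = {vs i}" if "i \<in> {2..n}" for i
    using that wpos[OF vsV[of i]] by (simp add: q_def)
  have "graded_betti V (edge_ideal V T w :: ('v, 'k) mpoly set) r d =
      graded_betti V (edge_ideal V T1 w :: ('v, 'k) mpoly set) r d +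
      graded_betti V (mon_ideal V ((\<lambda>x. x - ?u) ` ?X1) :: ('v, 'k) mpoly set) (r - 1) (d - int (monom_deg (?u + ?q1)))"
    unfolding I I1
  proof (rule graded_betti_mon_ideal_insert[OF finX1])
    show "?q1 \<noteq> 0" using q1 by fastforce
    show "Poly_Mapping.keys x \<subseteq> V" "Poly_Mapping.keys x \<inter> Poly_Mapping.keys ?q1 = {}" if "x \<in> ?X1" for x
      using keysX1[OF that] unfolding q1 by blast+
    show "Poly_Mapping.keys ?u \<subseteq> V" "Poly_Mapping.keys ?q1 \<subseteq> V"
      using vV v1_vertex unfolding q1 by simp_all
  qed
  also have "graded_betti V (mon_ideal V ((\<lambda>x. x - ?u) ` ?X1) :: ('v, 'k) mpoly set) (r - 1) (d - int (monom_deg (?u + ?q1)))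
      = (\<Sum>S\<in>Pow {2..n}. ?B (r - 1 - int (card S)) (d - int (monom_deg (?u + ?q1)) - int (\<Sum>i\<in>S. monom_deg (q i))))"
    unfolding colon I2
  proof (rule graded_betti_regular_monomials[OF finX2])
    show "Poly_Mapping.keys x \<subseteq> V" if "x \<in> ?X2" for x
      using keysX2[OF that] by blast
    show "Poly_Mapping.keys (q i) \<subseteq> V" "q i \<noteq> 0" if "i \<in> {2..n}" for i
      using keys_q[OF that] vsV[of i] that by auto
    show "Poly_Mapping.keys x \<inter> Poly_Mapping.keys (q i) = {}" if "i \<in> {2..n}" "x \<in> ?X2" for i x
      using keysX2[OF that(2)] keys_q[OF that(1)] that(1) by auto
    show "Poly_Mapping.keys (q i) \<inter> Poly_Mapping.keys (q j) = {}" if "i \<in> {2..n}" "j \<in> {2..n}" "i \<noteq> j" for i j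
      using keys_q that vs_eq[of i j] by auto
  qed simp
  also have "\<dots> = (\<Sum>S\<in>Pow M. ?B (r - (int (card S) + 1)) (d - int (d' S)))"
  proof -
    \<comment> \<open>Subsets of \<open>M\<close> correspond to subsets of \<open>{2..n}\<close>, as distinct neighbors give distinct generators.\<close>
    define g where "g i = (edge_gen T w v (vs i) :: ('v, 'k) mpoly)" for i
    have g_inj: "inj_on g {2..n}"
    proof (rule inj_onI)
      fix i j assume ij: "i \<in> {2..n}" "j \<in> {2..n}" "g i = g j"
      have "vs i = vs j"
        using ij(3) unfolding g_def
        by (rule edge_gen_inj) (use ij v_ne[of i] v_ne[of j] wpos vsV[of i] vsV[of j] w_v in auto)
      then show "i = j"
        using vs_eq[of i j] ij by auto
    qed
    have M: "M = g ` {2..n}"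
      by (auto simp: M_def g_def)
    have bij: "bij_betw (image g) (Pow {2..n}) (Pow M)"
      unfolding M by (rule bij_betw_Pow[OF inj_on_imp_bij_betw[OF g_inj]])
    have summand: "?B (r - 1 - int (card S)) (d - int (monom_deg (?u + ?q1)) - int (\<Sum>i\<in>S. monom_deg (q i))) =
        ?B (r - (int (card (g ` S)) + 1)) (d - int (d' (g ` S)))" if S: "S \<in> Pow {2..n}" for S
    proof -
      have finS: "finite S"
        using S finite_subset[of S "{2..n}"] by simp
      have card: "card (g ` S) = card S"
        using S by (intro card_image inj_on_subset[OF g_inj]) auto
      have mem: "g i \<in> g ` S \<longleftrightarrow> i \<in> S" if "i \<in> {2..n}" for i
        using inj_on_image_mem_iff[OF g_inj that] S by blast
      have "{i. i \<in> {2..n} \<and> edge_gen T w v (vs i) \<in> g ` S \<and> i \<noteq> n} = S - {n}"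
      proof (rule set_eqI)
        fix i show "i \<in> {i. i \<in> {2..n} \<and> edge_gen T w v (vs i) \<in> g ` S \<and> i \<noteq> n} \<longleftrightarrow> i \<in> S - {n}"
          using mem[of i] S unfolding g_def[of i] by blast
      qed
      moreover have "edge_gen T w v (vs n) \<in> g ` S \<longleftrightarrow> n \<in> S"
        using mem[of n] n2 unfolding g_def[of n] by simp
      ultimately have "d' (g ` S) = 1 + w (vs 1) + (\<Sum>i\<in>S - {n}. w (vs i)) + (if n \<in> S then 1 else 0)"
        unfolding d'_def[rule_format] by simp
      moreover have "(\<Sum>i\<in>S. monom_deg (q i)) = (\<Sum>i\<in>S - {n}. w (vs i)) + (if n \<in> S then 1 else 0)"
      proof -
        have "(\<Sum>i\<in>S - {n}. monom_deg (q i)) = (\<Sum>i\<in>S - {n}. w (vs i))"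
          by (rule sum.cong) (auto simp: q_def)
        then show ?thesis
          using finS by (cases "n \<in> S") (simp_all add: sum.remove[of S n] q_def)
      qed
      moreover have "monom_deg (?u + ?q1) = 1 + w (vs 1)"
        by (simp add: monom_deg_add)
      ultimately have "int (d' (g ` S)) = int (monom_deg (?u + ?q1)) + int (\<Sum>i\<in>S. monom_deg (q i))"
        by simp
      then have "d - int (monom_deg (?u + ?q1)) - int (\<Sum>i\<in>S. monom_deg (q i)) = d - int (d' (g ` S))"
        by linarith
      moreover have "r - 1 - int (card S) = r - (int (card (g ` S)) + 1)"
        by (simp add: card)
      ultimately show ?thesis by (simp only:)
    qed
    have "(\<Sum>S\<in>Pow {2..n}. ?B (r - 1 - int (card S)) (d - int (monom_deg (?u + ?q1)) - int (\<Sum>i\<in>S. monom_deg (q i))))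
        = (\<Sum>S\<in>Pow {2..n}. ?B (r - (int (card (g ` S)) + 1)) (d - int (d' (g ` S))))"
      by (rule sum.cong[OF refl summand])
    also have "\<dots> = (\<Sum>S\<in>Pow M. ?B (r - (int (card S) + 1)) (d - int (d' S)))"
      by (rule sum.reindex_bij_betw[OF bij])
    finally show ?thesis .
  qed
  finally show ?thesis .
qed

end
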